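(* Let $\Gamma\subset\mathbb Q^*$ be a finitely generated multiplicative subgroup of rank $r\ge1$ and let $m\in\mathbb N$. Then $$\rho(\Gamma,m) = A(\Gamma,m)\left( B_{\Gamma,m}-\frac{|\Gamma(m_2)|}{(2,m)\,|\Gamma(2m_2)|}\,B_{\Gamma,2m}\right),$$ where $A(\Gamma,m)$, $B_{\Gamma,k}$, $\Gamma(\cdot)$ and $\rho(\Gamma,m)$ are as defined in the context.
   Context: Throughout, $\ell$ denotes a prime, $v_\ell$ the $\ell$-adic valuation, $m_\ell=\ell^{v_\ell(m)}$ the $\ell$-part of $m$, $(a,b)=\gcd(a,b)$, $\mu$ the Möbius function, $\varphi$ Euler's function, and $\zeta_d=e^{2\pi i/d}$. For $d\in\mathbb N$ put $\Gamma(d)=\Gamma\cdot{\mathbb Q^*}^d/{\mathbb Q^*}^d$ (a finite group), and $\Gamma^{1/d}=\{\alpha\in\mathbb R:\alpha^d\in\Gamma\}$. Define $$\rho(\Gamma,m)=\sum_{k\ge1}\frac{\mu(k)}{[\mathbb Q(\zeta_{mk},\Gamma^{1/mk}):\mathbb Q]}$$ (under GRH this is the density of primes $p$ not dividing any element of $\Gamma$'s numerators/denominators for which $[\mathbb F_p^*:\Gamma_p]=m$, $\Gamma_p$ being the reduction of $\Gamma$ mod $p$). For $\gamma\in\Gamma(d)$, let $\gamma'\in\mathbb Z$ be the unique (up to sign) $d$-th-power-free integer with $\gamma=\gamma'{\mathbb Q^*}^d$; its sign is positive if $d$ is odd or if $\gamma\subset\mathbb Q^+$, and negative otherwise. If $\alpha\ge1$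 and $\gamma$ is a nontrivial element of the $2$-torsion subgroup $\Gamma(2^\alpha)[2]$, then $\gamma'=\pm\gamma_0^{2^{\alpha-1}}$ with $\gamma_0>1$ a squarefree positive integer, and one sets $\delta(\gamma)=\operatorname{disc}\mathbb Q(\sqrt{\gamma_0})$; for the trivial element set $\delta=1$. Define $$\tilde\Gamma(m)=\left\{\gamma\in\Gamma(m_2)[2]:\ \text{if }\gamma\subset\mathbb Q^+\text{ then }v_2(\delta(\gamma))\le v_2(m);\ \text{if }\gamma\not\subseteq\mathbb Q^+\text{ then }v_2(\delta(\gamma))=v_2(m)+1\right\}$$ (for $m$ odd, $\Gamma(m_2)=\Gamma(1)$ is trivial), $$A(\Gamma,m)=\frac1{\varphi(m)|\Gamma(m)|}\prod_{\substack{\ell>2\\ \ell\mid m}}\left(1-\frac{|\Gamma(m_\ell)|}{\ell|\Gamma(\ell m_\ell)|}\right)\prod_{\substack{\ell>2\\ \ell\nmid m}}\left(1-\frac1{(\ell-1)|\Gamma(\ell)|}\right),$$ $$B_{\Gamma,k}=\sum_{\gamma\in\tilde\Gamma(k)}\ \prod_{\substack{\ell\mid\delta(\gamma)\\ \ell\nmid k}}\frac{-1}{(\ell-1)|\Gamma(\ell)|-1}.$$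
   Formalization: The roots in Γ^{1/d} are complex, not real: with real roots the formula fails, e.g. Γ=⟨-2⟩, m=1. For odd m the trivial class counts as positive in Γ̃(m), and the class of -1 has γ₀=1, δ=1. Convergence of the series and the product is also asserted. *)

theory Defs
  imports
    "HOL-Analysis.Infinite_Products"
    "HOL-Algebra.Algebraic_Closure_Type"
    "HOL-Algebra.Generated_Fields"
    "HOL-Number_Theory.Totient"
    "HOL-Computational_Algebra.Squarefree"
    "Jordan_Normal_Form.Determinant"
begin

section \<open>Subgroups of the multiplicative group of the rationals\<close>

abbreviation Qstar :: "rat monoid" where
  "Qstar \<equiv> Multiplicative_Group.mult_of (ring_of_type_algebra :: rat ring)"

definition finitely_generated_subgroup :: "rat set \<Rightarrow> bool" where
  "finitely_generated_subgroup \<Gamma> \<longleftrightarrow>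
     (\<exists>S. finite S \<and> S \<subseteq> carrier Qstar \<and> \<Gamma> = generate Qstar S)"

definition mult_independent :: "rat set \<Rightarrow> bool" where
  "mult_independent S \<longleftrightarrow>
     (\<forall>e :: rat \<Rightarrow> int. (\<Prod>s\<in>S. s powi e s) = 1 \<longrightarrow> (\<forall>s\<in>S. e s = 0))"

text \<open>The rank of an abelian group is the maximal size of an independent subset.\<close>

definition has_rank :: "rat set \<Rightarrow> nat \<Rightarrow> bool" where
  "has_rank \<Gamma> r \<longleftrightarrow>
     (\<exists>S\<subseteq>\<Gamma>. finite S \<and> mult_independent S \<and> card S = r) \<and>
     (\<forall>S\<subseteq>\<Gamma>. finite S \<longrightarrow> mult_independent S \<longrightarrow> card S \<le> r)"

definition Qstar_pow :: "nat \<Rightarrow> rat set" where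
  "Qstar_pow d = {x ^ d | x. x \<noteq> 0}"

text \<open>\<open>Gamma_mod \<Gamma> d\<close> is the quotient of \<open>\<Gamma> Q*^d\<close> by \<open>Q*^d\<close>; its elements are
  cosets, that is, subsets of the nonzero rationals.\<close>

definition Gamma_mod :: "rat set \<Rightarrow> nat \<Rightarrow> rat set monoid" where
  "Gamma_mod \<Gamma> d = (Qstar\<lparr>carrier := \<Gamma> <#>\<^bsub>Qstar\<^esub> Qstar_pow d\<rparr>) Mod Qstar_pow d"

definition two_torsion :: "('a, 'b) monoid_scheme \<Rightarrow> 'a set" where
  "two_torsion G = {x \<in> carrier G. x [^]\<^bsub>G\<^esub> (2::nat) = \<one>\<^bsub>G\<^esub>}"

section \<open>Number fields inside the complex numbers\<close>

abbreviation CC :: "complex ring" where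
  "CC \<equiv> ring_of_type_algebra"

text \<open>The subfield of the complex numbers generated by \<open>S\<close> contains the rationals, so this
  is the extension of the rationals generated by \<open>S\<close>.\<close>

definition Q_adjoin :: "complex set \<Rightarrow> complex set" where
  "Q_adjoin S = generate_field CC S"

definition degree_over_Q :: "complex set \<Rightarrow> nat" where
  "degree_over_Q K = ring.dim CC \<rat> K"

definition embeddings :: "complex set \<Rightarrow> (complex \<Rightarrow> complex) set" where
  "embeddings K = Ring.ring_hom (CC\<lparr>carrier := K\<rparr>) CC \<inter> extensional K"

definition integral_basis :: "complex set \<Rightarrow> nat \<Rightarrow> (nat \<Rightarrow> complex) \<Rightarrow> bool" where
  "integral_basis K n \<omega> \<longleftrightarrow>
     {x \<in> K. algebraic_int x} = range (\<lambda>c :: nat \<Rightarrow> int. \<Sum>i<n. of_int (c i) * \<omega> i) \<and>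
     (\<forall>c :: nat \<Rightarrow> int. (\<Sum>i<n. of_int (c i) * \<omega> i) = 0 \<longrightarrow> (\<forall>i<n. c i = 0))"

text \<open>The field discriminant: the square of the determinant of all embeddings evaluated at
  an integral basis. It is independent of the basis and of both enumerations.\<close>

definition field_disc :: "complex set \<Rightarrow> int" where
  "field_disc K = (THE D. \<exists>n \<omega> \<sigma>.
     integral_basis K n \<omega> \<and> bij_betw \<sigma> {..<n} (embeddings K) \<and>
     of_int D = (Determinant.det (Matrix.mat n n (\<lambda>(i, j). \<sigma> i (\<omega> j)))) ^ 2)"

text \<open>Roots are taken in the complex numbers: with real roots only, negative elements of
  \<open>\<Gamma>\<close> would be lost for even \<open>d\<close>.\<close>

definition roots_of :: "rat set \<Rightarrow> nat \<Rightarrow> complex set" where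
  "roots_of \<Gamma> d = {\<alpha>. \<alpha> ^ d \<in> of_rat ` \<Gamma>}"

definition zeta :: "nat \<Rightarrow> complex" where
  "zeta d = cis (2 * pi / real d)"

section \<open>The density\<close>

definition moebius :: "nat \<Rightarrow> int" where
  "moebius n = (if squarefree n then (- 1) ^ card (prime_factors n) else 0)"

definition rho_term :: "rat set \<Rightarrow> nat \<Rightarrow> nat \<Rightarrow> real" where
  "rho_term \<Gamma> m k =
     of_int (moebius k) / real (degree_over_Q (Q_adjoin (insert (zeta (m * k)) (roots_of \<Gamma> (m * k)))))"

definition rho :: "rat set \<Rightarrow> nat \<Rightarrow> real" where
  "rho \<Gamma> m = (\<Sum>k. rho_term \<Gamma> m (Suc k))"

section \<open>Representatives of cosets and the discriminant attached to a 2-torsion element\<close>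

text \<open>For odd \<open>d\<close> every coset of \<open>Q*^d\<close> contains rationals of both signs, and its
  representative is chosen positive, so every coset counts as positive. In particular the trivial
  coset modulo \<open>Q*^1\<close> is positive, although it is not a set of positive rationals.\<close>

definition pos_coset :: "nat \<Rightarrow> rat set \<Rightarrow> bool" where
  "pos_coset d \<gamma> \<longleftrightarrow> odd d \<or> \<gamma> \<subseteq> {0<..}"

definition power_free :: "nat \<Rightarrow> int \<Rightarrow> bool" where
  "power_free d n \<longleftrightarrow> n \<noteq> 0 \<and> (\<forall>p. Factorial_Ring.prime p \<longrightarrow> \<not> p ^ d dvd n)"

definition coset_rep :: "nat \<Rightarrow> rat set \<Rightarrow> int" where
  "coset_rep d \<gamma> = (THE n. power_free d n \<and> \<gamma> = Qstar_pow d #>\<^bsub>Qstar\<^esub> of_int n \<and>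
     (0 < n \<longleftrightarrow> pos_coset d \<gamma>))"

text \<open>Used for \<open>d = 2 ^ \<alpha>\<close> with \<open>\<alpha> \<ge> 1\<close>, so that \<open>d div 2 = 2 ^ (\<alpha> - 1)\<close>. The coset
  of \<open>-1\<close> has \<open>sqfree_root d \<gamma> = 1\<close>.\<close>

definition sqfree_root :: "nat \<Rightarrow> rat set \<Rightarrow> nat" where
  "sqfree_root d \<gamma> = (THE g. squarefree g \<and>
     (coset_rep d \<gamma> = int g ^ (d div 2) \<or> coset_rep d \<gamma> = - (int g ^ (d div 2))))"

definition delta :: "nat \<Rightarrow> rat set \<Rightarrow> int" where
  "delta d \<gamma> = (if \<gamma> = Qstar_pow d then 1
     else field_disc (Q_adjoin {complex_of_real (sqrt (real (sqfree_root d \<gamma>)))}))"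

section \<open>The constants in the density formula\<close>

definition prime_part :: "nat \<Rightarrow> nat \<Rightarrow> nat" where
  "prime_part l m = l ^ multiplicity l m"

definition Gamma_tilde :: "rat set \<Rightarrow> nat \<Rightarrow> rat set set" where
  "Gamma_tilde \<Gamma> m = {\<gamma> \<in> two_torsion (Gamma_mod \<Gamma> (prime_part 2 m)).
     (if pos_coset (prime_part 2 m) \<gamma>
      then multiplicity 2 (delta (prime_part 2 m) \<gamma>) \<le> multiplicity 2 m
      else multiplicity 2 (delta (prime_part 2 m) \<gamma>) = multiplicity 2 m + 1)}"

definition A_factor :: "rat set \<Rightarrow> nat \<Rightarrow> nat \<Rightarrow> real" where
  "A_factor \<Gamma> m l = (if Factorial_Ring.prime l \<and> l > 2 \<and> \<not> l dvd m
     then 1 - 1 / ((real l - 1) * real (Coset.order (Gamma_mod \<Gamma> l))) else 1)"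

definition A_const :: "rat set \<Rightarrow> nat \<Rightarrow> real" where
  "A_const \<Gamma> m =
     1 / (real (totient m) * real (Coset.order (Gamma_mod \<Gamma> m))) *
     (\<Prod>l | Factorial_Ring.prime l \<and> l > 2 \<and> l dvd m.
        1 - real (Coset.order (Gamma_mod \<Gamma> (prime_part l m)))
            / (real l * real (Coset.order (Gamma_mod \<Gamma> (l * prime_part l m))))) *
     (\<Prod>l. A_factor \<Gamma> m l)"

definition B_const :: "rat set \<Rightarrow> nat \<Rightarrow> real" where
  "B_const \<Gamma> k = (\<Sum>\<gamma>\<in>Gamma_tilde \<Gamma> k.
     \<Prod>l | Factorial_Ring.prime l \<and> int l dvd delta (prime_part 2 k) \<gamma> \<and> \<not> l dvd k.
       - 1 / ((real l - 1) * real (Coset.order (Gamma_mod \<Gamma> l)) - 1))"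

end

theory Submission
  imports
    Defs
    "Jordan_Normal_Form.Char_Poly"
    "HOL-Analysis.Infinite_Sum"
begin

text \<open>
  Without entanglement, adjoining to the rationals the complex \<open>n\<close>-th roots of all elements of \<open>\<Gamma>\<close>
  would give degree \<open>\<phi>(n) |\<Gamma>(n)|\<close>. By Kummer theory the true degree is smaller by the
  number of cosets in \<open>\<Gamma>(n)\<close> that become trivial over the \<open>n\<close>-th cyclotomic field. A root
  of a rational that lies in a cyclotomic field is, up to a root of unity and a rational factor, the
  square root of a squarefree \<open>d\<close>, so only 2-torsion cosets occur. Since \<open>\<surd>d\<close> lies in the \<open>n\<close>-th cyclotomic field
  exactly if its discriminant divides \<open>n\<close>, they are those \<open>\<gamma>\<close> in \<open>\<Gamma>~(n)\<close> for which all odd prime divisors of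
  \<open>\<delta>(\<gamma>)\<close> divide \<open>n\<close>; for negative \<open>\<gamma>\<close> the factor is a root of unity of order a power of 2 outside
  the field, which explains the second clause of \<open>\<Gamma>~(n)\<close>.

  With \<open>n = m k\<close>, the odd \<open>k\<close> contribute a sum over \<open>\<gamma>\<close> in \<open>\<Gamma>~(m)\<close> of the multiplicative function
  \<open>\<mu>(k) / (\<phi>(m k) |\<Gamma>(m k)|)\<close> restricted to the \<open>k\<close> divisible by the primes of \<open>\<delta>(\<gamma>)\<close> outside \<open>m\<close>; its Euler
  product is \<open>A(\<Gamma>, m)\<close> times the factor of \<open>\<gamma>\<close> in \<open>B\<^bsub>\<Gamma>,m\<^esub>\<close>. The even \<open>k = 2 j\<close> contribute minus the
  same sum for \<open>2 m\<close>. Convergence uses that the rank is positive, which makes \<open>|\<Gamma>(d)|\<close> grow linearly in \<open>d\<close>.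
\<close>

subsection \<open>Cosets in the group of nonzero rationals\<close>

text \<open>No Galois groups occur: automorphisms are replaced by homomorphisms from a subfield into
  the complex numbers. An algebraic number outside \<open>K\<close> can be moved while
  \<open>K\<close> stays fixed, and every positive \<open>a\<close> coprime to \<open>n\<close>
  gives a homomorphism with \<open>zeta n\<close> sent to \<open>zeta n ^ a\<close>. Both the
  independence of radicals and the proof that a square root is not cyclotomic rest on moving
  elements in this way. The set \<Gamma>~(n) constrains only the prime 2, so it does not change when
  n is multiplied by an odd k; this is why the sum over odd k splits into finitely many Euler
  products. Put x = 1/((l-1)|\<Gamma>(l)|). A prime l of \<delta>(\<gamma>) outside m must divide k,
  so its Euler factor is -x instead of 1 - x, and the ratio -x/(1-x) is the factor
  -1/((l-1)|\<Gamma>(l)|-1) in B. The coefficient of the second B is A(\<Gamma>,2m)/A(\<Gamma>,m):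
  the products in A run over odd primes, so only the prefactor changes. Linear growth of
  |\<Gamma>(d)| comes from the powers of a single element of absolute value different from 1, and
  makes x of size at most a constant times 1/l^2.\<close>

lemma ring_of_type_algebra_simps [simp]:
  "carrier (ring_of_type_algebra :: 'a :: comm_ring_1 ring) = UNIV"
  "x \<otimes>\<^bsub>ring_of_type_algebra\<^esub> y = x * y" "x \<oplus>\<^bsub>ring_of_type_algebra\<^esub> y = x + y"
  "\<one>\<^bsub>ring_of_type_algebra\<^esub> = 1" "\<zero>\<^bsub>ring_of_type_algebra\<^esub> = 0"
  by (simp_all add: ring_of_type_algebra_def)

lemma group_Qstar: "group Qstar"
  by (rule field.field_mult_group) (rule field_from_type_algebra)

lemma Qstar_inv [simp]: "x \<noteq> 0 \<Longrightarrow> inv\<^bsub>Qstar\<^esub> x = inverse x"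
  using group.inv_equality[OF group_Qstar, of "inverse x" x] by simp

lemma
  assumes "subgroup P Qstar"
  shows subgroup_Qstar_nonzero: "x \<in> P \<Longrightarrow> x \<noteq> 0"
    and subgroup_Qstar_1: "1 \<in> P"
    and subgroup_Qstar_mult: "x \<in> P \<Longrightarrow> y \<in> P \<Longrightarrow> x * y \<in> P"
    and subgroup_Qstar_inverse: "x \<in> P \<Longrightarrow> inverse x \<in> P"
proof -
  show nz: "x \<noteq> 0" if "x \<in> P" for x using subgroup.subset[OF assms] that by auto
  show "1 \<in> P" using subgroup.one_closed[OF assms] by simp
  show "x \<in> P \<Longrightarrow> y \<in> P \<Longrightarrow> x * y \<in> P" using subgroup.m_closed[OF assms, of x y] by simp
  show "x \<in> P \<Longrightarrow> inverse x \<in> P" using subgroup.m_inv_closed[OF assms, of x] nz[of x] by simp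
qed

context
  fixes P assumes P: "subgroup P Qstar"
begin

lemma subgroup_Qstar_divide: "x \<in> P \<Longrightarrow> y \<in> P \<Longrightarrow> x / y \<in> P"
  by (simp add: divide_inverse subgroup_Qstar_mult[OF P] subgroup_Qstar_inverse[OF P])

lemma subgroup_Qstar_power: "x \<in> P \<Longrightarrow> x ^ n \<in> P"
  by (induction n) (auto intro: subgroup_Qstar_1[OF P] subgroup_Qstar_mult[OF P])

lemma subgroup_Qstar_power_int: "x \<in> P \<Longrightarrow> x powi n \<in> P"
  by (auto simp: power_int_def intro: subgroup_Qstar_power subgroup_Qstar_inverse[OF P])

end

lemma subgroup_QstarI:
  assumes "1 \<in> P" "\<And>x. x \<in> P \<Longrightarrow> x \<noteq> 0" "\<And>x y. x \<in> P \<Longrightarrow> y \<in> P \<Longrightarrow> x * y \<in> P"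
    "\<And>x. x \<in> P \<Longrightarrow> inverse x \<in> P"
  shows "subgroup P Qstar"
  by (rule group.subgroupI[OF group_Qstar]) (use assms in auto)

lemma subgroup_Qstar_pow: "subgroup (Qstar_pow d) Qstar"
proof (rule subgroup_QstarI)
  show "x * y \<in> Qstar_pow d" if "x \<in> Qstar_pow d" "y \<in> Qstar_pow d" for x y
    using that by (auto simp: Qstar_pow_def simp flip: power_mult_distrib)
  show "inverse x \<in> Qstar_pow d" if "x \<in> Qstar_pow d" for x
    using that by (auto simp: Qstar_pow_def simp flip: power_inverse)
  show "1 \<in> Qstar_pow d" unfolding Qstar_pow_def by (rule CollectI, rule exI[of _ 1]) simp
qed (auto simp: Qstar_pow_def)

lemma Qstar_powI: "x \<noteq> 0 \<Longrightarrow> x ^ d \<in> Qstar_pow d"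
  by (auto simp: Qstar_pow_def)

abbreviation qcoset :: "rat set \<Rightarrow> rat \<Rightarrow> rat set" where
  "qcoset P g \<equiv> P #>\<^bsub>Qstar\<^esub> g"

lemma qcoset_def': "qcoset P g = (\<lambda>x. x * g) ` P"
  by (auto simp: r_coset_def)

lemma qcoset_eq_iff:
  assumes P: "subgroup P Qstar" and "g \<noteq> 0" "h \<noteq> 0"
  shows "qcoset P g = qcoset P h \<longleftrightarrow> g / h \<in> P"
proof
  assume "qcoset P g = qcoset P h"
  moreover have "g \<in> qcoset P g" using subgroup_Qstar_1[OF P] by (force simp: qcoset_def')
  ultimately obtain x where "x \<in> P" "g = x * h" by (auto simp: qcoset_def')
  thus "g / h \<in> P" using assms by simp
next
  assume gh: "g / h \<in> P"
  have "x * g = (x * (g / h)) * h" "x * h = (x / (g / h)) * g" for x using assms by simp_all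
  thus "qcoset P g = qcoset P h"
    using subgroup_Qstar_mult[OF P _ gh] subgroup_Qstar_divide[OF P _ gh] unfolding qcoset_def'
    by (metis (no_types, lifting) image_eqI subsetI subset_antisym imageE)
qed

text \<open>Both images are the quotient of \<open>A\<close> by one equivalence relation. Coset
  counts for different moduli are compared in this form.\<close>

lemma card_image_same_kernel:
  assumes "\<And>x y. x \<in> A \<Longrightarrow> y \<in> A \<Longrightarrow> f x = f y \<longleftrightarrow> g x = g y"
  shows "card (f ` A) = card (g ` A)"
proof -
  define h where "h = (\<lambda>z. g (inv_into A f z))"
  have h: "h (f x) = g x" if "x \<in> A" for x
    unfolding h_def using assms[of "inv_into A f (f x)" x] that
    by (simp add: inv_into_into f_inv_into_f)
  have "inj_on h (f ` A)" using h assms by (intro inj_onI) auto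
  moreover have "h ` f ` A = g ` A" using h by (auto simp: image_iff)
  ultimately show ?thesis by (metis card_image)
qed

text \<open>Elements instead of cosets are wanted, because the roots of these elements later form a
  basis of the radical extension.\<close>

lemma coset_representatives:
  assumes P: "subgroup P Qstar" and \<Gamma>: "0 \<notin> \<Gamma>" and fin: "finite (qcoset P ` \<Gamma>)"
  obtains R where "finite R" "R \<subseteq> \<Gamma>" "card R = card (qcoset P ` \<Gamma>)"
    "\<And>g. g \<in> \<Gamma> \<Longrightarrow> \<exists>r\<in>R. g / r \<in> P" "\<And>r s. r \<in> R \<Longrightarrow> s \<in> R \<Longrightarrow> r / s \<in> P \<Longrightarrow> r = s"
proof -
  obtain R where R: "R \<subseteq> \<Gamma>" "inj_on (qcoset P) R" "qcoset P ` R = qcoset P ` \<Gamma>"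
    by (metis subset_image_inj subset_refl)
  have "finite R" using fin R by (metis finite_image_iff)
  moreover have "card R = card (qcoset P ` \<Gamma>)" using R by (metis card_image)
  moreover have "\<exists>r\<in>R. g / r \<in> P" if "g \<in> \<Gamma>" for g
  proof -
    have "qcoset P g \<in> qcoset P ` R" unfolding R(3) using that by (rule imageI)
    then obtain r where r: "r \<in> R" "qcoset P g = qcoset P r" by (elim imageE)
    have "r \<noteq> 0" "g \<noteq> 0" using r(1) R(1) \<Gamma> that by auto
    hence "g / r \<in> P" using qcoset_eq_iff[OF P, of g r] r(2) by simp
    thus ?thesis using r(1) by (rule bexI)
  qed
  moreover have "r = s" if "r \<in> R" "s \<in> R" "r / s \<in> P" for r s
  proof -
    have "r \<noteq> 0" "s \<noteq> 0" using that R(1) \<Gamma> by auto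
    hence "qcoset P r = qcoset P s" using qcoset_eq_iff[OF P, of r s] that(3) by simp
    thus ?thesis using R(2) that(1,2) by (meson inj_onD)
  qed
  ultimately show ?thesis using R(1) that[of R] by simp
qed

text \<open>Representatives modulo \<open>H\<close> times representatives of
  \<open>\<Gamma> \<inter> H\<close> modulo \<open>P\<close> represent \<Gamma> modulo
  \<open>P\<close>. It is applied with \<open>P\<close> the rational n-th powers and
  \<open>H\<close> the rationals that become n-th powers in the cyclotomic field; the second factor
  then measures the entanglement.\<close>

lemma card_cosets_tower:
  assumes \<Gamma>: "subgroup \<Gamma> Qstar" and P: "subgroup P Qstar" and H: "subgroup H Qstar" "P \<subseteq> H"
    and fin: "finite (qcoset P ` \<Gamma>)"
  shows "finite (qcoset H ` \<Gamma>)"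
    and "card (qcoset P ` \<Gamma>) = card (qcoset H ` \<Gamma>) * card (qcoset P ` (\<Gamma> \<inter> H))"
proof -
  note nz = subgroup_Qstar_nonzero
  have \<Gamma>0: "0 \<notin> \<Gamma>" "0 \<notin> \<Gamma> \<inter> H" using nz[OF \<Gamma>] by auto
  have PH: "qcoset P g = qcoset P h \<Longrightarrow> qcoset H g = qcoset H h" if "g \<in> \<Gamma>" "h \<in> \<Gamma>" for g h
    using that qcoset_eq_iff[OF P, of g h] qcoset_eq_iff[OF H(1), of g h] H(2) nz[OF \<Gamma>] by blast
  have "qcoset H ` \<Gamma> = (\<lambda>C. qcoset H (inv_into \<Gamma> (qcoset P) C)) ` qcoset P ` \<Gamma>"
    unfolding image_image
    by (intro image_cong refl PH[OF _ inv_into_into]) (auto simp: f_inv_into_f[of _ "qcoset P"])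
  thus finH: "finite (qcoset H ` \<Gamma>)" using fin by simp
  have finP: "finite (qcoset P ` (\<Gamma> \<inter> H))" by (rule finite_subset[OF _ fin]) auto
  obtain R where R: "finite R" "R \<subseteq> \<Gamma>" "card R = card (qcoset H ` \<Gamma>)"
    "\<And>g. g \<in> \<Gamma> \<Longrightarrow> \<exists>r\<in>R. g / r \<in> H" "\<And>r s. r \<in> R \<Longrightarrow> s \<in> R \<Longrightarrow> r / s \<in> H \<Longrightarrow> r = s"
    using coset_representatives[OF H(1) \<Gamma>0(1) finH] by metis
  obtain T where T: "finite T" "T \<subseteq> \<Gamma> \<inter> H" "card T = card (qcoset P ` (\<Gamma> \<inter> H))"
    "\<And>g. g \<in> \<Gamma> \<inter> H \<Longrightarrow> \<exists>r\<in>T. g / r \<in> P" "\<And>r s. r \<in> T \<Longrightarrow> s \<in> T \<Longrightarrow> r / s \<in> P \<Longrightarrow> r = s"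
    using coset_representatives[OF P \<Gamma>0(2) finP] by metis
  have R0: "r \<noteq> 0" if "r \<in> R" for r using that R(2) \<Gamma>0 by auto
  have T0: "r \<noteq> 0" if "r \<in> T" for r using that T(2) \<Gamma>0 by auto
  have "bij_betw (\<lambda>(r, t). qcoset P (r * t)) (R \<times> T) (qcoset P ` \<Gamma>)"
    unfolding bij_betw_def
  proof (intro conjI equalityI subsetI inj_onI, clarify)
    fix r t r' t' assume rt: "r \<in> R" "t \<in> T" "r' \<in> R" "t' \<in> T" "qcoset P (r * t) = qcoset P (r' * t')"
    hence p: "(r * t) / (r' * t') \<in> P" using qcoset_eq_iff[OF P] R0 T0 by simp
    have tH: "t' / t \<in> H" using rt T(2) subgroup_Qstar_divide[OF H(1), of t' t] by blast
    have "(r * t) / (r' * t') * (t' / t) = r / r'" using R0 T0 rt by (simp add: field_simps)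
    hence "r / r' \<in> H" using subgroup_Qstar_mult[OF H(1) _ tH] p H(2) by (metis subsetD)
    hence r: "r = r'" using R(5) rt by blast
    hence "t / t' \<in> P" using p R0 rt by simp
    thus "r = r' \<and> t = t'" using r T(5) rt by blast
  next
    fix C assume "C \<in> (\<lambda>(r, t). qcoset P (r * t)) ` (R \<times> T)"
    then obtain r t where "r \<in> R" "t \<in> T" "C = qcoset P (r * t)" by auto
    moreover from this have "r * t \<in> \<Gamma>" using R(2) T(2) by (intro subgroup_Qstar_mult[OF \<Gamma>]) auto
    ultimately show "C \<in> qcoset P ` \<Gamma>" by blast
  next
    fix C assume "C \<in> qcoset P ` \<Gamma>"
    then obtain g where g: "g \<in> \<Gamma>" "C = qcoset P g" by blast
    obtain r where r: "r \<in> R" "g / r \<in> H" using R(4) g(1) by blast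
    have "g / r \<in> \<Gamma> \<inter> H" using r g R(2) subgroup_Qstar_divide[OF \<Gamma>] by auto
    then obtain t where t: "t \<in> T" "g / r / t \<in> P" using T(4) by blast
    have "qcoset P g = qcoset P (r * t)"
      using t r g R0 T0 nz[OF \<Gamma>] by (subst qcoset_eq_iff[OF P]) auto
    thus "C \<in> (\<lambda>(r, t). qcoset P (r * t)) ` (R \<times> T)" using g t r by auto
  qed
  hence "card (R \<times> T) = card (qcoset P ` \<Gamma>)" by (rule bij_betw_same_card)
  thus "card (qcoset P ` \<Gamma>) = card (qcoset H ` \<Gamma>) * card (qcoset P ` (\<Gamma> \<inter> H))"
    using R(3) T(3) by (simp add: card_cartesian_product)
qed

subsection \<open>The groups \<open>\<Gamma>(d)\<close>\<close>

abbreviation pcls :: "nat \<Rightarrow> rat \<Rightarrow> rat set" where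
  "pcls d g \<equiv> qcoset (Qstar_pow d) g"

lemma pcls_eq_iff: "g \<noteq> 0 \<Longrightarrow> h \<noteq> 0 \<Longrightarrow> pcls d g = pcls d h \<longleftrightarrow> g / h \<in> Qstar_pow d"
  by (rule qcoset_eq_iff[OF subgroup_Qstar_pow])

lemma pcls_1: "pcls d 1 = Qstar_pow d"
  by (simp add: qcoset_def')

text \<open>Multiplying an element of \<Gamma> by a \<open>d\<close>-th power does not change its
  coset, so the formal quotient group reduces to a plain image, the form used from here on.\<close>

lemma carrier_Gamma_mod:
  assumes "subgroup \<Gamma> Qstar"
  shows "carrier (Gamma_mod \<Gamma> d) = pcls d ` \<Gamma>"
proof -
  have "carrier (Gamma_mod \<Gamma> d) = pcls d ` (\<Gamma> <#>\<^bsub>Qstar\<^esub> Qstar_pow d)"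
    by (auto simp: Gamma_mod_def FactGroup_def RCOSETS_def r_coset_def)
  also have "\<dots> = pcls d ` \<Gamma>"
  proof (intro equalityI subsetI)
    fix C assume "C \<in> pcls d ` (\<Gamma> <#>\<^bsub>Qstar\<^esub> Qstar_pow d)"
    then obtain g x where gx: "g \<in> \<Gamma>" "x \<in> Qstar_pow d" "C = pcls d (g * x)" by (auto simp: set_mult_def)
    have "g \<noteq> 0" "x \<noteq> 0"
      using gx subgroup_Qstar_nonzero[OF assms] subgroup_Qstar_nonzero[OF subgroup_Qstar_pow] by auto
    hence "C = pcls d g" using gx by (simp add: pcls_eq_iff)
    thus "C \<in> pcls d ` \<Gamma>" using gx by blast
  next
    fix C assume "C \<in> pcls d ` \<Gamma>"
    then obtain g where g: "g \<in> \<Gamma>" "C = pcls d g" by blast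
    have "g * 1 \<in> \<Gamma> <#>\<^bsub>Qstar\<^esub> Qstar_pow d"
      unfolding set_mult_def using g subgroup_Qstar_1[OF subgroup_Qstar_pow, of d] by force
    thus "C \<in> pcls d ` (\<Gamma> <#>\<^bsub>Qstar\<^esub> Qstar_pow d)" using g by auto
  qed
  finally show ?thesis .
qed

lemma order_Gamma_mod: "subgroup \<Gamma> Qstar \<Longrightarrow> Coset.order (Gamma_mod \<Gamma> d) = card (pcls d ` \<Gamma>)"
  by (simp add: Coset.order_def carrier_Gamma_mod)

lemma set_mult_pcls: "pcls d g <#>\<^bsub>Qstar\<^esub> pcls d h = pcls d (g * h)"
proof -
  have "pcls d g <#>\<^bsub>Qstar\<^esub> pcls d h = (\<lambda>(x, y). (x * y) * (g * h)) ` (Qstar_pow d \<times> Qstar_pow d)"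
    unfolding set_mult_def qcoset_def' by (auto simp: image_iff mult_ac)
  also have "\<dots> = (\<lambda>x. x * (g * h)) ` (\<lambda>(x, y). x * y) ` (Qstar_pow d \<times> Qstar_pow d)"
    by (auto simp: image_image case_prod_unfold)
  also have "(\<lambda>(x, y). x * y) ` (Qstar_pow d \<times> Qstar_pow d) = Qstar_pow d"
    using subgroup_Qstar_mult[OF subgroup_Qstar_pow] subgroup_Qstar_1[OF subgroup_Qstar_pow, of d]
    by (force simp: image_iff)
  finally show ?thesis by (simp add: qcoset_def')
qed

lemma two_torsion_Gamma_mod:
  assumes "subgroup \<Gamma> Qstar"
  shows "two_torsion (Gamma_mod \<Gamma> d) = pcls d ` {g \<in> \<Gamma>. g ^ 2 \<in> Qstar_pow d}"
proof -
  have "pcls d g [^]\<^bsub>Gamma_mod \<Gamma> d\<^esub> (2 :: nat) = \<one>\<^bsub>Gamma_mod \<Gamma> d\<^esub> \<longleftrightarrow> g ^ 2 \<in> Qstar_pow d"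
    if "g \<in> \<Gamma>" for g
  proof -
    have g0: "g \<noteq> 0" using that subgroup_Qstar_nonzero[OF assms] by auto
    have one: "\<one>\<^bsub>Gamma_mod \<Gamma> d\<^esub> = pcls d 1" by (simp add: Gamma_mod_def FactGroup_def pcls_1)
    have mult: "C \<otimes>\<^bsub>Gamma_mod \<Gamma> d\<^esub> D = C <#>\<^bsub>Qstar\<^esub> D" for C D
      by (simp add: Gamma_mod_def FactGroup_def set_mult_def)
    have "pcls d g [^]\<^bsub>Gamma_mod \<Gamma> d\<^esub> (2 :: nat) = pcls d (g ^ 2)"
      by (simp add: nat_pow_def numeral_2_eq_2 one mult set_mult_pcls)
    thus ?thesis unfolding one using g0 by (simp add: pcls_eq_iff)
  qed
  thus ?thesis unfolding two_torsion_def carrier_Gamma_mod[OF assms] by auto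
qed

text \<open>Bezout: with \<open>i * a + j * b = 1\<close>, the power \<open>x powi (i * a)\<close>
  is an \<open>a * b\<close>-th power because \<open>x\<close> is a \<open>b\<close>-th power, and
  symmetrically for the other factor of \<open>x\<close>.\<close>

lemma Qstar_pow_coprime_iff:
  assumes "Rings.coprime a b"
  shows "x \<in> Qstar_pow (a * b) \<longleftrightarrow> x \<in> Qstar_pow a \<and> x \<in> Qstar_pow b"
proof
  assume "x \<in> Qstar_pow (a * b)"
  then obtain u where "u \<noteq> 0" "x = u ^ (a * b)" by (auto simp: Qstar_pow_def)
  thus "x \<in> Qstar_pow a \<and> x \<in> Qstar_pow b"
    using Qstar_powI[of "u ^ b" a] Qstar_powI[of "u ^ a" b] by (simp add: mult.commute flip: power_mult)
next
  assume "x \<in> Qstar_pow a \<and> x \<in> Qstar_pow b"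
  then obtain u v where uv: "u \<noteq> 0" "v \<noteq> 0" "x = u ^ a" "x = v ^ b" by (auto simp: Qstar_pow_def)
  obtain i j where ij: "i * int a + j * int b = 1"
    using bezout_int[of "int a" "int b"] assms by (auto simp: coprime_iff_gcd_eq_1)
  have x0: "x \<noteq> 0" using uv by auto
  have "(v powi i * u powi j) ^ (a * b) = x powi (i * int a) * x powi (j * int b)"
  proof -
    have "(v powi i) ^ (a * b) = x powi (i * int a)"
      unfolding uv(4) by (simp add: power_int_power power_int_power' mult_ac)
    moreover have "(u powi j) ^ (a * b) = x powi (j * int b)"
      unfolding uv(3) by (simp add: power_int_power power_int_power' mult_ac)
    ultimately show ?thesis by (simp add: power_mult_distrib)
  qed
  also have "\<dots> = x" using x0 ij by (simp flip: power_int_add)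
  finally show "x \<in> Qstar_pow (a * b)"
    using Qstar_powI[of "v powi i * u powi j" "a * b"] uv by simp
qed

lemma card_pcls_mult:
  assumes \<Gamma>: "subgroup \<Gamma> Qstar" and ab: "Rings.coprime a b"
  shows "card (pcls (a * b) ` \<Gamma>) = card (pcls a ` \<Gamma>) * card (pcls b ` \<Gamma>)"
proof -
  note nz = subgroup_Qstar_nonzero[OF \<Gamma>]
  have "card (pcls (a * b) ` \<Gamma>) = card ((\<lambda>g. (pcls a g, pcls b g)) ` \<Gamma>)"
    by (rule card_image_same_kernel) (simp add: pcls_eq_iff nz Qstar_pow_coprime_iff[OF ab])
  also have "(\<lambda>g. (pcls a g, pcls b g)) ` \<Gamma> = (pcls a ` \<Gamma>) \<times> (pcls b ` \<Gamma>)"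
  proof (intro equalityI subsetI)
    fix z assume "z \<in> (pcls a ` \<Gamma>) \<times> (pcls b ` \<Gamma>)"
    then obtain g h where gh: "g \<in> \<Gamma>" "h \<in> \<Gamma>" "z = (pcls a g, pcls b h)" by auto
    obtain i j where ij: "i * int a + j * int b = 1"
      using bezout_int[of "int a" "int b"] ab by (auto simp: coprime_iff_gcd_eq_1)
    \<comment> \<open>The exponent \<open>j * b\<close> is 1 modulo \<open>a\<close> and 0 modulo
      \<open>b\<close>, and \<open>i * a\<close> is the reverse, as in the Chinese remainder
      theorem.\<close>
    define k where "k = g powi (j * int b) * h powi (i * int a)"
    have k: "k \<in> \<Gamma>" unfolding k_def
      by (intro subgroup_Qstar_mult[OF \<Gamma>] subgroup_Qstar_power_int[OF \<Gamma>] gh)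
    have g0: "g \<noteq> 0" "h \<noteq> 0" using nz gh by auto
    have "g powi (j * int b) * g powi (i * int a) = g" "h powi (j * int b) * h powi (i * int a) = h"
      using g0 ij by (simp_all add: add.commute flip: power_int_add)
    hence "k / g = h powi (i * int a) / g powi (i * int a)" "k / h = g powi (j * int b) / h powi (j * int b)"
      using g0 unfolding k_def by (simp_all add: field_simps)
    hence "k / g = (h powi i / g powi i) ^ a" "k / h = (g powi j / h powi j) ^ b"
      by (simp_all add: power_divide power_int_power')
    hence "k / g \<in> Qstar_pow a" "k / h \<in> Qstar_pow b" using g0 by (auto intro!: Qstar_powI)
    hence "pcls a k = pcls a g" "pcls b k = pcls b h" using g0 nz[OF k] by (simp_all add: pcls_eq_iff)
    thus "z \<in> (\<lambda>g. (pcls a g, pcls b g)) ` \<Gamma>" using gh k by auto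
  qed auto
  finally show ?thesis by (simp add: card_cartesian_product)
qed

text \<open>Reducing the exponents of the generators modulo \<open>d\<close> does not change the
  coset, so at most \<open>d ^ card S\<close> cosets occur.\<close>

lemma finite_pcls_image:
  assumes fg: "finitely_generated_subgroup \<Gamma>" and d: "d > 0"
  shows "finite (pcls d ` \<Gamma>)"
proof -
  obtain S where S: "finite S" "S \<subseteq> carrier Qstar" "\<Gamma> = generate Qstar S"
    using fg by (auto simp: finitely_generated_subgroup_def)
  have S0: "s \<noteq> 0" if "s \<in> S" for s using S that by auto
  have ex: "\<exists>e :: rat \<Rightarrow> int. x = (\<Prod>s\<in>S. s powi e s)" if "x \<in> generate Qstar S" for x
    using that
  proof induction
    case one
    show ?case by (rule exI[of _ "\<lambda>_. 0"]) simp
  next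
    case (incl h)
    have "(\<Prod>s\<in>S. s powi (if s = h then 1 else 0)) = (\<Prod>s\<in>S. if s = h then s else 1)"
      by (intro prod.cong) auto
    also have "\<dots> = h" using incl S(1) by simp
    finally show ?case by (intro exI[of _ "\<lambda>s. if s = h then 1 else 0"]) simp
  next
    case (inv h)
    have "(\<Prod>s\<in>S. s powi (if s = h then -1 else 0)) = (\<Prod>s\<in>S. if s = h then inverse s else 1)"
      by (intro prod.cong) auto
    also have "\<dots> = inverse h" using inv S(1) by simp
    finally show ?case using S0[OF inv] by (intro exI[of _ "\<lambda>s. if s = h then -1 else 0"]) simp
  next
    case (eng h1 h2)
    then obtain e1 e2 where "h1 = (\<Prod>s\<in>S. s powi e1 s)" "h2 = (\<Prod>s\<in>S. s powi e2 s)" by blast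
    hence "h1 * h2 = (\<Prod>s\<in>S. s powi (e1 s + e2 s))"
      using S0 by (auto simp: prod.distrib[symmetric] power_int_add intro!: prod.cong)
    thus ?case by auto
  qed
  have "pcls d ` \<Gamma> \<subseteq> (\<lambda>e. pcls d (\<Prod>s\<in>S. s ^ e s)) ` (S \<rightarrow>\<^sub>E {..<d})"
  proof
    fix C assume "C \<in> pcls d ` \<Gamma>"
    then obtain e where e: "C = pcls d (\<Prod>s\<in>S. s powi e s)" using ex S(3) by blast
    define e' where "e' = (\<lambda>s\<in>S. nat (e s mod int d))"
    define q where "q = (\<Prod>s\<in>S. s powi (e s div int d))"
    have q0: "q \<noteq> 0" using S S0 by (simp add: q_def)
    have "s powi e s = s ^ e' s * (s powi (e s div int d)) ^ d" if "s \<in> S" for s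
    proof -
      have "s powi e s = s powi (e s mod int d + e s div int d * int d)" by simp
      also have "\<dots> = s powi (e s mod int d) * s powi (e s div int d * int d)"
        by (rule power_int_add) (use S0 that in auto)
      also have "s powi (e s mod int d) = s ^ e' s"
        using that d by (simp add: e'_def power_int_nonneg_exp)
      also have "s powi (e s div int d * int d) = (s powi (e s div int d)) ^ d"
        by (simp add: power_int_power')
      finally show ?thesis .
    qed
    hence "(\<Prod>s\<in>S. s powi e s) = (\<Prod>s\<in>S. s ^ e' s) * q ^ d"
      by (simp add: q_def prod.distrib prod_power_distrib)
    moreover have "(\<Prod>s\<in>S. s ^ e' s) \<noteq> 0" using S S0 by simp
    ultimately have "C = pcls d (\<Prod>s\<in>S. s ^ e' s)" unfolding e using q0
      by (subst pcls_eq_iff) (auto intro: Qstar_powI)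
    moreover have "e' \<in> S \<rightarrow>\<^sub>E {..<d}" using d by (auto simp: e'_def nat_less_iff)
    ultimately show "C \<in> (\<lambda>e. pcls d (\<Prod>s\<in>S. s ^ e s)) ` (S \<rightarrow>\<^sub>E {..<d})" by blast
  qed
  thus ?thesis by (rule finite_subset) (intro finite_imageI finite_PiE S(1) finite_lessThan)
qed

section \<open>Linear growth of the number of cosets\<close>

lemma quotient_of_power:
  assumes "quotient_of x = (a, b)"
  shows "quotient_of (x ^ k) = (a ^ k, b ^ k)"
proof -
  have b: "b > 0" "Rings.coprime a b" using quotient_of_denom_pos[OF assms] quotient_of_coprime[OF assms] by auto
  have "x ^ k = of_int (a ^ k) / of_int (b ^ k)" using quotient_of_div[OF assms] by (simp add: power_divide)
  hence "x ^ k = Rat.Fract (a ^ k) (b ^ k)" by (simp add: Fract_of_int_quotient)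
  thus ?thesis using b by (simp add: quotient_of_Fract normalize_stable)
qed

text \<open>Let \<open>x \<ge> 2\<close> be the denominator or the absolute numerator of
  \<open>g\<close>. If \<open>g ^ k\<close> is a \<open>d\<close>-th power, then
  \<open>x ^ k = y ^ d\<close> with \<open>y \<ge> 2\<close>, so
  \<open>2 ^ d \<le> M ^ k \<le> 2 ^ (M * k)\<close> and \<open>d \<le> M * k\<close>. Hence the
  powers \<open>g ^ j\<close> with \<open>j < d / M\<close> lie in different cosets, and
  \<open>L = M\<close> works.\<close>

lemma pcls_card_lower_bound:
  assumes \<Gamma>: "subgroup \<Gamma> Qstar" and fin: "\<And>d. d > 0 \<Longrightarrow> finite (pcls d ` \<Gamma>)"
    and g: "g \<in> \<Gamma>" "\<bar>g\<bar> \<noteq> 1"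
  obtains L :: nat where "L > 0" "\<And>d. d > 0 \<Longrightarrow> d \<le> L * card (pcls d ` \<Gamma>)"
proof -
  have g0: "g \<noteq> 0" using subgroup_Qstar_nonzero[OF \<Gamma> g(1)] .
  obtain a b where ab: "quotient_of g = (a, b)" by (cases "quotient_of g")
  have b: "b > 0" using quotient_of_denom_pos[OF ab] .
  have gd: "g = of_int a / of_int b" using quotient_of_div[OF ab] .
  have a0: "a \<noteq> 0" using g0 gd by auto
  define M where "M = nat (max \<bar>a\<bar> b)"
  have key: "d \<le> M * k" if k: "g ^ k = q ^ d" and d: "d > 0" and k0: "k > 0" for k d q
  proof -
    obtain n m where nm: "quotient_of q = (n, m)" by (cases "quotient_of q")
    have m: "m > 0" using quotient_of_denom_pos[OF nm] .
    have eq: "a ^ k = n ^ d" "b ^ k = m ^ d"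
      using quotient_of_power[OF ab, of k] quotient_of_power[OF nm, of d] k by auto
    have big: "2 ^ d \<le> (int M) ^ k" if "x ^ k = y ^ d" "x \<ge> 2" "x \<le> int M" "y \<ge> 0" "k > 0" for x y :: int
    proof -
      have "y \<noteq> 0" using that d by (auto simp: power_0_left)
      moreover have "y \<noteq> 1"
      proof
        assume "y = 1"
        hence "x ^ k = 1" using that by simp
        moreover have "x ^ k > 1" using that by (intro one_less_power) auto
        ultimately show False by simp
      qed
      ultimately have "y \<ge> 2" using that by linarith
      hence "2 ^ d \<le> y ^ d" by (intro power_mono) auto
      also have "\<dots> = x ^ k" using that by simp
      also have "\<dots> \<le> int M ^ k" using that by (intro power_mono) auto
      finally show ?thesis .
    qed
    have False: "k \<noteq> 0" using k0 by simp
      have "\<bar>a\<bar> \<ge> 2 \<or> b \<ge> 2"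
      proof (rule ccontr)
        assume "\<not> ?thesis"
        hence "\<bar>a\<bar> = 1" "b = 1" using a0 b by linarith+
        hence "\<bar>g\<bar> = 1" using gd by (simp flip: of_int_abs)
        thus False using g(2) by simp
      qed
      moreover have "\<bar>a\<bar> ^ k = \<bar>n\<bar> ^ d" using eq(1) by (metis power_abs)
      moreover have "\<bar>a\<bar> \<le> int M" "b \<le> int M" unfolding M_def by linarith+
      ultimately have "2 ^ d \<le> (int M) ^ k"
        using big[of "\<bar>a\<bar>" "\<bar>n\<bar>"] big[OF eq(2)] m k0 by (meson abs_ge_zero less_imp_le)
      also have "\<dots> \<le> (2 ^ M) ^ k" by (intro power_mono) (auto simp: less_imp_le of_nat_less_two_power)
      finally have "(2 :: int) ^ d \<le> 2 ^ (M * k)" by (simp add: power_mult)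
      thus ?thesis by (simp add: power_increasing_iff)
  qed
  have M0: "M > 0" using b by (simp add: M_def)
  have "d \<le> M * card (pcls d ` \<Gamma>)" if d: "d > 0" for d
  proof -
    define J where "J = {j. M * j < d}"
    \<comment> \<open>The number of such \<open>j\<close> is \<open>d / M\<close> rounded up, which
      explains \<open>d + M - 1\<close>.\<close>
    have fJ: "J = {..<(d + M - 1) div M}"
    proof (intro equalityI subsetI)
      fix j assume "j \<in> J"
      hence "M * j + M \<le> d + M - 1" by (simp add: J_def)
      hence "(j + 1) * M \<le> d + M - 1" by (simp add: algebra_simps)
      hence "j + 1 \<le> (d + M - 1) div M" using M0 by (simp add: less_eq_div_iff_mult_less_eq)
      thus "j \<in> {..<(d + M - 1) div M}" by simp
    next
      fix j assume "j \<in> {..<(d + M - 1) div M}"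
      hence "j + 1 \<le> (d + M - 1) div M" by simp
      hence "(j + 1) * M \<le> d + M - 1" using M0 by (simp add: less_eq_div_iff_mult_less_eq)
      thus "j \<in> J" using M0 by (simp add: J_def algebra_simps)
    qed
    have "inj_on (\<lambda>j. pcls d (g ^ j)) J"
    proof (rule linorder_inj_onI)
      fix i j assume ij: "i < j" "i \<in> J" "j \<in> J"
      show "pcls d (g ^ i) \<noteq> pcls d (g ^ j)"
      proof
        assume "pcls d (g ^ i) = pcls d (g ^ j)"
        hence "pcls d (g ^ j) = pcls d (g ^ i)" by simp
        hence "g ^ j / g ^ i \<in> Qstar_pow d" using pcls_eq_iff[of "g ^ j" "g ^ i"] g0 by simp
        hence "g ^ (j - i) \<in> Qstar_pow d" using ij g0 by (simp add: power_diff)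
        then obtain q where "g ^ (j - i) = q ^ d" by (auto simp: Qstar_pow_def)
        hence "d \<le> M * (j - i)" using key d ij by simp
        also have "\<dots> \<le> M * j" by simp
        also have "\<dots> < d" using ij by (simp add: J_def)
        finally show False by simp
      qed
    qed auto
    hence "card J = card ((\<lambda>j. pcls d (g ^ j)) ` J)" by (simp add: card_image)
    also have "\<dots> \<le> card (pcls d ` \<Gamma>)"
      using subgroup_Qstar_power[OF \<Gamma> g(1)] by (intro card_mono fin d) auto
    finally have "(d + M - 1) div M \<le> card (pcls d ` \<Gamma>)" by (simp add: fJ)
    hence "M * ((d + M - 1) div M) \<le> M * card (pcls d ` \<Gamma>)" by simp
    moreover have "d \<le> M * ((d + M - 1) div M)"
    proof -
      have "d + M - 1 = M * ((d + M - 1) div M) + (d + M - 1) mod M" by simp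
      moreover have "(d + M - 1) mod M < M" using M0 by simp
      ultimately show ?thesis by linarith
    qed
    ultimately show ?thesis by linarith
  qed
  thus ?thesis using that M0 by blast
qed

subsection \<open>Subfields of the complex numbers\<close>

lemma field_CC: "field CC"
  by (rule field_from_type_algebra)

lemma cring_CC: "cring CC"
  by (rule cring_from_type_algebra)

lemma ring_CC: "ring CC"
  by (rule ring_from_type_algebra)

lemma CC_a_inv [simp]: "\<ominus>\<^bsub>CC\<^esub> x = - x"
  using abelian_group.minus_equality[OF ring.is_abelian_group[OF ring_CC], of "- x" x] by simp

lemma CC_m_inv [simp]: "x \<noteq> 0 \<Longrightarrow> inv\<^bsub>CC\<^esub> x = inverse x"
  using comm_monoid.comm_inv_char[OF cring.axioms(2)[OF cring_CC], of x "inverse x"] by simp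

text \<open>An elementary closure predicate that stands in for \<open>subfield K CC\<close>. The
  condition on inverses can include 0 because \<open>inverse 0 = 0\<close>.\<close>

definition complex_subfield :: "complex set \<Rightarrow> bool" where
  "complex_subfield K \<longleftrightarrow> 0 \<in> K \<and> 1 \<in> K \<and> (\<forall>x\<in>K. \<forall>y\<in>K. x + y \<in> K \<and> x * y \<in> K) \<and>
     (\<forall>x\<in>K. - x \<in> K \<and> inverse x \<in> K)"

lemma complex_subfieldI:
  assumes "0 \<in> K" "1 \<in> K" "\<And>x y. x \<in> K \<Longrightarrow> y \<in> K \<Longrightarrow> x + y \<in> K"
    "\<And>x y. x \<in> K \<Longrightarrow> y \<in> K \<Longrightarrow> x * y \<in> K" "\<And>x. x \<in> K \<Longrightarrow> - x \<in> K"
    "\<And>x. x \<in> K \<Longrightarrow> x \<noteq> 0 \<Longrightarrow> inverse x \<in> K"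
  shows "complex_subfield K"
  using assms unfolding complex_subfield_def by (metis inverse_zero)

context
  fixes K assumes K: "complex_subfield K"
begin

lemma subfield_0: "0 \<in> K" and subfield_1: "1 \<in> K"
  and subfield_add: "x \<in> K \<Longrightarrow> y \<in> K \<Longrightarrow> x + y \<in> K"
  and subfield_mult: "x \<in> K \<Longrightarrow> y \<in> K \<Longrightarrow> x * y \<in> K"
  and subfield_uminus: "x \<in> K \<Longrightarrow> - x \<in> K"
  and subfield_inverse: "x \<in> K \<Longrightarrow> inverse x \<in> K"
  using K by (auto simp: complex_subfield_def)

lemma subfield_diff: "x \<in> K \<Longrightarrow> y \<in> K \<Longrightarrow> x - y \<in> K"
  using subfield_add[of x "- y"] subfield_uminus[of y] by simp

lemma subfield_divide: "x \<in> K \<Longrightarrow> y \<in> K \<Longrightarrow> x / y \<in> K"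
  unfolding divide_inverse by (intro subfield_mult subfield_inverse)

lemma subfield_power: "x \<in> K \<Longrightarrow> x ^ n \<in> K"
  by (induction n) (auto intro: subfield_1 subfield_mult)

lemma subfield_power_int: "x \<in> K \<Longrightarrow> x powi n \<in> K"
  by (auto simp: power_int_def intro: subfield_power subfield_inverse)

lemma subfield_sum: "(\<And>i. i \<in> A \<Longrightarrow> f i \<in> K) \<Longrightarrow> sum f A \<in> K"
  by (induction A rule: infinite_finite_induct) (auto intro: subfield_0 subfield_add)

lemma subfield_prod: "(\<And>i. i \<in> A \<Longrightarrow> f i \<in> K) \<Longrightarrow> prod f A \<in> K"
  by (induction A rule: infinite_finite_induct) (auto intro: subfield_1 subfield_mult)

lemma subfield_of_nat: "of_nat n \<in> K"
  by (induction n) (auto intro: subfield_0 subfield_1 subfield_add)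

lemma subfield_of_int: "of_int n \<in> K"
  by (cases n rule: int_cases2) (auto intro: subfield_of_nat subfield_uminus)

lemma subfield_of_rat: "of_rat q \<in> K"
proof -
  obtain a b where "q = of_int a / of_int b" by (metis Fract_of_int_quotient Rat_cases)
  thus ?thesis by (auto simp: of_rat_divide intro: subfield_divide subfield_of_int)
qed

lemma Rats_subset_subfield: "\<rat> \<subseteq> K"
  using subfield_of_rat by (auto elim: Rats_cases)

lemma subfield_imp_CC_subfield: "subfield K CC"
proof (rule field.subfieldI'[OF field_CC])
  show "subring K CC"
    by (rule ring.subringI[OF ring_CC]) (auto intro: subfield_1 subfield_add subfield_mult subfield_uminus)
qed (auto intro: subfield_inverse)

end

lemma complex_subfield_Rats: "complex_subfield \<rat>"
  by (rule complex_subfieldI) auto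

lemma Q_adjoin_incl: "x \<in> S \<Longrightarrow> x \<in> Q_adjoin S"
  unfolding Q_adjoin_def by (rule generate_field.incl)

lemma complex_subfield_Q_adjoin: "complex_subfield (Q_adjoin S)"
proof (rule complex_subfieldI)
  show "1 \<in> Q_adjoin S" unfolding Q_adjoin_def using generate_field.one[of CC S] by simp
  show u: "- x \<in> Q_adjoin S" if "x \<in> Q_adjoin S" for x
    using that generate_field.a_inv[of x CC S] unfolding Q_adjoin_def by simp
  show a: "x + y \<in> Q_adjoin S" if "x \<in> Q_adjoin S" "y \<in> Q_adjoin S" for x y
    using that generate_field.eng_add[of x CC S y] unfolding Q_adjoin_def by simp
  show "x * y \<in> Q_adjoin S" if "x \<in> Q_adjoin S" "y \<in> Q_adjoin S" for x y
    using that generate_field.eng_mult[of x CC S y] unfolding Q_adjoin_def by simp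
  show "inverse x \<in> Q_adjoin S" if "x \<in> Q_adjoin S" "x \<noteq> 0" for x
    using that generate_field.m_inv[of x CC S] unfolding Q_adjoin_def by simp
  show "0 \<in> Q_adjoin S"
    using a[OF \<open>1 \<in> Q_adjoin S\<close> u[OF \<open>1 \<in> Q_adjoin S\<close>]] by simp
qed

lemma Q_adjoin_least:
  assumes K: "complex_subfield K" and S: "S \<subseteq> K"
  shows "Q_adjoin S \<subseteq> K"
proof
  fix x assume "x \<in> Q_adjoin S"
  hence "x \<in> generate_field CC S" by (simp add: Q_adjoin_def)
  thus "x \<in> K"
    by induction (use K S in \<open>auto intro: subfield_1 subfield_add subfield_mult subfield_uminus
      subfield_inverse\<close>)
qed

lemma Q_adjoin_mono: "S \<subseteq> T \<Longrightarrow> Q_adjoin S \<subseteq> Q_adjoin T"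
  by (intro Q_adjoin_least complex_subfield_Q_adjoin) (auto intro: Q_adjoin_incl)

subsection \<open>Polynomials over a subfield\<close>

text \<open>Polynomials over \<open>K\<close> are complex polynomials with restricted coefficients,
  so evaluation and roots need no change of type.\<close>

definition poly_over :: "complex set \<Rightarrow> complex poly \<Rightarrow> bool" where
  "poly_over K p \<longleftrightarrow> (\<forall>i. poly.coeff p i \<in> K)"

lemma poly_over_mono: "poly_over K p \<Longrightarrow> K \<subseteq> L \<Longrightarrow> poly_over L p"
  by (auto simp: poly_over_def)

context
  fixes K assumes K: "complex_subfield K"
begin

lemma poly_over_0: "poly_over K 0" and poly_over_1: "poly_over K 1"
  and poly_over_add: "poly_over K p \<Longrightarrow> poly_over K q \<Longrightarrow> poly_over K (p + q)"
  and poly_over_uminus: "poly_over K p \<Longrightarrow> poly_over K (- p)"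
  and poly_over_diff: "poly_over K p \<Longrightarrow> poly_over K q \<Longrightarrow> poly_over K (p - q)"
  and poly_over_smult: "c \<in> K \<Longrightarrow> poly_over K p \<Longrightarrow> poly_over K (smult c p)"
  and poly_over_monom: "c \<in> K \<Longrightarrow> poly_over K (Polynomial.monom c n)"
  and poly_over_pCons: "c \<in> K \<Longrightarrow> poly_over K p \<Longrightarrow> poly_over K (pCons c p)"
  and poly_over_pderiv: "poly_over K p \<Longrightarrow> poly_over K (pderiv p)"
  by (auto simp: poly_over_def coeff_pCons coeff_pderiv split: nat.splits
      intro!: subfield_0[OF K] subfield_1[OF K] subfield_add[OF K] subfield_mult[OF K]
        subfield_uminus[OF K] subfield_diff[OF K] subfield_of_nat[OF K])

lemma poly_over_mult: "poly_over K p \<Longrightarrow> poly_over K q \<Longrightarrow> poly_over K (p * q)"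
  by (auto simp: poly_over_def coeff_mult intro!: subfield_sum[OF K] subfield_mult[OF K])

lemma poly_over_const: "c \<in> K \<Longrightarrow> poly_over K [:c:]"
  by (intro poly_over_pCons poly_over_0)

lemma poly_over_X: "poly_over K [:0, 1:]"
  by (intro poly_over_pCons poly_over_0 subfield_0[OF K] subfield_1[OF K])

lemma poly_over_eval: "poly_over K p \<Longrightarrow> x \<in> K \<Longrightarrow> poly p x \<in> K"
  unfolding poly_altdef poly_over_def
  by (auto intro!: subfield_sum[OF K] subfield_mult[OF K] subfield_power[OF K])

lemma poly_over_map_of_int: "poly_over K (map_poly of_int p)"
  by (auto simp: poly_over_def coeff_map_poly intro: subfield_of_int[OF K])

text \<open>Long division by cancelling leading terms; the point is that quotient and remainder keep
  their coefficients in \<open>K\<close>.\<close>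

lemma poly_over_div:
  assumes "poly_over K m" "m \<noteq> 0" "poly_over K p"
  shows "\<exists>q r. poly_over K q \<and> poly_over K r \<and> p = q * m + r \<and>
           (r = 0 \<or> Polynomial.degree r < Polynomial.degree m)"
  using assms(3)
proof (induction "Polynomial.degree p" arbitrary: p rule: less_induct)
  case less
  show ?case
  proof (cases "p = 0 \<or> Polynomial.degree p < Polynomial.degree m")
    case True
    thus ?thesis using less.prems by (intro exI[of _ 0] exI[of _ p]) (auto intro: poly_over_0)
  next
    case False
    hence p: "p \<noteq> 0" "Polynomial.degree m \<le> Polynomial.degree p" by auto
    define c where "c = lead_coeff p / lead_coeff m"
    define t where "t = Polynomial.monom c (Polynomial.degree p - Polynomial.degree m)"
    have c: "c \<in> K" unfolding c_def
      using less.prems assms(1) by (auto simp: poly_over_def intro: subfield_divide[OF K])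
    have t: "poly_over K t" unfolding t_def by (rule poly_over_monom[OF c])
    have c0: "c \<noteq> 0" using p assms(2) by (simp add: c_def)
    have t0: "t \<noteq> 0" "Polynomial.degree t = Polynomial.degree p - Polynomial.degree m"
      using c0 by (simp_all add: t_def degree_monom_eq)
    have dtm: "Polynomial.degree (t * m) = Polynomial.degree p"
      using p assms(2) t0 by (simp add: degree_mult_eq)
    have ltm: "lead_coeff (t * m) = lead_coeff p"
      using assms(2) unfolding lead_coeff_mult t0(2) by (simp add: t_def) (simp add: c_def)
    define p' where "p' = p - t * m"
    have po: "poly_over K p'" unfolding p'_def
      by (intro poly_over_diff poly_over_mult less.prems t assms)
    have "\<exists>q r. poly_over K q \<and> poly_over K r \<and> p' = q * m + r \<and>
           (r = 0 \<or> Polynomial.degree r < Polynomial.degree m)"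
    proof (cases "p' = 0")
      case True
      thus ?thesis by (intro exI[of _ 0]) (auto intro: poly_over_0)
    next
      case False
      have "Polynomial.degree p' \<le> Polynomial.degree p" unfolding p'_def
        using degree_diff_le_max[of p "t * m"] dtm by simp
      moreover have "poly.coeff p' (Polynomial.degree p) = 0"
        unfolding p'_def using ltm dtm by simp
      ultimately have "Polynomial.degree p' < Polynomial.degree p"
        using False by (metis le_neq_implies_less leading_coeff_0_iff)
      thus ?thesis using less.hyps po by blast
    qed
    then obtain q r where qr: "poly_over K q" "poly_over K r" "p' = q * m + r"
           "r = 0 \<or> Polynomial.degree r < Polynomial.degree m" by blast
    have "p = (q + t) * m + r" using qr(3) by (simp add: p'_def algebra_simps)
    thus ?thesis using qr t by (intro exI[of _ "q + t"] exI[of _ r]) (auto intro: poly_over_add)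
  qed
qed

end

section \<open>Algebraic elements, minimal polynomials and simple extensions\<close>

definition alg_over :: "complex set \<Rightarrow> complex \<Rightarrow> bool" where
  "alg_over K x \<longleftrightarrow> (\<exists>p. p \<noteq> 0 \<and> poly_over K p \<and> poly p x = 0)"

lemma alg_over_mono: "alg_over K x \<Longrightarrow> K \<subseteq> L \<Longrightarrow> alg_over L x"
  by (auto simp: alg_over_def intro: poly_over_mono)

lemma alg_over_root:
  assumes K: "complex_subfield K" and "x ^ n \<in> K" "n > 0"
  shows "alg_over K x"
proof -
  have "Polynomial.monom 1 n - [:x ^ n:] \<noteq> 0"
  proof
    assume *: "Polynomial.monom 1 n - [:x ^ n:] = 0"
    have "poly.coeff (Polynomial.monom 1 n - [:x ^ n:]) n = 1"
      using \<open>n > 0\<close> by (simp add: coeff_pCons split: nat.splits)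
    thus False using * by simp
  qed
  moreover have "poly_over K (Polynomial.monom 1 n - [:x ^ n:])"
    by (intro poly_over_diff poly_over_monom poly_over_const assms subfield_1)
  ultimately show ?thesis unfolding alg_over_def
    by (intro exI[of _ "Polynomial.monom 1 n - [:x ^ n:]"]) (auto simp: poly_monom)
qed

text \<open>Minimal degree takes the place of irreducibility, so that divisibility follows at once
  from division with remainder.\<close>

definition is_min_poly :: "complex set \<Rightarrow> complex \<Rightarrow> complex poly \<Rightarrow> bool" where
  "is_min_poly K x m \<longleftrightarrow> poly_over K m \<and> lead_coeff m = 1 \<and> poly m x = 0 \<and>
     (\<forall>p. poly_over K p \<longrightarrow> poly p x = 0 \<longrightarrow> p \<noteq> 0 \<longrightarrow> Polynomial.degree m \<le> Polynomial.degree p)"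

lemma min_poly_exists:
  assumes K: "complex_subfield K" and "alg_over K x"
  obtains m where "is_min_poly K x m"
proof -
  define P where "P = (\<lambda>p. p \<noteq> 0 \<and> poly_over K p \<and> poly p x = 0)"
  obtain p0 where "P p0" using assms(2) unfolding alg_over_def P_def by blast
  then obtain p where p: "P p" "\<And>q. P q \<Longrightarrow> Polynomial.degree p \<le> Polynomial.degree q"
    using ex_has_least_nat[of P p0 Polynomial.degree] by blast
  have p': "p \<noteq> 0" "poly_over K p" "poly p x = 0" using p(1) by (auto simp: P_def)
  have "is_min_poly K x (smult (inverse (lead_coeff p)) p)"
    unfolding is_min_poly_def using p p'
    by (auto simp: P_def intro!: poly_over_smult[OF K] subfield_inverse[OF K])
       (auto simp: poly_over_def)
  thus ?thesis by (rule that)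
qed

lemma min_poly_dvd:
  assumes K: "complex_subfield K" and m: "is_min_poly K x m" and p: "poly_over K p" "poly p x = 0"
  obtains q where "poly_over K q" "p = q * m"
proof -
  have m': "poly_over K m" "m \<noteq> 0" "poly m x = 0" using m by (auto simp: is_min_poly_def)
  from poly_over_div[OF K m'(1,2) p(1)] obtain q r where
    qr: "poly_over K q" "poly_over K r" "p = q * m + r"
        "r = 0 \<or> Polynomial.degree r < Polynomial.degree m" by blast
  have "poly r x = 0" using p(2) m'(3) by (simp add: qr(3))
  hence "r = 0" using qr(2,4) m unfolding is_min_poly_def by (metis not_le)
  thus ?thesis using that qr by auto
qed

lemma min_poly_degree_pos:
  assumes "is_min_poly K x m"
  shows "Polynomial.degree m > 0"
proof (rule ccontr)
  assume "\<not> ?thesis"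
  then obtain c where "m = [:c:]" by (auto elim: degree_eq_zeroE)
  thus False using assms by (auto simp: is_min_poly_def)
qed

definition adjoin1 :: "complex set \<Rightarrow> complex \<Rightarrow> complex set" where
  "adjoin1 K x = {poly p x | p. poly_over K p}"

lemma adjoin1_superset: "complex_subfield K \<Longrightarrow> K \<subseteq> adjoin1 K x"
  unfolding adjoin1_def by (force intro: exI[of _ "[:_:]"] poly_over_const)

lemma adjoin1_mem: "complex_subfield K \<Longrightarrow> x \<in> adjoin1 K x"
  unfolding adjoin1_def by (force intro: exI[of _ "[:0, 1:]"] poly_over_X)

lemma adjoin1_least: "complex_subfield E \<Longrightarrow> K \<subseteq> E \<Longrightarrow> x \<in> E \<Longrightarrow> adjoin1 K x \<subseteq> E"
  unfolding adjoin1_def by (auto intro: poly_over_eval poly_over_mono)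

text \<open>Only inverses need an argument. A nonzero combination of \<open>p\<close> and the
  minimal polynomial \<open>m\<close> of least degree divides both. It is nonzero at
  \<open>x\<close> because \<open>p\<close> is, so the cofactor in \<open>m\<close> vanishes at
  \<open>x\<close> and has full degree; the combination is therefore a constant.\<close>

lemma complex_subfield_adjoin1:
  assumes K: "complex_subfield K" and x: "alg_over K x"
  shows "complex_subfield (adjoin1 K x)"
proof (rule complex_subfieldI)
  show "0 \<in> adjoin1 K x" "1 \<in> adjoin1 K x"
    using adjoin1_superset[OF K, of x] subfield_0[OF K] subfield_1[OF K] by auto
  show "y + z \<in> adjoin1 K x" if "y \<in> adjoin1 K x" "z \<in> adjoin1 K x" for y z
    using that unfolding adjoin1_def by (auto simp flip: poly_add intro: poly_over_add[OF K])
  show "y * z \<in> adjoin1 K x" if "y \<in> adjoin1 K x" "z \<in> adjoin1 K x" for y z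
    using that unfolding adjoin1_def by (auto simp flip: poly_mult intro: poly_over_mult[OF K])
  show "- y \<in> adjoin1 K x" if "y \<in> adjoin1 K x" for y
    using that unfolding adjoin1_def by (auto simp flip: poly_minus intro: poly_over_uminus[OF K])
  show "inverse y \<in> adjoin1 K x" if "y \<in> adjoin1 K x" "y \<noteq> 0" for y
  proof -
    from that obtain p where p: "poly_over K p" "y = poly p x" unfolding adjoin1_def by blast
    obtain m where m: "is_min_poly K x m" using min_poly_exists[OF K x] .
    hence m': "poly_over K m" "m \<noteq> 0" "poly m x = 0" by (auto simp: is_min_poly_def)
    define P where "P = (\<lambda>g. g \<noteq> 0 \<and> (\<exists>u v. poly_over K u \<and> poly_over K v \<and> g = u * p + v * m))"
    have "P m" using m' unfolding P_def
      by (intro conjI exI[of _ 0] exI[of _ 1] poly_over_0[OF K] poly_over_1[OF K]) auto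
    then obtain g where g: "P g" "\<And>q. P q \<Longrightarrow> Polynomial.degree g \<le> Polynomial.degree q"
      using ex_has_least_nat[of P m Polynomial.degree] by blast
    then obtain u v where uv: "g \<noteq> 0" "poly_over K u" "poly_over K v" "g = u * p + v * m"
      unfolding P_def by blast
    have go: "poly_over K g" unfolding uv(4)
      by (intro poly_over_add[OF K] poly_over_mult[OF K] uv p m')
    have dv: "\<exists>q. poly_over K q \<and> f = q * g"
      if f: "poly_over K a" "poly_over K b" "f = a * p + b * m" for f a b
    proof -
      have fo: "poly_over K f" unfolding f(3)
        by (intro poly_over_add[OF K] poly_over_mult[OF K] f p m')
      from poly_over_div[OF K go uv(1) fo] obtain q r where
        qr: "poly_over K q" "poly_over K r" "f = q * g + r"
          "r = 0 \<or> Polynomial.degree r < Polynomial.degree g" by blast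
      have "r = (a - q * u) * p + (b - q * v) * m" using qr(3) f(3) uv(4) by (simp add: algebra_simps)
      moreover have "poly_over K (a - q * u)" "poly_over K (b - q * v)"
        by (intro poly_over_diff[OF K] poly_over_mult[OF K] f qr uv)+
      ultimately have "r = 0" using g(2)[of r] qr(4) unfolding P_def by (metis not_le)
      thus ?thesis using qr by auto
    qed
    from dv[of 0 1 m] obtain h where h: "poly_over K h" "m = h * g"
      using poly_over_0[OF K] poly_over_1[OF K] by auto
    from dv[of 1 0 p] obtain h' where h': "poly_over K h'" "p = h' * g"
      using poly_over_0[OF K] poly_over_1[OF K] by auto
    have "poly g x \<noteq> 0" using that p h' by auto
    hence "poly h x = 0" using m'(3) h(2) by simp
    moreover have h0: "h \<noteq> 0" using h m' by auto
    ultimately have "Polynomial.degree m \<le> Polynomial.degree h"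
      using m h(1) unfolding is_min_poly_def by blast
    hence "Polynomial.degree g = 0" using h(2) h0 uv(1) by (simp add: degree_mult_eq)
    then obtain c where c: "g = [:c:]" by (auto elim: degree_eq_zeroE)
    have "c \<noteq> 0" using c uv by auto
    have cK: "c \<in> K" using go unfolding c poly_over_def by (metis coeff_pCons_0)
    have "poly g x = poly u x * y" using uv(4) m'(3) p by simp
    hence "inverse y = poly (smult (inverse c) u) x"
      using c \<open>c \<noteq> 0\<close> that by (simp add: field_simps)
    thus ?thesis unfolding adjoin1_def
      using poly_over_smult[OF K subfield_inverse[OF K cK] uv(2)] by blast
  qed
qed

fun adjoin_list :: "complex set \<Rightarrow> complex list \<Rightarrow> complex set" where
  "adjoin_list K [] = K"
| "adjoin_list K (x # xs) = adjoin_list (adjoin1 K x) xs"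

lemma complex_subfield_adjoin_list:
  assumes "complex_subfield K" "\<forall>x\<in>set xs. alg_over K x"
  shows "complex_subfield (adjoin_list K xs)"
  using assms
proof (induction xs arbitrary: K)
  case (Cons x xs)
  thus ?case using Cons.IH[OF complex_subfield_adjoin1[OF Cons.prems(1), of x]]
    by (auto intro: alg_over_mono[OF _ adjoin1_superset])
qed auto

lemma adjoin_list_superset:
  assumes "complex_subfield K" "\<forall>x\<in>set xs. alg_over K x"
  shows "K \<subseteq> adjoin_list K xs" "set xs \<subseteq> adjoin_list K xs"
proof -
  have "K \<subseteq> adjoin_list K xs \<and> set xs \<subseteq> adjoin_list K xs"
    using assms
  proof (induction xs arbitrary: K)
    case (Cons x xs)
    have "adjoin1 K x \<subseteq> adjoin_list K (x # xs) \<and> set xs \<subseteq> adjoin_list K (x # xs)"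
      using Cons.IH[OF complex_subfield_adjoin1[OF Cons.prems(1), of x]] Cons.prems
      by (auto intro: alg_over_mono[OF _ adjoin1_superset])
    thus ?case using adjoin1_superset[OF Cons.prems(1), of x] adjoin1_mem[OF Cons.prems(1), of x]
      by auto
  qed auto
  thus "K \<subseteq> adjoin_list K xs" "set xs \<subseteq> adjoin_list K xs" by auto
qed

subsection \<open>Extension of homomorphisms\<close>

text \<open>Values outside \<open>K\<close> are unconstrained and the target is all of the complex
  numbers, so a map can be extended along any algebraic element without changing its type.\<close>

definition hom_on :: "complex set \<Rightarrow> (complex \<Rightarrow> complex) \<Rightarrow> bool" where
  "hom_on K f \<longleftrightarrow> f 1 = 1 \<and> (\<forall>x\<in>K. \<forall>y\<in>K. f (x + y) = f x + f y \<and> f (x * y) = f x * f y)"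

lemma hom_on_id: "hom_on K (\<lambda>x. x)"
  by (auto simp: hom_on_def)

context
  fixes K f assumes K: "complex_subfield K" and f: "hom_on K f"
begin

lemma hom_on_1: "f 1 = 1"
  and hom_on_add: "x \<in> K \<Longrightarrow> y \<in> K \<Longrightarrow> f (x + y) = f x + f y"
  and hom_on_mult: "x \<in> K \<Longrightarrow> y \<in> K \<Longrightarrow> f (x * y) = f x * f y"
  using f by (auto simp: hom_on_def)

lemma hom_on_0: "f 0 = 0"
  using hom_on_add[of 0 0] subfield_0[OF K] by simp

lemma hom_on_uminus: "x \<in> K \<Longrightarrow> f (- x) = - f x"
  using hom_on_add[of x "- x"] subfield_uminus[OF K, of x] hom_on_0 by (simp add: eq_neg_iff_add_eq_0 add.commute)

lemma hom_on_diff: "x \<in> K \<Longrightarrow> y \<in> K \<Longrightarrow> f (x - y) = f x - f y"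
  using hom_on_add[of x "- y"] hom_on_uminus[of y] subfield_uminus[OF K, of y] by simp

lemma hom_on_eq_0_iff: "x \<in> K \<Longrightarrow> f x = 0 \<longleftrightarrow> x = 0"
  using hom_on_mult[of x "inverse x"] subfield_inverse[OF K, of x] hom_on_1 hom_on_0
  by (cases "x = 0") auto

lemma hom_on_inj: "x \<in> K \<Longrightarrow> y \<in> K \<Longrightarrow> f x = f y \<longleftrightarrow> x = y"
  using hom_on_eq_0_iff[of "x - y"] hom_on_diff[of x y] subfield_diff[OF K, of x y] by auto

lemma hom_on_inverse: "x \<in> K \<Longrightarrow> f (inverse x) = inverse (f x)"
proof (cases "x = 0")
  case False
  assume x: "x \<in> K"
  have "f x * f (inverse x) = 1"
    using False hom_on_mult[of x "inverse x"] x subfield_inverse[OF K, of x] hom_on_1 by simp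
  thus ?thesis by (metis inverse_unique)
qed (simp add: hom_on_0)

lemma hom_on_divide: "x \<in> K \<Longrightarrow> y \<in> K \<Longrightarrow> f (x / y) = f x / f y"
  by (simp add: divide_inverse hom_on_mult hom_on_inverse subfield_inverse[OF K])

lemma hom_on_power: "x \<in> K \<Longrightarrow> f (x ^ n) = f x ^ n"
  by (induction n) (simp_all add: hom_on_1 hom_on_mult subfield_power[OF K])

lemma hom_on_sum: "(\<And>i. i \<in> A \<Longrightarrow> g i \<in> K) \<Longrightarrow> f (sum g A) = (\<Sum>i\<in>A. f (g i))"
  by (induction A rule: infinite_finite_induct) (simp_all add: hom_on_0 hom_on_add subfield_sum[OF K])

lemma hom_on_of_nat: "f (of_nat n) = of_nat n"
  by (induction n) (simp_all add: hom_on_0 hom_on_1 hom_on_add subfield_of_nat[OF K] subfield_1[OF K])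

lemma hom_on_of_int: "f (of_int n) = of_int n"
  by (cases n rule: int_cases2) (simp_all add: hom_on_of_nat hom_on_uminus subfield_of_nat[OF K])

lemma hom_on_of_rat: "f (of_rat q) = of_rat q"
proof -
  obtain a b where "q = of_int a / of_int b" by (metis Fract_of_int_quotient Rat_cases)
  thus ?thesis by (simp add: of_rat_divide hom_on_divide subfield_of_int[OF K] hom_on_of_int)
qed

lemma hom_on_Rats: "x \<in> \<rat> \<Longrightarrow> f x = x"
  by (auto elim: Rats_cases simp: hom_on_of_rat)

lemma hom_on_map_poly_add: "poly_over K p \<Longrightarrow> poly_over K q \<Longrightarrow> map_poly f (p + q) = map_poly f p + map_poly f q"
  by (rule poly_eqI) (simp add: coeff_map_poly hom_on_0 hom_on_add poly_over_def)

lemma hom_on_map_poly_mult: "poly_over K p \<Longrightarrow> poly_over K q \<Longrightarrow> map_poly f (p * q) = map_poly f p * map_poly f q"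
  by (rule poly_eqI)
     (simp add: coeff_map_poly hom_on_0 hom_on_mult poly_over_def coeff_mult hom_on_sum subfield_mult[OF K])

lemma hom_on_poly: "poly_over K p \<Longrightarrow> x \<in> K \<Longrightarrow> f (poly p x) = poly (map_poly f p) (f x)"
proof (induction p)
  case (pCons c p)
  have "c \<in> K" "poly_over K p" using pCons.prems(1) unfolding poly_over_def
    by (metis coeff_pCons_0, metis coeff_pCons_Suc)
  thus ?case using pCons
    by (simp add: hom_on_add hom_on_mult subfield_mult[OF K] poly_over_eval[OF K] map_poly_pCons hom_on_0)
qed (simp add: hom_on_0)

text \<open>Sending \<open>poly p x\<close> to \<open>poly (map_poly f p) y\<close> is well defined:
  two choices of \<open>p\<close> differ by a multiple of \<open>m\<close>, and the image of
  \<open>m\<close> vanishes at \<open>y\<close>.\<close>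

lemma hom_on_extend1:
  assumes m: "is_min_poly K x m" and y: "poly (map_poly f m) y = 0"
  obtains g where "hom_on (adjoin1 K x) g" "\<And>z. z \<in> K \<Longrightarrow> g z = f z" "g x = y"
proof -
  define P where "P = (\<lambda>z p. poly_over K p \<and> poly p x = z)"
  define g where "g = (\<lambda>z. poly (map_poly f (SOME p. P z p)) y)"
  have g: "g (poly p x) = poly (map_poly f p) y" if p: "poly_over K p" for p
  proof -
    define q where "q = (SOME q. P (poly p x) q)"
    have "P (poly p x) q" unfolding q_def by (rule someI[of _ p]) (use p in \<open>auto simp: P_def\<close>)
    hence q: "poly_over K q" "poly q x = poly p x" by (auto simp: P_def)
    have d: "poly_over K (p - q)" "poly (p - q) x = 0" using p q by (auto intro: poly_over_diff[OF K])
    obtain h where h: "poly_over K h" "p - q = h * m" using min_poly_dvd[OF K m d] .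
    have mo: "poly_over K m" using m by (simp add: is_min_poly_def)
    have "p = q + h * m" using h by (simp add: algebra_simps)
    hence "map_poly f p = map_poly f q + map_poly f h * map_poly f m"
      by (simp add: hom_on_map_poly_add hom_on_map_poly_mult q h mo poly_over_mult[OF K])
    hence "poly (map_poly f p) y = poly (map_poly f q) y" using y by simp
    thus ?thesis unfolding g_def q_def by simp
  qed
  have 1: "g z = f z" if "z \<in> K" for z
    using g[of "[:z:]"] that by (simp add: poly_over_const[OF K] Polynomial.map_poly_pCons hom_on_0)
  have 2: "g x = y"
    using g[of "[:0, 1:]"] by (simp add: poly_over_X[OF K] Polynomial.map_poly_pCons hom_on_0 hom_on_1)
  have 3: "hom_on (adjoin1 K x) g" unfolding hom_on_def
  proof (intro conjI ballI)
    show "g 1 = 1" using 1[of 1] subfield_1[OF K] hom_on_1 by simp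
    fix a b assume "a \<in> adjoin1 K x" "b \<in> adjoin1 K x"
    then obtain p q where pq: "a = poly p x" "b = poly q x" "poly_over K p" "poly_over K q"
      unfolding adjoin1_def by blast
    show "g (a + b) = g a + g b"
      using g[OF poly_over_add[OF K pq(3,4)]] g[OF pq(3)] g[OF pq(4)] pq
      by (simp add: hom_on_map_poly_add)
    show "g (a * b) = g a * g b"
      using g[OF poly_over_mult[OF K pq(3,4)]] g[OF pq(3)] g[OF pq(4)] pq
      by (simp add: hom_on_map_poly_mult)
  qed
  show ?thesis by (rule that[OF 3 1 2])
qed

end

text \<open>At each step the image of the minimal polynomial has a complex root, and this root
  serves as the next value.\<close>

lemma hom_on_extend_list:
  assumes "complex_subfield K" "hom_on K f" "\<forall>x\<in>set xs. alg_over K x"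
  shows "\<exists>g. hom_on (adjoin_list K xs) g \<and> (\<forall>z\<in>K. g z = f z)"
  using assms
proof (induction xs arbitrary: K f)
  case Nil
  thus ?case by auto
next
  case (Cons x xs)
  note K = Cons.prems(1) and f = Cons.prems(2)
  obtain m where m: "is_min_poly K x m" using min_poly_exists[OF K] Cons.prems(3) by auto
  have "lead_coeff m = 1" "Polynomial.degree m > 0"
    using m min_poly_degree_pos[OF m] by (auto simp: is_min_poly_def)
  hence "poly.coeff (map_poly f m) (Polynomial.degree m) = 1"
    by (simp add: coeff_map_poly hom_on_0[OF K f] hom_on_1[OF K f])
  hence "Polynomial.degree (map_poly f m) > 0"
    using \<open>Polynomial.degree m > 0\<close> le_degree[of "map_poly f m" "Polynomial.degree m"] by simp
  hence "\<exists>y. poly (map_poly f m) y = 0"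
    by (intro fundamental_theorem_of_algebra) (auto simp: constant_degree)
  then obtain y where "poly (map_poly f m) y = 0" by blast
  then obtain g where g: "hom_on (adjoin1 K x) g" "\<And>z. z \<in> K \<Longrightarrow> g z = f z"
    using hom_on_extend1[OF K f m] by blast
  have "\<exists>h. hom_on (adjoin_list (adjoin1 K x) xs) h \<and> (\<forall>z\<in>adjoin1 K x. h z = g z)"
    using Cons.prems g by (intro Cons.IH complex_subfield_adjoin1)
      (auto intro: alg_over_mono[OF _ adjoin1_superset])
  thus ?case using g(2) adjoin1_superset[OF K, of x] by fastforce
qed

text \<open>In characteristic 0 the derivative is nonzero and of smaller degree, so minimality keeps
  it from vanishing at \<open>x\<close>.\<close>

lemma min_poly_separable:
  assumes K: "complex_subfield K" and m: "is_min_poly K x m"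
  shows "poly (pderiv m) x \<noteq> 0"
proof
  assume "poly (pderiv m) x = 0"
  moreover have "poly_over K (pderiv m)"
    using m by (auto intro: poly_over_pderiv[OF K] simp: is_min_poly_def)
  moreover have "pderiv m \<noteq> 0" using min_poly_degree_pos[OF m] by (simp add: pderiv_eq_0_iff)
  ultimately have "Polynomial.degree m \<le> Polynomial.degree (pderiv m)"
    using m by (auto simp: is_min_poly_def)
  thus False using min_poly_degree_pos[OF m] by (simp add: degree_pderiv)
qed

text \<open>As \<open>x\<close> lies outside \<open>K\<close>, its minimal polynomial has degree at
  least 2, and separability gives a root \<open>y\<close> other than \<open>x\<close>. Placing
  \<open>x\<close> first in the list lets \<open>y\<close> be prescribed as its image. The lemma
  replaces the Galois correspondence: what no homomorphism over \<open>K\<close> can move lies in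
  \<open>K\<close>.\<close>

lemma hom_moving_exists:
  assumes K: "complex_subfield K" and x: "alg_over K x" "x \<notin> K" and xs: "\<forall>y\<in>set xs. alg_over K y"
  obtains g where "hom_on (adjoin_list K (x # xs)) g" "\<And>z. z \<in> K \<Longrightarrow> g z = z" "g x \<noteq> x"
proof -
  obtain m where m: "is_min_poly K x m" using min_poly_exists[OF K x(1)] .
  have mx: "poly m x = 0" "poly_over K m" "lead_coeff m = 1" "m \<noteq> 0" using m by (auto simp: is_min_poly_def)
  then obtain q where q: "m = [:- x, 1:] * q" by (metis poly_eq_0_iff_dvd dvdE)
  have "Polynomial.degree q > 0"
  proof (rule ccontr)
    assume "\<not> Polynomial.degree q > 0"
    then obtain c where c: "q = [:c:]" by (auto elim: degree_eq_zeroE)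
    hence "c = 1" using mx q by (auto split: if_splits)
    hence "m = [:- x, 1:]" using q c by simp
    hence "- x \<in> K" using mx(2) unfolding poly_over_def by (metis coeff_pCons_0)
    thus False using x(2) subfield_uminus[OF K, of "- x"] by simp
  qed
  hence "\<exists>y. poly q y = 0"
    by (intro fundamental_theorem_of_algebra) (auto simp: constant_degree)
  then obtain y where y: "poly q y = 0" by blast
  have "pderiv m = q + [:- x, 1:] * pderiv q"
    unfolding q pderiv_mult by (simp add: pderiv_pCons)
  hence "poly (pderiv m) x = poly q x" by simp
  hence yx: "y \<noteq> x" using min_poly_separable[OF K m] y by auto
  have "poly (map_poly (\<lambda>x. x) m) y = 0" using q y by simp
  then obtain g where g: "hom_on (adjoin1 K x) g" "\<And>z. z \<in> K \<Longrightarrow> g z = z" "g x = y"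
    using hom_on_extend1[OF K hom_on_id m] by blast
  have "\<exists>h. hom_on (adjoin_list (adjoin1 K x) xs) h \<and> (\<forall>z\<in>adjoin1 K x. h z = g z)"
    using g xs by (intro hom_on_extend_list complex_subfield_adjoin1 K x)
      (auto intro: alg_over_mono[OF _ adjoin1_superset[OF K]])
  then obtain h where h: "hom_on (adjoin_list (adjoin1 K x) xs) h" "\<forall>z\<in>adjoin1 K x. h z = g z"
    by blast
  show ?thesis
    by (rule that[of h]) (use h g yx adjoin1_superset[OF K, of x] adjoin1_mem[OF K, of x] in auto)
qed

subsection \<open>Algebraic integers form a ring\<close>

definition int_span :: "complex set \<Rightarrow> complex set" where
  "int_span S = {\<Sum>s\<in>S. of_int (c s) * s | c :: complex \<Rightarrow> int. True}"

lemma int_span_incl: "finite S \<Longrightarrow> s \<in> S \<Longrightarrow> s \<in> int_span S"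
  unfolding int_span_def
  by (rule CollectI, rule exI[of _ "\<lambda>t. if t = s then 1 else 0"])
     (simp add: if_distrib[of "\<lambda>x. x * _"] if_distrib[of of_int] sum.delta cong: if_cong)

lemma int_span_0: "0 \<in> int_span S"
  unfolding int_span_def by (rule CollectI, rule exI[of _ "\<lambda>_. 0"]) simp

lemma int_span_add: "x \<in> int_span S \<Longrightarrow> y \<in> int_span S \<Longrightarrow> x + y \<in> int_span S"
  unfolding int_span_def
  by clarify (rule_tac x = "\<lambda>s. c s + ca s" in exI, simp add: sum.distrib algebra_simps)

lemma int_span_of_int_mult: "x \<in> int_span S \<Longrightarrow> of_int a * x \<in> int_span S"
  unfolding int_span_def
  by clarify (rule_tac x = "\<lambda>s. a * c s" in exI, simp add: sum_distrib_left algebra_simps)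

lemma int_span_sum: "(\<And>i. i \<in> A \<Longrightarrow> f i \<in> int_span S) \<Longrightarrow> sum f A \<in> int_span S"
  by (induction A rule: infinite_finite_induct) (auto intro: int_span_0 int_span_add)

text \<open>Cayley--Hamilton: \<open>x\<close> is an eigenvalue of an integer matrix.\<close>

lemma algebraic_int_if_int_span_stable:
  assumes S: "finite S" "s0 \<in> S" "s0 \<noteq> 0" and x: "\<And>s. s \<in> S \<Longrightarrow> x * s \<in> int_span S"
  shows "algebraic_int x"
proof -
  obtain ss where ss: "set ss = S" "distinct ss" using finite_distinct_list[OF S(1)] by blast
  define n where "n = length ss"
  have "\<exists>c :: complex \<Rightarrow> int. x * s = (\<Sum>t\<in>S. of_int (c t) * t)" if "s \<in> S" for s
    using x[OF that] unfolding int_span_def by auto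
  then obtain c :: "complex \<Rightarrow> complex \<Rightarrow> int" where
    c: "\<And>s. s \<in> S \<Longrightarrow> x * s = (\<Sum>t\<in>S. of_int (c s t) * t)" by metis
  define A :: "int mat" where "A = Matrix.mat n n (\<lambda>(i, j). c (ss ! i) (ss ! j))"
  define A' :: "complex mat" where "A' = map_mat of_int A"
  have A: "A \<in> carrier_mat n n" and A': "A' \<in> carrier_mat n n" by (auto simp: A_def A'_def)
  define v where "v = Matrix.vec n (\<lambda>i. ss ! i)"
  have v: "v \<in> carrier_vec n" by (simp add: v_def n_def)
  have "A' *\<^sub>v v = x \<cdot>\<^sub>v v"
  proof (rule eq_vecI)
    fix i assume "i < dim_vec (x \<cdot>\<^sub>v v)"
    hence i: "i < n" using v by simp
    hence si: "ss ! i \<in> S" using ss by (auto simp: n_def)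
    have "(A' *\<^sub>v v) $ i = (\<Sum>j<n. of_int (c (ss ! i) (ss ! j)) * ss ! j)"
      using i v A' by (simp add: A'_def A_def scalar_prod_def v_def n_def
          atLeast0LessThan)
    also have "\<dots> = (\<Sum>t\<in>S. of_int (c (ss ! i) t) * t)"
      using ss unfolding n_def by (intro sum.reindex_bij_betw bij_betw_nth) auto
    also have "\<dots> = (x \<cdot>\<^sub>v v) $ i" using c[OF si] i v by (simp add: v_def n_def)
    finally show "(A' *\<^sub>v v) $ i = (x \<cdot>\<^sub>v v) $ i" .
  qed (use A' v in auto)
  moreover have "v \<noteq> 0\<^sub>v n"
  proof
    assume *: "v = 0\<^sub>v n"
    obtain i where i: "i < n" "ss ! i = s0" using S(2) ss by (metis in_set_conv_nth n_def)
    hence "v $ i = s0" by (simp add: v_def)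
    thus False using i * S(3) by simp
  qed
  ultimately have "eigenvalue A' x"
    unfolding eigenvalue_def eigenvector_def using A' v by auto
  hence "poly (char_poly A') x = 0" using eigenvalue_root_char_poly[OF A'] by simp
  moreover have "char_poly A' = map_poly of_int (char_poly A)"
    unfolding A'_def by (rule of_int_hom.char_poly_hom[OF A])
  moreover have "lead_coeff (char_poly A) = 1" using degree_monic_char_poly[OF A] by simp
  ultimately show ?thesis by (auto simp: algebraic_int_altdef_ipoly)
qed

lemma algebraic_int_power_expand:
  fixes x :: complex
  assumes "algebraic_int x"
  obtains m and c :: "nat \<Rightarrow> int" where "m > 0" "x ^ m = (\<Sum>i<m. of_int (c i) * x ^ i)"
proof -
  obtain p :: "int poly" where p: "poly (map_poly of_int p) x = 0" "lead_coeff p = 1"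
    using assms by (auto simp: algebraic_int_altdef_ipoly)
  define m where "m = Polynomial.degree p"
  have "poly (map_poly of_int p) x = (\<Sum>i\<le>m. of_int (poly.coeff p i) * x ^ i)"
    by (simp add: poly_altdef degree_map_poly coeff_map_poly m_def)
  also have "\<dots> = x ^ m + (\<Sum>i<m. of_int (poly.coeff p i) * x ^ i)"
    using p(2) by (simp add: m_def lessThan_Suc_atMost[symmetric])
  finally have *: "x ^ m = (\<Sum>i<m. of_int (- poly.coeff p i) * x ^ i)"
    using p(1) by (simp add: sum_negf eq_neg_iff_add_eq_0)
  have "m > 0" using * by (cases "m = 0") auto
  thus ?thesis using * by (rule that)
qed

text \<open>The integer span of the products \<open>x ^ i * y ^ j\<close> below the two degrees is
  stable under multiplication by \<open>x\<close> and by \<open>y\<close>, hence by their sum and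
  product.\<close>

lemma
  fixes x y :: complex
  assumes "algebraic_int x" "algebraic_int y"
  shows algebraic_int_add_complex: "algebraic_int (x + y)"
    and algebraic_int_mult_complex: "algebraic_int (x * y)"
proof -
  obtain m and c :: "nat \<Rightarrow> int" where m: "m > 0" "x ^ m = (\<Sum>i<m. of_int (c i) * x ^ i)"
    using algebraic_int_power_expand[OF assms(1)] .
  obtain k and d :: "nat \<Rightarrow> int" where k: "k > 0" "y ^ k = (\<Sum>i<k. of_int (d i) * y ^ i)"
    using algebraic_int_power_expand[OF assms(2)] .
  define S where "S = (\<lambda>(i, j). x ^ i * y ^ j) ` ({..<m} \<times> {..<k})"
  have fin: "finite S" by (auto simp: S_def)
  have mem: "x ^ i * y ^ j \<in> int_span S" if "i < m" "j < k" for i j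
    by (rule int_span_incl[OF fin]) (use that in \<open>auto simp: S_def\<close>)
  have memx: "x ^ i * y ^ j \<in> int_span S" if "i \<le> m" "j < k" for i j
  proof (cases "i = m")
    case True
    have "x ^ i * y ^ j = (\<Sum>l<m. of_int (c l) * (x ^ l * y ^ j))"
      unfolding True m(2) sum_distrib_right by (simp add: mult_ac)
    thus ?thesis using that(2) by (auto intro!: int_span_sum int_span_of_int_mult mem)
  qed (use mem that in auto)
  have memy: "x ^ i * y ^ j \<in> int_span S" if "i < m" "j \<le> k" for i j
  proof (cases "j = k")
    case True
    have "x ^ i * y ^ j = (\<Sum>l<k. of_int (d l) * (x ^ i * y ^ l))"
      unfolding True k(2) sum_distrib_left by (simp add: mult_ac)
    thus ?thesis using that(1) by (auto intro!: int_span_sum int_span_of_int_mult mem)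
  qed (use mem that in auto)
  have 1: "1 \<in> S" using m(1) k(1) by (force simp: S_def)
  have X: "x * s \<in> int_span S" if s: "s \<in> int_span S" for s
  proof -
    have "x * t \<in> int_span S" if "t \<in> S" for t
      using that memx[of "Suc i" j for i j] by (auto simp: S_def mult.assoc Suc_le_eq)
    hence "(\<Sum>t\<in>S. of_int (c t) * (x * t)) \<in> int_span S" for c :: "complex \<Rightarrow> int"
      by (intro int_span_sum int_span_of_int_mult)
    moreover obtain c :: "complex \<Rightarrow> int" where "s = (\<Sum>t\<in>S. of_int (c t) * t)"
      using s unfolding int_span_def by blast
    ultimately show ?thesis by (simp add: sum_distrib_left mult.left_commute[of x])
  qed
  have Y: "y * s \<in> int_span S" if s: "s \<in> int_span S" for s
  proof -
    have "y * t \<in> int_span S" if "t \<in> S" for t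
      using that memy[of i "Suc j" for i j] by (auto simp: S_def mult_ac Suc_le_eq)
    hence "(\<Sum>t\<in>S. of_int (c t) * (y * t)) \<in> int_span S" for c :: "complex \<Rightarrow> int"
      by (intro int_span_sum int_span_of_int_mult)
    moreover obtain c :: "complex \<Rightarrow> int" where "s = (\<Sum>t\<in>S. of_int (c t) * t)"
      using s unfolding int_span_def by blast
    ultimately show ?thesis by (simp add: sum_distrib_left mult.left_commute[of y])
  qed
  show "algebraic_int (x + y)"
  proof (rule algebraic_int_if_int_span_stable[OF fin 1])
    fix s assume "s \<in> S"
    hence "s \<in> int_span S" by (rule int_span_incl[OF fin])
    thus "(x + y) * s \<in> int_span S" unfolding distrib_right by (intro int_span_add X Y)
  qed simp
  show "algebraic_int (x * y)"
  proof (rule algebraic_int_if_int_span_stable[OF fin 1])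
    fix s assume "s \<in> S"
    hence "s \<in> int_span S" by (rule int_span_incl[OF fin])
    thus "x * y * s \<in> int_span S" unfolding mult.assoc by (intro X Y)
  qed simp
qed

lemma algebraic_int_power_complex: "algebraic_int (x :: complex) \<Longrightarrow> algebraic_int (x ^ n)"
  by (induction n) (auto intro: algebraic_int_mult_complex)

lemma algebraic_int_sum_complex:
  "(\<And>i. i \<in> A \<Longrightarrow> algebraic_int (f i :: complex)) \<Longrightarrow> algebraic_int (sum f A)"
  by (induction A rule: infinite_finite_induct) (auto intro: algebraic_int_add_complex)

lemma algebraic_int_of_int_complex: "algebraic_int (of_int n :: complex)"
  by (rule int_imp_algebraic_int) auto

lemma algebraic_int_root_of_unity: "x ^ n = (1 :: complex) \<Longrightarrow> n > 0 \<Longrightarrow> algebraic_int x"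
  by (rule algebraic_int_root[where y = 1 and p = "Polynomial.monom 1 n"])
     (auto simp: poly_monom degree_monom_eq coeff_monom)

subsection \<open>Conjugates of roots of unity\<close>

text \<open>Frobenius modulo \<open>p\<close> in the ring of algebraic integers: the inner binomial
  coefficients are divisible by \<open>p\<close>. Congruences modulo \<open>p\<close> are expressed
  by an explicit integral witness.\<close>

lemma add_power_prime:
  fixes a b :: complex
  assumes p: "Factorial_Ring.prime (p :: nat)" and "algebraic_int a" "algebraic_int b"
  obtains w where "algebraic_int w" "(a + b) ^ p = a ^ p + b ^ p + of_nat p * w"
proof -
  define w where "w = (\<Sum>k\<in>{0<..<p}. of_nat ((p choose k) div p) * (a ^ k * b ^ (p - k)))"
  have p0: "p > 0" using p prime_gt_0_nat by blast
  have "(a + b) ^ p = (\<Sum>k\<le>p. of_nat (p choose k) * a ^ k * b ^ (p - k))"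
    by (rule binomial_ring)
  also have "{..p} = insert 0 (insert p {0<..<p})" by auto
  also have "(\<Sum>k\<in>\<dots>. of_nat (p choose k) * a ^ k * b ^ (p - k)) =
      b ^ p + (a ^ p + (\<Sum>k\<in>{0<..<p}. of_nat (p choose k) * a ^ k * b ^ (p - k)))"
    using p0 by (subst sum.insert; simp)
  also have "(\<Sum>k\<in>{0<..<p}. of_nat (p choose k) * a ^ k * b ^ (p - k)) = of_nat p * w"
    unfolding w_def sum_distrib_left
  proof (rule sum.cong)
    fix k assume k: "k \<in> {0<..<p}"
    have "p dvd (p choose k)" by (rule dvd_choose_prime) (use k p in auto)
    hence "(p choose k) = p * ((p choose k) div p)" by simp
    hence "(of_nat (p choose k) :: complex) = of_nat p * of_nat ((p choose k) div p)"
      by (metis of_nat_mult)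
    thus "of_nat (p choose k) * a ^ k * b ^ (p - k) =
        of_nat p * (of_nat ((p choose k) div p) * (a ^ k * b ^ (p - k)))" by simp
  qed auto
  finally have "(a + b) ^ p = a ^ p + b ^ p + of_nat p * w" by simp
  moreover have "algebraic_int w" unfolding w_def
    using assms algebraic_int_of_int_complex[of "int k" for k]
    by (intro algebraic_int_sum_complex algebraic_int_mult_complex algebraic_int_power_complex) auto
  ultimately show ?thesis using that by blast
qed

text \<open>Fermat's little theorem in the same witness form, so that it combines with Frobenius for
  polynomials with integer coefficients.\<close>

lemma of_int_power_prime_cong:
  assumes p: "Factorial_Ring.prime (p :: nat)"
  shows "\<exists>t. algebraic_int t \<and> (of_int c :: complex) ^ p = of_int c + of_nat p * t"
proof (induction c rule: int_induct[where k = 0])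
  case base
  thus ?case using p prime_gt_0_nat[of p] by (intro exI[of _ 0]) (auto simp: power_0_left)
next
  case (step1 i)
  then obtain t where t: "algebraic_int t" "(of_int i :: complex) ^ p = of_int i + of_nat p * t" by blast
  obtain w where w: "algebraic_int w" "(of_int i + 1 :: complex) ^ p = of_int i ^ p + 1 ^ p + of_nat p * w"
    using add_power_prime[OF p algebraic_int_of_int_complex[of i] algebraic_int_of_int_complex[of 1]] by auto
  have "(of_int (i + 1) :: complex) ^ p = of_int (i + 1) + of_nat p * (t + w)"
    using w(2) t(2) by (simp add: algebra_simps)
  thus ?case using algebraic_int_add_complex[OF t(1) w(1)] by blast
next
  case (step2 i)
  then obtain t where t: "algebraic_int t" "(of_int i :: complex) ^ p = of_int i + of_nat p * t" by blast
  obtain w where w: "algebraic_int w"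
    "(of_int (i - 1) + 1 :: complex) ^ p = of_int (i - 1) ^ p + 1 ^ p + of_nat p * w"
    using add_power_prime[OF p algebraic_int_of_int_complex[of "i - 1"] algebraic_int_of_int_complex[of 1]] by auto
  have "(of_int (i - 1) :: complex) ^ p = of_int (i - 1) + of_nat p * (t + - w)"
    using w(2) t(2) by (simp add: algebra_simps)
  thus ?case using algebraic_int_add_complex[OF t(1) algebraic_int_minus[OF w(1)]] by blast
qed

lemma poly_power_prime_cong:
  fixes f :: "int poly" and z :: complex
  assumes p: "Factorial_Ring.prime (p :: nat)" and z: "algebraic_int z"
  shows "\<exists>y. algebraic_int y \<and>
    poly (map_poly of_int f) (z ^ p) = (poly (map_poly of_int f) z) ^ p + of_nat p * y"
proof (induction f)
  case 0
  thus ?case using p prime_gt_0_nat[of p] by (intro exI[of _ 0]) (auto simp: power_0_left)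
next
  case (pCons c f)
  define F where "F = (\<lambda>z :: complex. poly (map_poly of_int f) z)"
  have algF: "algebraic_int (F z)" unfolding F_def poly_altdef
    by (intro algebraic_int_sum_complex algebraic_int_mult_complex algebraic_int_power_complex z)
       (simp add: coeff_map_poly algebraic_int_of_int_complex)
  from pCons.IH obtain y where y: "algebraic_int y" "F (z ^ p) = F z ^ p + of_nat p * y"
    unfolding F_def by blast
  obtain w where w: "algebraic_int w"
    "(of_int c + z * F z) ^ p = of_int c ^ p + (z * F z) ^ p + of_nat p * w"
    using add_power_prime[OF p algebraic_int_of_int_complex algebraic_int_mult_complex[OF z algF]] .
  obtain t where t: "algebraic_int t" and c: "(of_int c :: complex) ^ p = of_int c + of_nat p * t"
    using of_int_power_prime_cong[OF p] by blast
  have "poly (map_poly of_int (pCons c f)) (z ^ p) = of_int c + z ^ p * F (z ^ p)"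
    unfolding F_def of_int_hom.map_poly_pCons_hom by simp
  also have "\<dots> = (of_int c + z * F z) ^ p + of_nat p * (z ^ p * y - w - t)"
    unfolding w(2) c y(2) by (simp add: algebra_simps)
  also have "of_int c + z * F z = poly (map_poly of_int (pCons c f)) z"
    unfolding F_def of_int_hom.map_poly_pCons_hom by simp
  finally have eq: "poly (map_poly of_int (pCons c f)) (z ^ p) =
    poly (map_poly of_int (pCons c f)) z ^ p + of_nat p * (z ^ p * y - w - t)" .
  have "algebraic_int (z ^ p * y + (- w) + (- t))"
    by (intro algebraic_int_add_complex algebraic_int_mult_complex algebraic_int_power_complex
        y w z t algebraic_int_minus)
  thus ?case using eq by (intro exI[of _ "z ^ p * y - w - t"]) simp
qed

text \<open>Up to sign the coefficients are elementary symmetric functions of the roots. This makes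
  the rational minimal polynomial of a root of unity integral.\<close>

lemma algebraic_int_coeff_prod_linear:
  "(\<And>x. x \<in># A \<Longrightarrow> algebraic_int (x :: complex)) \<Longrightarrow>
     algebraic_int (poly.coeff (\<Prod>x\<in>#A. [:- x, 1:]) i)"
proof (induction A arbitrary: i)
  case empty
  thus ?case by (auto simp: coeff_pCons split: nat.splits)
next
  case (add x A)
  have "algebraic_int (- x * poly.coeff (\<Prod>x\<in>#A. [:- x, 1:]) i +
      (case i of 0 \<Rightarrow> 0 | Suc j \<Rightarrow> poly.coeff (\<Prod>x\<in>#A. [:- x, 1:]) j))"
    using add by (intro algebraic_int_add_complex algebraic_int_mult_complex)
      (auto split: nat.splits)
  thus ?case by (simp add: coeff_pCons split: nat.splits)
qed

lemma poly_over_X_power_minus_1: "complex_subfield K \<Longrightarrow> poly_over K (Polynomial.monom 1 n - 1)"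
  by (intro poly_over_diff poly_over_monom poly_over_1 subfield_1)

text \<open>With \<open>e = v / u\<close>, the numbers \<open>1 - e ^ j\<close> for
  \<open>j < n\<close> are multiples of \<open>1 - e\<close> and add up to \<open>n\<close>, because
  the powers of \<open>e\<close> sum to 0.\<close>

lemma roots_of_unity_diff_dvd:
  fixes u v :: complex
  assumes "u ^ n = 1" "v ^ n = 1" "u \<noteq> v" "n > 0"
  obtains w where "algebraic_int w" "(u - v) * w = of_nat n"
proof -
  define e where "e = v / u"
  have u0: "u \<noteq> 0" using assms by (auto simp: power_0_left)
  have e: "e ^ n = 1" "e \<noteq> 1" using assms u0 by (auto simp: e_def power_divide)
  have un: "u * u ^ (n - 1) = 1" using assms by (metis power_eq_if less_irrefl)
  define s where "s = (\<Sum>j<n. \<Sum>i<j. e ^ i)"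
  have "(1 - e) * s = (\<Sum>j<n. 1 - e ^ j)"
    unfolding s_def sum_distrib_left by (intro sum.cong refl) (simp add: one_diff_power_eq sum_distrib_left)
  also have "\<dots> = of_nat n - (\<Sum>j<n. e ^ j)" by (simp add: sum_subtractf)
  also have "(\<Sum>j<n. e ^ j) = 0" using e by (simp add: geometric_sum)
  finally have "(1 - e) * s = of_nat n" by simp
  moreover have "u - v = u * (1 - e)" using u0 by (simp add: e_def field_simps)
  moreover have "u * (1 - e) * (s * u ^ (n - 1)) = (u * u ^ (n - 1)) * ((1 - e) * s)"
    by (simp only: mult_ac)
  ultimately have "(u - v) * (s * u ^ (n - 1)) = of_nat n"
    by (metis un mult_1)
  moreover have "algebraic_int (s * u ^ (n - 1))" unfolding s_def
    using algebraic_int_root_of_unity[OF assms(1,4)] algebraic_int_root_of_unity[OF e(1) assms(4)]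
    by (intro algebraic_int_mult_complex algebraic_int_sum_complex algebraic_int_power_complex)
  ultimately show ?thesis using that by blast
qed

text \<open>If \<open>m\<close> is the minimal polynomial of the root of unity \<open>z\<close>, then \<open>m(z\<^sup>p) \<equiv> m(z)\<^sup>p = 0\<close> modulo \<open>p\<close>; were
  \<open>m(z\<^sup>p)\<close> nonzero, it would be a product of differences of distinct \<open>n\<close>-th roots of unity and hence
  divide a power of \<open>n\<close>.\<close>

lemma root_of_unity_conjugate_prime:
  fixes z :: complex
  assumes z: "z ^ n = 1" and n: "n > 0" and p: "Factorial_Ring.prime p" "\<not> p dvd n"
    and g: "poly_over \<rat> g" "poly g z = 0"
  shows "poly g (z ^ p) = 0"
proof -
  note Q = complex_subfield_Rats
  have "alg_over \<rat> z" by (rule alg_over_root[OF Q _ n]) (simp add: z)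
  then obtain m where m: "is_min_poly \<rat> z m" using min_poly_exists[OF Q] by blast
  have m': "lead_coeff m = 1" "m \<noteq> 0" "poly_over \<rat> m" "poly m z = 0"
    using m by (auto simp: is_min_poly_def)
  obtain q where q: "Polynomial.monom 1 n - 1 = q * m"
    using min_poly_dvd[OF Q m poly_over_X_power_minus_1[OF Q, of n]] z by (auto simp: poly_monom)
  have root: "x ^ n = 1" if "poly m x = 0" for x
  proof -
    have "poly (Polynomial.monom 1 n - 1) x = 0" unfolding q using that by simp
    thus ?thesis by (simp add: poly_monom)
  qed
  \<comment> \<open>The roots are kept as a multiset, so their multiplicities need not be
    known.\<close>
  obtain A where A: "m = (\<Prod>x\<in>#A. [:- x, 1:])"
    using alg_closed_imp_factorization[OF m'(2)] m'(1) by auto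
  have rootA: "x ^ n = 1" if "x \<in># A" for x
    by (rule root) (use that in \<open>auto simp: A poly_prod_mset\<close>)
  have "poly.coeff m i \<in> \<int>" for i
  proof (rule rational_algebraic_int_is_int)
    show "algebraic_int (poly.coeff m i)" unfolding A
      by (rule algebraic_int_coeff_prod_linear) (use rootA n algebraic_int_root_of_unity in auto)
    show "poly.coeff m i \<in> \<rat>" using m'(3) by (simp add: poly_over_def)
  qed
  hence coeff: "poly.coeff m i = of_int \<lfloor>Re (poly.coeff m i)\<rfloor>" for i
    by (metis Ints_cases Re_complex_of_real floor_of_int of_real_of_int_eq)
  have "m = map_poly of_int (map_poly (\<lambda>c. \<lfloor>Re c\<rfloor>) m)"
    by (rule poly_eqI) (simp add: coeff_map_poly flip: coeff)
  then obtain f :: "int poly" where f: "m = map_poly of_int f" by blast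
  have "poly m (z ^ p) = 0"
  proof (rule ccontr)
    assume nz: "poly m (z ^ p) \<noteq> 0"
    have zp: "(z ^ p) ^ n = 1" by (metis power_mult mult.commute power_one z)
    obtain y where y: "algebraic_int y" "poly m (z ^ p) = of_nat p * y"
      using poly_power_prime_cong[OF p(1) algebraic_int_root_of_unity[OF z n], of f] m'(4)
        prime_gt_0_nat[OF p(1)] by (auto simp: f power_0_left)
    have "\<exists>W. algebraic_int W \<and> (\<Prod>x\<in>#B. z ^ p - x) * W = of_nat n ^ size B" if "B \<subseteq># A" for B
      using that
    proof (induction B)
      case (add x B)
      hence x: "x \<in># A" by (auto dest: mset_subset_eq_insertD)
      hence ne: "z ^ p \<noteq> x" using nz by (auto simp: A poly_prod_mset)
      obtain w where w: "algebraic_int w" "(z ^ p - x) * w = of_nat n"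
        using roots_of_unity_diff_dvd[OF zp rootA[OF x] ne n] .
      have "B \<subseteq># A" using add.prems by (meson mset_subset_eq_add_right subset_mset.order_trans mset_subset_eq_insertD subset_mset.less_imp_le)
      then obtain W where W: "algebraic_int W" "(\<Prod>x\<in>#B. z ^ p - x) * W = of_nat n ^ size B"
        using add.IH by blast
      have "(\<Prod>x\<in>#add_mset x B. z ^ p - x) * (w * W) =
          ((z ^ p - x) * w) * ((\<Prod>x\<in>#B. z ^ p - x) * W)" by (simp add: mult_ac)
      also have "\<dots> = of_nat n ^ size (add_mset x B)" unfolding w(2) W(2) by simp
      finally show ?case using algebraic_int_mult_complex[OF w(1) W(1)] by blast
    qed (auto intro: exI[of _ 1])
    from this[of A] obtain W where W: "algebraic_int W" "(\<Prod>x\<in>#A. z ^ p - x) * W = of_nat n ^ size A"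
      by auto
    have "poly m (z ^ p) = (\<Prod>x\<in>#A. z ^ p - x)"
      by (simp add: A poly_prod_mset image_mset.compositionality comp_def)
    hence eq: "of_nat p * (y * W) = of_nat n ^ size A" using W(2) y(2) by (simp add: mult_ac)
    have p0: "(of_nat p :: complex) \<noteq> 0" using prime_gt_0_nat[OF p(1)] by simp
    \<comment> \<open>The equation makes the algebraic integer \<open>y * W\<close> rational, hence
      an integer, which turns divisibility by \<open>p\<close> into a statement about
      integers.\<close>
    have "y * W = of_rat (of_nat n ^ size A / of_nat p)"
      using eq p0 by (simp add: of_rat_divide of_rat_power field_simps)
    hence "y * W \<in> \<rat>" by simp
    moreover have "algebraic_int (y * W)" by (rule algebraic_int_mult_complex[OF y(1) W(1)])
    ultimately have "y * W \<in> \<int>" by (rule rational_algebraic_int_is_int[rotated])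
    then obtain k where k: "y * W = of_int k" by (auto elim: Ints_cases)
    have "(of_int (int p * k) :: complex) = of_int (int n ^ size A)" using eq k by simp
    hence "int p * k = int n ^ size A" by (simp only: of_int_eq_iff)
    hence "int p dvd int (n ^ size A)" by (metis dvd_triv_left of_nat_power)
    hence "p dvd n ^ size A" by (simp only: int_dvd_int_iff)
    thus False using p prime_dvd_power by blast
  qed
  moreover obtain q where "g = q * m" using min_poly_dvd[OF Q m g] by blast
  ultimately show ?thesis by simp
qed

text \<open>The exponent is reached one prime at a time, with \<open>z\<close> replaced by
  \<open>z ^ p\<close>; each prime factor of \<open>a\<close> avoids \<open>n\<close>.\<close>

lemma root_of_unity_conjugate:
  fixes z :: complex
  assumes "z ^ n = 1" "n > 0" "Rings.coprime a n" "a > 0" "poly_over \<rat> g" "poly g z = 0"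
  shows "poly g (z ^ a) = 0"
  using assms
proof (induction a arbitrary: z rule: less_induct)
  case (less a)
  show ?case
  proof (cases "a = 1")
    case False
    then obtain p where p: "Factorial_Ring.prime p" "p dvd a" using prime_factor_nat by blast
    then obtain b where b: "a = p * b" by (elim dvdE)
    have "\<not> p dvd n" using p less.prems(3) by (meson coprime_common_divisor not_prime_unit)
    hence "poly g (z ^ p) = 0" using root_of_unity_conjugate_prime less.prems p by blast
    moreover have "(z ^ p) ^ n = 1" by (metis power_mult mult.commute power_one less.prems(1))
    moreover have "b < a" "b > 0" using b less.prems(4) prime_gt_1_nat[OF p(1)] by auto
    moreover have "Rings.coprime b n" using less.prems(3) b by simp
    ultimately have "poly g ((z ^ p) ^ b) = 0" using less.IH[of b "z ^ p"] less.prems by blast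
    thus ?thesis by (simp add: b power_mult)
  qed (use less.prems in simp)
qed

subsection \<open>Cyclotomic fields\<close>

abbreviation cyclotomic :: "nat \<Rightarrow> complex set" where
  "cyclotomic n \<equiv> Q_adjoin {zeta n}"

lemma zeta_power: "zeta n ^ k = cis (2 * pi * real k / real n)"
  by (simp add: zeta_def Complex.DeMoivre mult_ac)

lemma zeta_power_self: "n > 0 \<Longrightarrow> zeta n ^ n = 1"
  by (simp add: zeta_power)

lemma zeta_nonzero [simp]: "zeta n \<noteq> 0"
  by (simp add: zeta_def)

lemma zeta_power_mod: "n > 0 \<Longrightarrow> zeta n ^ (k mod n) = zeta n ^ k"
  by (metis div_mult_mod_eq mult.commute mult_1 power_add power_mult power_one zeta_power_self)

lemma root_of_unity_eq_zeta_power: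
  assumes "x ^ n = 1" "n > 0"
  obtains j where "j < n" "x = zeta n ^ j"
  using Complex.bij_betw_roots_unity[OF assms(2)] assms(1) by (auto simp: bij_betw_def zeta_power image_iff)

lemma zeta_power_eq_iff:
  assumes "n > 0"
  shows "zeta n ^ i = zeta n ^ j \<longleftrightarrow> i mod n = j mod n"
proof -
  have "inj_on (\<lambda>k. zeta n ^ k) {..<n}"
    using Complex.bij_betw_roots_unity[OF assms] by (simp add: bij_betw_def zeta_power)
  hence "zeta n ^ (i mod n) = zeta n ^ (j mod n) \<longleftrightarrow> i mod n = j mod n"
    using assms by (auto simp: inj_on_def)
  thus ?thesis using assms by (simp add: zeta_power_mod)
qed

lemma zeta_power_eq_1_iff: "n > 0 \<Longrightarrow> zeta n ^ i = 1 \<longleftrightarrow> n dvd i"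
  using zeta_power_eq_iff[of n i 0] by (simp add: dvd_eq_mod_eq_0)

lemma zeta_mult_power: "k > 0 \<Longrightarrow> zeta (n * k) ^ k = zeta n"
  by (simp add: zeta_power) (simp add: zeta_def)

lemma alg_over_zeta: "complex_subfield K \<Longrightarrow> n > 0 \<Longrightarrow> alg_over K (zeta n)"
  by (rule alg_over_root[of _ _ n]) (auto simp: zeta_power_self subfield_1)

lemma zeta_in_cyclotomic: "zeta n ^ k \<in> cyclotomic n"
  by (intro subfield_power complex_subfield_Q_adjoin Q_adjoin_incl) simp

lemma root_of_unity_in_cyclotomic: "x ^ n = 1 \<Longrightarrow> n > 0 \<Longrightarrow> x \<in> cyclotomic n"
  by (metis root_of_unity_eq_zeta_power zeta_in_cyclotomic)

lemma cyclotomic_eq_adjoin1: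
  assumes "n > 0"
  shows "cyclotomic n = adjoin1 \<rat> (zeta n)"
proof
  show "cyclotomic n \<subseteq> adjoin1 \<rat> (zeta n)"
    using assms by (intro Q_adjoin_least complex_subfield_adjoin1 complex_subfield_Rats alg_over_zeta)
      (auto intro: adjoin1_mem complex_subfield_Rats)
  show "adjoin1 \<rat> (zeta n) \<subseteq> cyclotomic n"
    by (intro adjoin1_least complex_subfield_Q_adjoin Rats_subset_subfield Q_adjoin_incl) auto
qed

lemma cyclotomic_mono:
  assumes "n dvd N" "N > 0"
  shows "cyclotomic n \<subseteq> cyclotomic N"
proof -
  obtain k where k: "N = n * k" "k > 0" using assms by (auto elim!: dvdE)
  have "zeta n \<in> cyclotomic N"
    using zeta_mult_power[OF k(2), of n] zeta_in_cyclotomic[of N k] k(1) by simp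
  thus ?thesis by (intro Q_adjoin_least complex_subfield_Q_adjoin) auto
qed

lemma hom_on_poly_Rats:
  assumes K: "complex_subfield K" and f: "hom_on K f" and p: "poly_over \<rat> p" and x: "x \<in> K"
  shows "f (poly p x) = poly p (f x)"
proof -
  have "map_poly f p = p"
    using p by (intro poly_eqI) (simp add: coeff_map_poly hom_on_0[OF K f] poly_over_def hom_on_Rats[OF K f])
  moreover have "poly_over K p" using poly_over_mono[OF p Rats_subset_subfield[OF K]] .
  ultimately show ?thesis using hom_on_poly[OF K f _ x, of p] by simp
qed

text \<open>This is irreducibility of the cyclotomic polynomial in usable form:
  \<open>zeta n ^ a\<close> is a root of the minimal polynomial of \<open>zeta n\<close>.\<close>

lemma hom_on_cyclotomic_exists:
  assumes n: "n > 0" and a: "Rings.coprime a n" "a > 0"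
  obtains g where "hom_on (cyclotomic n) g" "g (zeta n) = zeta n ^ a"
proof -
  note Q = complex_subfield_Rats
  obtain m where m: "is_min_poly \<rat> (zeta n) m" using min_poly_exists[OF Q alg_over_zeta[OF Q n]] .
  hence "poly m (zeta n ^ a) = 0"
    using root_of_unity_conjugate[OF zeta_power_self[OF n] n a] by (auto simp: is_min_poly_def)
  then obtain g where "hom_on (adjoin1 \<rat> (zeta n)) g" "g (zeta n) = zeta n ^ a"
    using hom_on_extend1[OF Q hom_on_id m, of "zeta n ^ a"] by auto
  thus ?thesis using that by (simp add: cyclotomic_eq_adjoin1[OF n])
qed

text \<open>The image is a power \<open>zeta n ^ j\<close>. With \<open>d = gcd j n\<close>, the map
  sends \<open>zeta n ^ (n div d)\<close> to 1, so injectivity forces \<open>d = 1\<close>.\<close>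

lemma hom_on_zeta:
  assumes K: "complex_subfield K" "cyclotomic n \<subseteq> K" and g: "hom_on K g" and n: "n > 0"
  obtains a where "Rings.coprime a n" "a > 0" "g (zeta n) = zeta n ^ a"
proof -
  have z: "zeta n \<in> K" using K(2) zeta_in_cyclotomic[of n 1] by auto
  have "g (zeta n) ^ n = 1"
    using hom_on_power[OF K(1) g z, of n] zeta_power_self[OF n] hom_on_1[OF K(1) g] by simp
  then obtain j where j: "g (zeta n) = zeta n ^ j" using root_of_unity_eq_zeta_power n by metis
  have "Rings.coprime j n"
  proof -
    define d where "d = gcd j n"
    have d: "d dvd n" "d dvd j" "d > 0" using n by (auto simp: d_def)
    have "g (zeta n ^ (n div d)) = zeta n ^ (j * (n div d))"
      using hom_on_power[OF K(1) g z] j by (simp add: power_mult)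
    also have "j * (n div d) = (j div d) * n" using d by (metis dvd_div_mult div_mult_swap mult.commute)
    also have "zeta n ^ \<dots> = 1" using n by (simp add: zeta_power_eq_1_iff)
    also have "\<dots> = g 1" using hom_on_1[OF K(1) g] by simp
    finally have "zeta n ^ (n div d) = 1"
      using hom_on_inj[OF K(1) g] subfield_power[OF K(1) z] subfield_1[OF K(1)] by blast
    hence "n dvd n div d" using n by (simp add: zeta_power_eq_1_iff)
    moreover obtain k where k: "n = d * k" using d(1) by (rule dvdE)
    ultimately have "d * k dvd k" using d(3) by simp
    moreover have "k > 0" using k n by (cases k) auto
    ultimately have "d * k \<le> k" by (simp add: dvd_imp_le)
    hence "d = 1" using d(3) \<open>k > 0\<close> by (cases d) auto
    thus ?thesis by (simp add: d_def coprime_iff_gcd_eq_1)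
  qed
  \<comment> \<open>Adding \<open>n\<close> makes the exponent positive; for \<open>n = 1\<close>
    the exponent \<open>j\<close> may be 0.\<close>
  hence "Rings.coprime (j + n) n" by (simp add: coprime_iff_gcd_eq_1)
  moreover have "g (zeta n) = zeta n ^ (j + n)" using j n by (simp add: power_add zeta_power_self)
  ultimately show ?thesis using that[of "j + n"] n by simp
qed

text \<open>On \<open>n\<close>-th roots of unity, conjugation is the power map with exponent
  \<open>n - 1\<close>, which commutes with \<open>g\<close>; all of the cyclotomic field consists
  of rational polynomials in \<open>zeta n\<close>.\<close>

lemma hom_on_cnj:
  assumes K: "complex_subfield K" "cyclotomic n \<subseteq> K" and g: "hom_on K g" and n: "n > 0"
    and x: "x \<in> cyclotomic n"
  shows "cnj x \<in> cyclotomic n" "g (cnj x) = cnj (g x)"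
proof -
  have U: "complex_subfield UNIV" "hom_on UNIV cnj"
    by (auto simp: complex_subfield_def hom_on_def)
  obtain p where p: "poly_over \<rat> p" "x = poly p (zeta n)"
    using x cyclotomic_eq_adjoin1[OF n] by (auto simp: adjoin1_def)
  have root: "cnj y = y ^ (n - 1)" if "y ^ n = 1" for y
  proof -
    have "norm y = 1" using power_eq_imp_eq_norm[of y n 1] that n by simp
    hence "y * cnj y = 1" using complex_norm_square[of y] by simp
    moreover have "y * y ^ (n - 1) = 1" using that n by (simp flip: power_Suc)
    moreover have "y \<noteq> 0" using \<open>norm y = 1\<close> by auto
    ultimately show ?thesis by (metis mult_left_cancel)
  qed
  have z: "zeta n \<in> K" using K(2) zeta_in_cyclotomic[of n 1] by auto
  have gz: "g (zeta n) ^ n = 1"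
    using hom_on_power[OF K(1) g z, of n] zeta_power_self[OF n] hom_on_1[OF K(1) g] by simp
  have c: "cnj x = poly p (zeta n ^ (n - 1))"
    unfolding p(2) using hom_on_poly_Rats[OF U p(1), of "zeta n"] root[OF zeta_power_self[OF n]] by simp
  show "cnj x \<in> cyclotomic n" unfolding c
    by (intro poly_over_eval complex_subfield_Q_adjoin zeta_in_cyclotomic
        poly_over_mono[OF p(1) Rats_subset_subfield])
  have "g (cnj x) = poly p (g (zeta n) ^ (n - 1))"
    unfolding c using hom_on_poly_Rats[OF K(1) g p(1)] subfield_power[OF K(1) z]
      hom_on_power[OF K(1) g z] by simp
  also have "\<dots> = cnj (poly p (g (zeta n)))"
    using hom_on_poly_Rats[OF U p(1), of "g (zeta n)"] root[OF gz] by simp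
  also have "poly p (g (zeta n)) = g x" using hom_on_poly_Rats[OF K(1) g p(1) z] p(2) by simp
  finally show "g (cnj x) = cnj (g x)" .
qed

text \<open>Homomorphisms show that the roots of \<open>m\<close> are exactly the powers of
  \<open>zeta n\<close> by totatives. They also carry a multiple root back to \<open>zeta n\<close>,
  against separability, so counting roots gives the degree.\<close>

lemma degree_min_poly_zeta:
  assumes n: "n > 0" and m: "is_min_poly \<rat> (zeta n) m"
  shows "Polynomial.degree m = totient n"
proof -
  note Q = complex_subfield_Rats
  have sub: "complex_subfield (adjoin1 \<rat> (zeta n))"
    by (rule complex_subfield_adjoin1[OF Q alg_over_zeta[OF Q n]])
  have z: "zeta n \<in> adjoin1 \<rat> (zeta n)" by (rule adjoin1_mem[OF Q])
  have m': "lead_coeff m = 1" "m \<noteq> 0" "poly_over \<rat> m" "poly m (zeta n) = 0"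
    using m by (auto simp: is_min_poly_def)
  have hom: "\<exists>g. hom_on (adjoin1 \<rat> (zeta n)) g \<and> g (zeta n) = y" if "poly m y = 0" for y
    using hom_on_extend1[OF Q hom_on_id m, of y] that by auto
  have "{x. poly m x = 0} = (\<lambda>a. zeta n ^ a) ` totatives n"
  proof (intro equalityI subsetI)
    fix y assume "y \<in> {x. poly m x = 0}"
    then obtain g where g: "hom_on (adjoin1 \<rat> (zeta n)) g" "g (zeta n) = y" using hom by auto
    obtain a where a: "Rings.coprime a n" "a > 0" "y = zeta n ^ a"
      using hom_on_zeta[OF sub _ g(1) n] g(2) cyclotomic_eq_adjoin1[OF n] by auto
    show "y \<in> (\<lambda>a. zeta n ^ a) ` totatives n"
    \<comment> \<open>The totatives of 1 consist of 1 and not of 0, so reducing \<open>a\<close>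
      modulo \<open>n\<close> would miss them.\<close>
    proof (cases "n = 1")
      case True
      thus ?thesis using a by (auto simp: zeta_def)
    next
      case False
      hence "a mod n \<noteq> 0" using a(1) n by (metis coprime_common_divisor dvd_refl mod_0_imp_dvd nat_dvd_1_iff_1)
      hence "a mod n \<in> totatives n"
        using a n by (auto simp: in_totatives_iff intro: less_imp_le)
      thus ?thesis using a n zeta_power_mod by (intro image_eqI[of _ _ "a mod n"]) auto
    qed
  next
    fix y assume "y \<in> (\<lambda>a. zeta n ^ a) ` totatives n"
    thus "y \<in> {x. poly m x = 0}"
      using root_of_unity_conjugate[OF zeta_power_self[OF n] n _ _ m'(3,4)]
      by (auto simp: in_totatives_iff)
  qed
  moreover have "inj_on (\<lambda>a. zeta n ^ a) (totatives n)"
  proof (cases "n = 1")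
    case False
    have "a mod n = a" if "a \<in> totatives n" for a
      using totatives_less[OF that] False n by simp
    thus ?thesis using n by (auto simp: inj_on_def zeta_power_eq_iff)
  qed auto
  ultimately have card: "card {x. poly m x = 0} = totient n" by (simp add: card_image totient_def)
  have "rsquarefree m" unfolding rsquarefree_roots
  proof (intro allI notI)
    fix y assume y: "poly m y = 0 \<and> poly (pderiv m) y = 0"
    then obtain g where g: "hom_on (adjoin1 \<rat> (zeta n)) g" "g (zeta n) = y" using hom by auto
    have "g (poly (pderiv m) (zeta n)) = poly (pderiv m) y"
      using hom_on_poly_Rats[OF sub g(1) poly_over_pderiv[OF Q m'(3)] z] g(2) by simp
    moreover have "poly (pderiv m) (zeta n) \<in> adjoin1 \<rat> (zeta n)"
      using poly_over_pderiv[OF Q m'(3)] by (auto simp: adjoin1_def)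
    ultimately have "poly (pderiv m) (zeta n) = 0"
      using y hom_on_eq_0_iff[OF sub g(1)] by auto
    thus False using min_poly_separable[OF Q m] by simp
  qed
  hence "m = (\<Prod>z | poly m z = 0. [:- z, 1:])"
    using complex_poly_decompose_rsquarefree[of m] m'(1) by simp
  hence "Polynomial.degree m = Polynomial.degree (\<Prod>z | poly m z = 0. [:- z, 1:])" by simp
  also have "\<dots> = (\<Sum>z | poly m z = 0. 1)"
    by (subst degree_prod_sum_eq) auto
  also have "\<dots> = totient n" using card by simp
  finally show ?thesis .
qed

subsection \<open>Dimensions\<close>

text \<open>The dimension predicate grows by one line extension at a time, so basis vectors are
  added one by one; independence keeps \<open>t k\<close> outside the span of the earlier
  ones.\<close>

lemma dimension_of_basis:
  assumes K: "complex_subfield K"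
    and "\<And>c. (\<And>i. i < k \<Longrightarrow> c i \<in> K) \<Longrightarrow> (\<Sum>i<k. c i * t i) = 0 \<Longrightarrow> \<forall>i<k. c i = 0"
  shows "ring.dimension CC k K {\<Sum>i<k. c i * t i | c. \<forall>i<k. c i \<in> K}"
  using assms(2)
proof (induction k)
  case 0
  have "{\<Sum>i<0. c i * t i | c :: nat \<Rightarrow> complex. \<forall>i<0. c i \<in> K} = {0}" by auto
  thus ?case using ring.zero_dim[OF ring_CC, of K] by simp
next
  case (Suc k)
  define E where "E = {\<Sum>i<k. c i * t i | c. \<forall>i<k. c i \<in> K}"
  have IH: "ring.dimension CC k K E" unfolding E_def
  proof (rule Suc.IH)
    fix c assume c: "\<And>i. i < k \<Longrightarrow> c i \<in> K" "(\<Sum>i<k. c i * t i) = 0"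
    have "\<forall>i<Suc k. (c(k := 0)) i = 0"
      using c subfield_0[OF K] by (intro Suc.prems) (auto simp: less_Suc_eq)
    thus "\<forall>i<k. c i = 0" by (auto simp: less_Suc_eq split: if_splits)
  qed
  have "t k \<notin> E"
  proof
    assume "t k \<in> E"
    then obtain c where c: "\<forall>i<k. c i \<in> K" "t k = (\<Sum>i<k. c i * t i)" by (auto simp: E_def)
    have "\<forall>i<Suc k. (c(k := - 1)) i = 0"
      using c subfield_uminus[OF K subfield_1[OF K]] by (intro Suc.prems) (auto simp: less_Suc_eq)
    thus False by (auto dest: spec[of _ k])
  qed
  hence "ring.dimension CC (Suc k) K (ring.line_extension CC K (t k) E)"
    by (intro ring.Suc_dim[OF ring_CC] IH) auto
  also have "ring.line_extension CC K (t k) E = {\<Sum>i<Suc k. c i * t i | c. \<forall>i<Suc k. c i \<in> K}"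
  proof (intro equalityI subsetI)
    fix x assume "x \<in> ring.line_extension CC K (t k) E"
    then obtain a v where av: "a \<in> K" "v \<in> E" "x = a * t k + v"
      by (auto simp: ring.line_extension_mem_iff[OF ring_CC])
    then obtain c where c: "\<forall>i<k. c i \<in> K" "v = (\<Sum>i<k. c i * t i)" by (auto simp: E_def)
    have "x = (\<Sum>i<Suc k. (c(k := a)) i * t i)" using av c by simp
    moreover have "\<forall>i<Suc k. (c(k := a)) i \<in> K" using av c by auto
    ultimately show "x \<in> {\<Sum>i<Suc k. c i * t i | c. \<forall>i<Suc k. c i \<in> K}" by blast
  next
    fix x assume "x \<in> {\<Sum>i<Suc k. c i * t i | c. \<forall>i<Suc k. c i \<in> K}"
    then obtain c where "x = (\<Sum>i<k. c i * t i) + c k * t k" "\<forall>i<Suc k. c i \<in> K" by auto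
    thus "x \<in> ring.line_extension CC K (t k) E"
      unfolding ring.line_extension_mem_iff[OF ring_CC]
      by (intro bexI[of _ "c k"] bexI[of _ "\<Sum>i<k. c i * t i"]) (auto simp: E_def)
  qed
  finally show ?case .
qed

text \<open>Division by \<open>m\<close> shows that the powers of \<open>x\<close> below its degree
  span, and minimality of the degree makes them independent.\<close>

lemma dimension_adjoin1:
  assumes K: "complex_subfield K" and m: "is_min_poly K x m"
  shows "ring.dimension CC (Polynomial.degree m) K (adjoin1 K x)"
proof -
  define d where "d = Polynomial.degree m"
  have m': "lead_coeff m = 1" "m \<noteq> 0" "poly_over K m" "poly m x = 0"
    using m by (auto simp: is_min_poly_def)
  have d0: "d > 0" using min_poly_degree_pos[OF m] by (simp add: d_def)
  have "{\<Sum>i<d. c i * x ^ i | c. \<forall>i<d. c i \<in> K} = adjoin1 K x"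
  proof (intro equalityI subsetI)
    fix y assume "y \<in> {\<Sum>i<d. c i * x ^ i | c. \<forall>i<d. c i \<in> K}"
    then obtain c where c: "\<forall>i<d. c i \<in> K" "y = (\<Sum>i<d. c i * x ^ i)" by auto
    define p where "p = (\<Sum>i<d. Polynomial.monom (c i) i)"
    have "poly p x = y" by (simp add: p_def poly_sum poly_monom c)
    moreover have "poly_over K p" unfolding poly_over_def p_def
      using c subfield_0[OF K] by (auto simp: coeff_sum intro!: subfield_sum[OF K])
    ultimately show "y \<in> adjoin1 K x" by (auto simp: adjoin1_def)
  next
    fix y assume "y \<in> adjoin1 K x"
    then obtain p where p: "poly_over K p" "y = poly p x" by (auto simp: adjoin1_def)
    obtain q r where qr: "poly_over K q" "poly_over K r" "p = q * m + r"
      "r = 0 \<or> Polynomial.degree r < d"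
      using poly_over_div[OF K m'(3,2) p(1)] unfolding d_def by blast
    hence dr: "Polynomial.degree r < d" using d0 by auto
    have "y = poly r x" using p qr m' by simp
    also have "\<dots> = (\<Sum>i\<le>Polynomial.degree r. poly.coeff r i * x ^ i)" by (rule poly_altdef)
    also have "\<dots> = (\<Sum>i<d. poly.coeff r i * x ^ i)"
      using dr by (intro sum.mono_neutral_left) (auto simp: coeff_eq_0)
    finally show "y \<in> {\<Sum>i<d. c i * x ^ i | c. \<forall>i<d. c i \<in> K}"
      using qr(2) by (auto simp: poly_over_def)
  qed
  moreover have "ring.dimension CC d K {\<Sum>i<d. c i * x ^ i | c. \<forall>i<d. c i \<in> K}"
  proof (rule dimension_of_basis[OF K])
    fix c assume c: "\<And>i. i < d \<Longrightarrow> c i \<in> K" "(\<Sum>i<d. c i * x ^ i) = 0"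
    define p where "p = (\<Sum>i<d. Polynomial.monom (c i) i)"
    have px: "poly p x = 0" by (simp add: p_def poly_sum poly_monom c)
    have po: "poly_over K p" unfolding poly_over_def p_def
      using c subfield_0[OF K] by (auto simp: coeff_sum intro!: subfield_sum[OF K])
    have coeff: "poly.coeff p i = (if i < d then c i else 0)" for i
      by (simp add: p_def coeff_sum)
    have "p = 0"
    proof (rule ccontr)
      assume "p \<noteq> 0"
      hence "d \<le> Polynomial.degree p" using m px po by (auto simp: is_min_poly_def d_def)
      hence "lead_coeff p = 0" by (simp add: coeff)
      thus False using \<open>p \<noteq> 0\<close> by simp
    qed
    thus "\<forall>i<d. c i = 0" using coeff by (metis coeff_0)
  qed
  ultimately show ?thesis by (simp add: d_def)
qed

lemma dimension_cyclotomic: "n > 0 \<Longrightarrow> ring.dimension CC (totient n) \<rat> (cyclotomic n)"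
  by (metis alg_over_zeta complex_subfield_Rats cyclotomic_eq_adjoin1 degree_min_poly_zeta
      dimension_adjoin1 min_poly_exists)

subsection \<open>Kummer theory\<close>

text \<open>Artin's argument on a shortest relation, with a homomorphism that moves a quotient of two
  of the radicals.\<close>

lemma kummer_independent:
  assumes F: "complex_subfield F" and n: "n > 0" and mu: "\<And>x. x ^ n = 1 \<Longrightarrow> x \<in> F"
    and T: "finite T" "\<And>t. t \<in> T \<Longrightarrow> t \<noteq> 0 \<and> t ^ n \<in> F"
    and indep: "\<And>s t. s \<in> T \<Longrightarrow> t \<in> T \<Longrightarrow> s \<noteq> t \<Longrightarrow> s / t \<notin> F"
    and c: "\<And>t. t \<in> T \<Longrightarrow> c t \<in> F" "(\<Sum>t\<in>T. c t * t) = 0"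
  shows "\<forall>t\<in>T. c t = 0"
  using c
proof (induction "card {t \<in> T. c t \<noteq> 0}" arbitrary: c rule: less_induct)
  case (less c)
  show ?case
  proof (rule ccontr)
    assume "\<not> ?case"
    then obtain s where s: "s \<in> T" "c s \<noteq> 0" by auto
    have "\<exists>t\<in>T. t \<noteq> s \<and> c t \<noteq> 0"
    proof (rule ccontr)
      assume *: "\<not> ?thesis"
      have "(\<Sum>t\<in>T. c t * t) = (\<Sum>t\<in>{s}. c t * t)"
        using * s T(1) by (intro sum.mono_neutral_right) auto
      thus False using s T(2)[of s] less.prems(2) by simp
    qed
    then obtain t where t: "t \<in> T" "t \<noteq> s" "c t \<noteq> 0" by blast
    have sn: "s / t \<notin> F" using indep s t by auto
    obtain ts where ts: "set ts = T" using finite_list[OF T(1)] by blast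
    have algT: "\<forall>y\<in>set ts. alg_over F y" using T(2) ts alg_over_root[OF F _ n] by blast
    have "(s / t) ^ n \<in> F" using T(2) s t by (auto simp: power_divide intro: subfield_divide[OF F])
    hence al: "alg_over F (s / t)" by (rule alg_over_root[OF F _ n])
    obtain g where g: "hom_on (adjoin_list F (s / t # ts)) g" "\<And>z. z \<in> F \<Longrightarrow> g z = z" "g (s / t) \<noteq> s / t"
      using hom_moving_exists[OF F al sn algT] by blast
    define L where "L = adjoin_list F (s / t # ts)"
    have L: "complex_subfield L" "F \<subseteq> L" "T \<subseteq> L" and gL: "hom_on L g"
      using complex_subfield_adjoin_list[OF F, of "s / t # ts"] adjoin_list_superset[OF F, of "s / t # ts"]
        al algT ts g(1) by (auto simp: L_def)
    \<comment> \<open>For \<open>u\<close> in \<open>T\<close> this is an \<open>n\<close>-th root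
      of unity, since \<open>g\<close> fixes \<open>u ^ n\<close>; hence it lies in
      \<open>F\<close>.\<close>
    define w where "w = (\<lambda>u. g u / u)"
    have gw: "g u = w u * u" "w u \<in> F" if u: "u \<in> T" for u
    proof -
      have u0: "u \<noteq> 0" "u ^ n \<in> F" using T(2) u by auto
      show "g u = w u * u" using u0 by (simp add: w_def)
      have "g u ^ n = u ^ n" using hom_on_power[OF L(1) gL, of u n] L(3) u g(2)[OF u0(2)] by auto
      thus "w u \<in> F" using u0 by (intro mu) (simp add: w_def power_divide)
    qed
    have "w s \<noteq> w t"
    proof
      assume eq: "w s = w t"
      have "g (s / t) = g s / g t" using hom_on_divide[OF L(1) gL] L(3) s t by auto
      also have "\<dots> = (w s * s) / (w t * t)" using gw s t by simp
      also have "w s \<noteq> 0" using gw(1)[OF s(1)] T(2)[OF s(1)] hom_on_eq_0_iff[OF L(1) gL, of s] L(3) s by auto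
      hence "(w s * s) / (w t * t) = s / t" using eq by simp
      finally show False using g(3) by simp
    qed
    \<comment> \<open>Applying \<open>g\<close> to the relation and subtracting \<open>w s\<close>
      times the relation cancels the term at \<open>s\<close>, while the term at \<open>t\<close>
      survives because \<open>w s \<noteq> w t\<close>.\<close>
    define c' where "c' = (\<lambda>u. c u * (w u - w s))"
    have c'F: "c' u \<in> F" if "u \<in> T" for u unfolding c'_def
      using that less.prems(1) gw(2) s by (intro subfield_mult[OF F] subfield_diff[OF F]) auto
    have "0 = g (\<Sum>u\<in>T. c u * u)" using less.prems(2) hom_on_0[OF L(1) gL] by simp
    also have "\<dots> = (\<Sum>u\<in>T. g (c u * u))"
      by (rule hom_on_sum[OF L(1) gL]) (use less.prems(1) L in \<open>auto intro!: subfield_mult[OF L(1)]\<close>)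
    also have "\<dots> = (\<Sum>u\<in>T. c u * (w u * u))"
    proof (rule sum.cong)
      fix u assume u: "u \<in> T"
      have "g (c u * u) = g (c u) * g u"
        using u less.prems(1) L by (intro hom_on_mult[OF L(1) gL]) auto
      thus "g (c u * u) = c u * (w u * u)" using g(2) less.prems(1) gw(1) u by simp
    qed simp
    finally have "(\<Sum>u\<in>T. c u * (w u * u)) - w s * (\<Sum>u\<in>T. c u * u) = 0" using less.prems(2) by simp
    hence sum0: "(\<Sum>u\<in>T. c' u * u) = 0"
      by (simp add: c'_def sum_distrib_left sum_subtractf[symmetric] algebra_simps)
    have "{u \<in> T. c' u \<noteq> 0} \<subset> {u \<in> T. c u \<noteq> 0}" using s by (auto simp: c'_def)
    hence "card {u \<in> T. c' u \<noteq> 0} < card {u \<in> T. c u \<noteq> 0}" using T(1) by (intro psubset_card_mono) auto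
    hence "\<forall>u\<in>T. c' u = 0" using c'F sum0 by (rule less.hyps)
    thus False using t \<open>w s \<noteq> w t\<close> by (auto simp: c'_def)
  qed
qed

text \<open>The span of \<open>T\<close> is a ring by the last assumption. It equals the field
  obtained by adjoining the elements of \<open>T\<close> in turn, which supplies the inverses, and
  \<open>T\<close> is a basis by \<open>kummer_independent\<close>.\<close>

lemma kummer_dimension:
  assumes F: "complex_subfield F" and n: "n > 0" and mu: "\<And>x. x ^ n = 1 \<Longrightarrow> x \<in> F"
    and T: "finite T" "\<And>t. t \<in> T \<Longrightarrow> t \<noteq> 0 \<and> t ^ n \<in> F"
    and indep: "\<And>s t. s \<in> T \<Longrightarrow> t \<in> T \<Longrightarrow> s \<noteq> t \<Longrightarrow> s / t \<notin> F"
    and one: "\<exists>u\<in>T. u \<in> F"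
    and mult: "\<And>s t. s \<in> T \<Longrightarrow> t \<in> T \<Longrightarrow> \<exists>u\<in>T. \<exists>a\<in>F. s * t = a * u"
  shows "ring.dimension CC (card T) F (Q_adjoin (F \<union> T))"
proof -
  define E where "E = {\<Sum>t\<in>T. c t * t | c. \<forall>t\<in>T. c t \<in> F}"
  have incl: "a * t \<in> E" if "a \<in> F" "t \<in> T" for a t unfolding E_def
    by (rule CollectI, rule exI[of _ "\<lambda>s. if s = t then a else 0"])
       (use that T(1) subfield_0[OF F] in \<open>auto simp: if_distrib[of "\<lambda>x. x * _"] cong: if_cong\<close>)
  have add: "x + y \<in> E" if "x \<in> E" "y \<in> E" for x y
  proof -
    from that obtain c d where "\<forall>t\<in>T. c t \<in> F" "\<forall>t\<in>T. d t \<in> F" "x = (\<Sum>t\<in>T. c t * t)" "y = (\<Sum>t\<in>T. d t * t)"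
      unfolding E_def by blast
    thus ?thesis unfolding E_def
      by (intro CollectI exI[of _ "\<lambda>t. c t + d t"])
         (auto simp: sum.distrib distrib_right intro: subfield_add[OF F])
  qed
  have zero: "0 \<in> E" unfolding E_def using subfield_0[OF F] by (intro CollectI exI[of _ "\<lambda>_. 0"]) auto
  have sumE: "sum f A \<in> E" if "\<And>i. i \<in> A \<Longrightarrow> f i \<in> E" for f :: "complex \<Rightarrow> complex" and A
    using that by (induction A rule: infinite_finite_induct) (auto intro: zero add)
  have smult: "a * x \<in> E" if a: "a \<in> F" and x: "x \<in> E" for a x
  proof -
    from x obtain c where c: "\<forall>t\<in>T. c t \<in> F" "x = (\<Sum>t\<in>T. c t * t)" unfolding E_def by blast
    have "(\<Sum>t\<in>T. (a * c t) * t) \<in> E" by (rule sumE) (auto intro!: incl subfield_mult[OF F] a c(1)[rule_format])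
    thus ?thesis using c(2) by (simp add: sum_distrib_left mult.assoc)
  qed
  have multE: "x * y \<in> E" if "x \<in> E" "y \<in> E" for x y
  proof -
    from that obtain c d where cd: "\<forall>t\<in>T. c t \<in> F" "\<forall>t\<in>T. d t \<in> F" "x = (\<Sum>t\<in>T. c t * t)" "y = (\<Sum>t\<in>T. d t * t)"
      unfolding E_def by blast
    have tt: "s * t \<in> E" if "s \<in> T" "t \<in> T" for s t using mult[OF that] incl by auto
    have "x * y = (\<Sum>s\<in>T. \<Sum>t\<in>T. (c s * d t) * (s * t))"
      unfolding cd by (simp add: sum_product mult_ac)
    also have "\<dots> \<in> E" by (intro sumE smult subfield_mult[OF F] tt cd(1,2)[rule_format])
    finally show ?thesis .
  qed
  obtain u0 where u0: "u0 \<in> T" "u0 \<in> F" using one by blast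
  have FE: "F \<subseteq> E"
  proof
    fix a assume "a \<in> F"
    hence "a / u0 * u0 \<in> E" by (intro incl subfield_divide[OF F] u0)
    thus "a \<in> E" using T(2)[OF u0(1)] by simp
  qed
  have TE: "T \<subseteq> E" using incl[OF subfield_1[OF F]] by auto
  obtain ts where ts: "set ts = T" using finite_list[OF T(1)] by blast
  have algT: "\<forall>y\<in>set ts. alg_over F y" using T(2) ts alg_over_root[OF F _ n] by blast
  have polyE: "poly p x \<in> E" if "poly_over E p" "x \<in> E" for p x
    using that
  proof (induction p)
    case (pCons a p)
    have "a \<in> E" "poly_over E p" using pCons.prems(1) unfolding poly_over_def
      by (metis coeff_pCons_0, metis coeff_pCons_Suc)
    thus ?case using pCons by (auto intro: add multE)
  qed (use zero in auto)
  have "adjoin_list K xs \<subseteq> E" if "K \<subseteq> E" "set xs \<subseteq> E" for K xs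
    using that
  proof (induction xs arbitrary: K)
    case (Cons x xs)
    have "adjoin1 K x \<subseteq> E" using Cons.prems
      by (auto simp: adjoin1_def intro!: polyE intro: poly_over_mono)
    thus ?case using Cons by auto
  qed auto
  hence sub1: "adjoin_list F ts \<subseteq> E" using FE TE ts by auto
  have L: "complex_subfield (adjoin_list F ts)" "F \<subseteq> adjoin_list F ts" "T \<subseteq> adjoin_list F ts"
    using complex_subfield_adjoin_list[OF F algT] adjoin_list_superset[OF F algT] ts by auto
  have sub2: "E \<subseteq> K" if "complex_subfield K" "F \<subseteq> K" "T \<subseteq> K" for K
    using that by (auto simp: E_def intro!: subfield_sum subfield_mult)
  have "E = adjoin_list F ts" using sub1 sub2[OF L] by auto
  hence E: "complex_subfield E" using L by simp
  have "Q_adjoin (F \<union> T) = E"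
    using FE TE by (intro equalityI Q_adjoin_least E sub2 complex_subfield_Q_adjoin)
      (auto intro: Q_adjoin_incl)
  moreover obtain t where t: "bij_betw t {..<card T} T"
    using ex_bij_betw_nat_finite[OF T(1)] by (auto simp: atLeast0LessThan)
  have reindex: "(\<Sum>i<card T. c (t i) * t i) = (\<Sum>u\<in>T. c u * u)" for c
    by (rule sum.reindex_bij_betw[OF t])
  define t' where "t' = the_inv_into {..<card T} t"
  have t': "t' (t i) = i" if "i < card T" for i
    unfolding t'_def using t that by (intro the_inv_into_f_f) (auto simp: bij_betw_def)
  have tT: "t i \<in> T" if "i < card T" for i using t that by (auto simp: bij_betw_def)
  have tT': "t' u < card T" if "u \<in> T" for u
    using that t t' unfolding bij_betw_def by (metis imageE lessThan_iff)
  have "E = {\<Sum>i<card T. c i * t i | c. \<forall>i<card T. c i \<in> F}"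
  proof (intro equalityI subsetI)
    fix x assume "x \<in> E"
    then obtain c where c: "\<forall>t\<in>T. c t \<in> F" "x = (\<Sum>t\<in>T. c t * t)" unfolding E_def by blast
    thus "x \<in> {\<Sum>i<card T. c i * t i | c. \<forall>i<card T. c i \<in> F}"
      using tT by (intro CollectI exI[of _ "\<lambda>i. c (t i)"]) (auto simp: reindex)
  next
    fix x assume "x \<in> {\<Sum>i<card T. c i * t i | c. \<forall>i<card T. c i \<in> F}"
    then obtain c where c: "\<forall>i<card T. c i \<in> F" "x = (\<Sum>i<card T. c i * t i)" by blast
    hence "x = (\<Sum>u\<in>T. c (t' u) * u)" using t' by (simp flip: reindex)
    moreover have "\<forall>u\<in>T. c (t' u) \<in> F" using c(1) tT' by simp
    ultimately show "x \<in> E" unfolding E_def by (intro CollectI exI[of _ "\<lambda>u. c (t' u)"]) auto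
  qed
  moreover have "ring.dimension CC (card T) F {\<Sum>i<card T. c i * t i | c. \<forall>i<card T. c i \<in> F}"
  proof (rule dimension_of_basis[OF F])
    fix c assume c: "\<And>i. i < card T \<Longrightarrow> c i \<in> F" "(\<Sum>i<card T. c i * t i) = 0"
    have "(\<Sum>u\<in>T. c (t' u) * u) = 0" using c(2) t' by (simp flip: reindex)
    moreover have "c (t' u) \<in> F" if "u \<in> T" for u using c(1) tT'[OF that] by simp
    ultimately have "\<forall>u\<in>T. c (t' u) = 0"
      using kummer_independent[OF F n mu T indep, of "\<lambda>u. c (t' u)"] by blast
    thus "\<forall>i<card T. c i = 0" using t' tT by metis
  qed
  ultimately show ?thesis by simp
qed

text \<open>For positive \<open>n\<close> this is the kernel of the map from the nonzero rationals
  to \<open>F*\<close> modulo n-th powers, with \<open>F\<close> the n-th cyclotomic field. The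
  choice of the root is immaterial, as \<open>F\<close> contains the n-th roots of unity.\<close>

definition cyclotomic_powers :: "nat \<Rightarrow> rat set" where
  "cyclotomic_powers n = {g. g \<noteq> 0 \<and> (\<exists>x\<in>cyclotomic n. x ^ n = of_rat g)}"

text \<open>One complex root is chosen for each representative. Roots within one coset of
  \<open>cyclotomic_powers n\<close> differ by cyclotomic factors, and roots from different cosets
  have a quotient outside the cyclotomic field, so the chosen roots form a basis over it. The tower
  law contributes \<open>totient n\<close>.\<close>

lemma degree_radical_extension:
  assumes n: "n > 0" and \<Gamma>: "0 \<notin> \<Gamma>" "1 \<in> \<Gamma>" "\<And>x y. x \<in> \<Gamma> \<Longrightarrow> y \<in> \<Gamma> \<Longrightarrow> x * y \<in> \<Gamma>"
    and R: "finite R" "R \<subseteq> \<Gamma>" "\<And>g. g \<in> \<Gamma> \<Longrightarrow> \<exists>r\<in>R. g / r \<in> cyclotomic_powers n"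
      "\<And>r s. r \<in> R \<Longrightarrow> s \<in> R \<Longrightarrow> r / s \<in> cyclotomic_powers n \<Longrightarrow> r = s"
  shows "degree_over_Q (Q_adjoin (insert (zeta n) (roots_of \<Gamma> n))) = totient n * card R"
proof -
  define F where "F = cyclotomic n"
  have F: "complex_subfield F" unfolding F_def by (rule complex_subfield_Q_adjoin)
  have mu: "x \<in> F" if "x ^ n = 1" for x using root_of_unity_in_cyclotomic[OF that n] by (simp add: F_def)
  define t where "t = (\<lambda>r :: rat. SOME x :: complex. x ^ n = of_rat r)"
  have t: "t r ^ n = of_rat r" for r
  proof -
    have "\<exists>x :: complex. x ^ n = of_rat r" using n by (metis nth_root_exists)
    thus ?thesis unfolding t_def by (rule someI_ex)
  qed
  have t_inj: "inj t" by (metis injI of_rat_eq_iff t)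
  define T where "T = t ` R"
  have cardT: "card T = card R" unfolding T_def by (intro card_image inj_on_subset[OF t_inj]) auto
  have R0: "r \<noteq> 0" if "r \<in> R" for r using that R(2) \<Gamma>(1) by auto
  have t0: "t r \<noteq> 0" if "r \<noteq> 0" for r using t[of r] that n by (auto simp: power_0_left)
  have key: "\<exists>u\<in>T. \<exists>a\<in>F. x = a * u" if x: "x ^ n = of_rat g" "g \<in> \<Gamma>" for x g
  proof -
    obtain r where r: "r \<in> R" "g / r \<in> cyclotomic_powers n" using R(3) x(2) by blast
    then obtain y where y: "y \<in> F" "y ^ n = of_rat (g / r)" by (auto simp: cyclotomic_powers_def F_def)
    have "y \<noteq> 0" using y(2) x(2) R0[OF r(1)] \<Gamma>(1) n by (auto simp: power_0_left)
    have "(x / (y * t r)) ^ n = 1"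
      using x y(2) t[of r] R0[OF r(1)] \<Gamma>(1) by (auto simp: power_divide power_mult_distrib of_rat_divide)
    hence "x / (y * t r) \<in> F" by (rule mu)
    hence "x / (y * t r) * y \<in> F" by (intro subfield_mult[OF F] y)
    moreover have "x = (x / (y * t r) * y) * t r" using \<open>y \<noteq> 0\<close> t0[OF R0[OF r(1)]] by simp
    ultimately show ?thesis using r(1) unfolding T_def by blast
  qed
  have dim: "ring.dimension CC (card T) F (Q_adjoin (F \<union> T))"
  proof (rule kummer_dimension[OF F n mu])
    show "finite T" using R(1) by (simp add: T_def)
    show "u \<noteq> 0 \<and> u ^ n \<in> F" if "u \<in> T" for u
      using that t t0 R0 by (auto simp: T_def intro: subfield_of_rat[OF F])
    show "u / v \<notin> F" if "u \<in> T" "v \<in> T" "u \<noteq> v" for u v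
    proof
      assume uv: "u / v \<in> F"
      from that obtain r s where rs: "r \<in> R" "s \<in> R" "u = t r" "v = t s" by (auto simp: T_def)
      have "(u / v) ^ n = of_rat (r / s)" using t rs by (simp add: power_divide of_rat_divide)
      hence "r / s \<in> cyclotomic_powers n"
        using uv R0 rs unfolding cyclotomic_powers_def F_def by auto
      thus False using R(4) rs that by auto
    qed
    obtain u a where ua: "u \<in> T" "a \<in> F" "1 = a * u" using key[of 1 1] \<Gamma>(2) by auto
    hence "u = inverse a" by (metis inverse_unique)
    thus "\<exists>u\<in>T. u \<in> F" using ua subfield_inverse[OF F] by blast
    show "\<exists>w\<in>T. \<exists>a\<in>F. u * v = a * w" if "u \<in> T" "v \<in> T" for u v
    proof -
      from that obtain r s where rs: "r \<in> R" "s \<in> R" "u = t r" "v = t s" by (auto simp: T_def)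
      show ?thesis
        by (rule key[of _ "r * s"]) (use rs t R(2) \<Gamma>(3)[of r s] in \<open>auto simp: power_mult_distrib of_rat_mult\<close>)
    qed
  qed
  have eq: "Q_adjoin (F \<union> T) = Q_adjoin (insert (zeta n) (roots_of \<Gamma> n))" (is "?A = ?B")
  proof
    have "F \<subseteq> ?B" unfolding F_def by (rule Q_adjoin_mono) auto
    moreover have "T \<subseteq> ?B" using t R(2) by (auto simp: T_def roots_of_def intro!: Q_adjoin_incl)
    ultimately show "?A \<subseteq> ?B" by (intro Q_adjoin_least complex_subfield_Q_adjoin) auto
    have A: "complex_subfield ?A" by (rule complex_subfield_Q_adjoin)
    have "zeta n \<in> F" using zeta_in_cyclotomic[of n 1] by (simp add: F_def)
    hence "zeta n \<in> ?A" by (intro Q_adjoin_incl) auto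
    moreover have "x \<in> ?A" if x: "x \<in> roots_of \<Gamma> n" for x
    proof -
      obtain g where "x ^ n = of_rat g" "g \<in> \<Gamma>" using x by (auto simp: roots_of_def)
      then obtain u a where "u \<in> T" "a \<in> F" "x = a * u" using key by blast
      thus ?thesis using subfield_mult[OF A] Q_adjoin_incl[of _ "F \<union> T"] by auto
    qed
    ultimately show "?B \<subseteq> ?A" by (intro Q_adjoin_least A) auto
  qed
  have "ring.dimension CC (totient n * card T) \<rat> (Q_adjoin (F \<union> T))"
    using dimension_cyclotomic[OF n] dim unfolding F_def
    by (rule ring.telescopic_base[OF ring_CC subfield_imp_CC_subfield[OF complex_subfield_Rats]
          subfield_imp_CC_subfield[OF complex_subfield_Q_adjoin]])
  hence "ring.dim CC \<rat> (Q_adjoin (F \<union> T)) = totient n * card T"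
    using ring.dimI[OF ring_CC subfield_imp_CC_subfield[OF complex_subfield_Rats]] by (simp add: over_def)
  thus ?thesis by (simp add: degree_over_Q_def eq cardT)
qed

subsection \<open>Square roots in cyclotomic fields\<close>

text \<open>\<open>(X ^ n - 1) / (X - 1)\<close> is evaluated at 1, once as a product of linear
  factors and once as a geometric sum.\<close>

lemma prod_one_minus_roots_of_unity:
  assumes n: "n > 0"
  shows "(\<Prod>z\<in>{z :: complex. z ^ n = 1} - {1}. 1 - z) = of_nat n"
proof -
  define P :: "complex poly" where "P = Polynomial.monom 1 n - 1"
  have roots: "poly P z = 0 \<longleftrightarrow> z ^ n = 1" for z by (simp add: P_def poly_monom)
  have "rsquarefree P" unfolding rsquarefree_roots
  proof (intro allI notI)
    fix z assume z: "poly P z = 0 \<and> poly (pderiv P) z = 0"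
    hence "of_nat n * z ^ (n - 1) = 0"
      by (simp add: P_def pderiv_diff pderiv_monom poly_monom pderiv_1)
    hence "z = 0" using n by simp
    thus False using z roots n by (simp add: power_0_left)
  qed
  hence eq: "P = smult (lead_coeff P) (\<Prod>z | poly P z = 0. [:- z, 1:])"
    by (simp add: complex_poly_decompose_rsquarefree)
  have c: "poly.coeff P i = (if i = n then 1 else 0) - (if i = 0 then 1 else 0)" for i
    by (simp add: P_def coeff_1)
  have "Polynomial.degree P = n"
    by (intro antisym degree_le le_degree) (use n in \<open>auto simp: c\<close>)
  hence "lead_coeff P = 1" using n by (simp add: c)
  hence "P = (\<Prod>z | z ^ n = 1. [:- z, 1:])" using eq roots by simp
  also have "\<dots> = [:- 1, 1:] * (\<Prod>z\<in>{z. z ^ n = 1} - {1}. [:- z, 1:])"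
    using n by (subst prod.remove[of _ 1]) (auto simp: finite_roots_unity)
  finally have "P = [:- 1, 1:] * (\<Prod>z\<in>{z. z ^ n = 1} - {1}. [:- z, 1:])" .
  moreover have "P = [:- 1, 1:] * (\<Sum>i<n. Polynomial.monom 1 i)"
  proof (rule poly_ext)
    fix x :: complex
    show "poly P x = poly ([:- 1, 1:] * (\<Sum>i<n. Polynomial.monom 1 i)) x"
      using power_diff_1_eq[of x n] by (simp add: P_def poly_monom poly_sum algebra_simps)
  qed
  ultimately have "(\<Prod>z\<in>{z. z ^ n = 1} - {1}. [:- z, 1:]) = (\<Sum>i<n. Polynomial.monom 1 i :: complex poly)"
    by (metis mult_left_cancel pCons_eq_0_iff zero_neq_one)
  hence "poly (\<Prod>z\<in>{z. z ^ n = 1} - {1}. [:- z, 1:]) 1 = poly (\<Sum>i<n. Polynomial.monom 1 i :: complex poly) 1"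
    by simp
  thus ?thesis by (simp add: poly_prod poly_sum poly_monom)
qed

text \<open>A product takes the place of the Gauss sum. The square of the factor at \<open>j\<close>
  is minus the product of \<open>1 - z ^ (2 * j)\<close> and \<open>1 - z ^ (- 2 * j)\<close>;
  doubling permutes the nonzero residues modulo the odd \<open>p\<close>, so every
  \<open>1 - w\<close> with \<open>w\<close> a nontrivial \<open>p\<close>-th root of unity occurs
  once.\<close>

lemma sqrt_prime_in_cyclotomic:
  assumes p: "Factorial_Ring.prime p" "odd p"
  shows "\<exists>y\<in>cyclotomic p. y ^ 2 = (- 1) ^ ((p - 1) div 2) * of_nat p"
proof -
  define h where "h = (p - 1) div 2"
  have p0: "p > 0" using prime_gt_0_nat[OF p(1)] .
  have ph: "p = 2 * h + 1" using p(2) by (auto simp: h_def elim!: oddE)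
  define z where "z = zeta p"
  have zp: "z ^ p = 1" using zeta_power_self[OF p0] by (simp add: z_def)
  define y where "y = (\<Prod>j\<in>{1..h}. z ^ j - z ^ (p - j))"
  have "y \<in> cyclotomic p" unfolding y_def z_def
    by (intro subfield_prod subfield_diff complex_subfield_Q_adjoin zeta_in_cyclotomic)
  moreover have "y ^ 2 = (- 1) ^ h * of_nat p"
  proof -
    have summand: "(z ^ j - z ^ (p - j)) ^ 2 = - 1 * ((1 - z ^ (2 * j)) * (1 - z ^ (2 * (p - j))))"
      if j: "j \<in> {1..h}" for j
    proof -
      have 1: "z ^ j * z ^ (p - j) = 1" using j zp ph by (simp flip: power_add)
      have sq: "z ^ (2 * i) = (z ^ i) ^ 2" for i by (simp add: mult.commute[of 2] power_mult)
      have 2: "(z ^ j) ^ 2 * (z ^ (p - j)) ^ 2 = 1" using 1 by (simp flip: power_mult_distrib)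
      have "(z ^ j - z ^ (p - j)) ^ 2 = (z ^ j) ^ 2 + (z ^ (p - j)) ^ 2 - 2 * z ^ j * z ^ (p - j)"
        by (rule power2_diff)
      also have "\<dots> = (z ^ j) ^ 2 + (z ^ (p - j)) ^ 2 - 1 - (z ^ j) ^ 2 * (z ^ (p - j)) ^ 2"
        using 1 2 by (simp add: mult.assoc)
      finally show ?thesis unfolding sq by (simp only: left_diff_distrib right_diff_distrib) simp
    qed
    have "y ^ 2 = (\<Prod>j\<in>{1..h}. - 1 * ((1 - z ^ (2 * j)) * (1 - z ^ (2 * (p - j)))))"
      unfolding y_def prod_power_distrib by (intro prod.cong refl summand)
    also have "\<dots> = (- 1) ^ h * ((\<Prod>j\<in>{1..h}. 1 - z ^ (2 * j)) * (\<Prod>j\<in>{1..h}. 1 - z ^ (2 * (p - j))))"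
      unfolding prod.distrib by simp
    also have "(\<Prod>j\<in>{1..h}. 1 - z ^ (2 * (p - j))) = (\<Prod>j\<in>{h + 1..<p}. 1 - z ^ (2 * j))"
      by (rule prod.reindex_bij_witness[of _ "\<lambda>j. p - j" "\<lambda>j. p - j"]) (use ph in auto)
    also have "(\<Prod>j\<in>{1..h}. 1 - z ^ (2 * j)) * \<dots> = (\<Prod>j\<in>{1..h} \<union> {h + 1..<p}. 1 - z ^ (2 * j))"
      by (rule prod.union_disjoint[symmetric]) auto
    also have "{1..h} \<union> {h + 1..<p} = {1..<p}" using ph by auto
    also have "(\<Prod>j\<in>{1..<p}. 1 - z ^ (2 * j)) = (\<Prod>w\<in>{w. w ^ p = 1} - {1}. 1 - w)"
    proof (rule prod.reindex_bij_betw)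
      have inj: "inj_on (\<lambda>j. z ^ (2 * j)) {1..<p}"
      proof (rule inj_onI)
        fix i j assume ij: "i \<in> {1..<p}" "j \<in> {1..<p}" "z ^ (2 * i) = z ^ (2 * j)"
        hence "[2 * i = 2 * j] (mod p)" using zeta_power_eq_iff[OF p0] by (simp add: z_def cong_def)
        hence "[i = j] (mod p)" using p(2) by (subst (asm) cong_mult_lcancel_nat) (auto simp: coprime_right_2_iff_odd coprime_commute)
        thus "i = j" using ij by (simp add: cong_def)
      qed
      have sub: "(\<lambda>j. z ^ (2 * j)) ` {1..<p} \<subseteq> {w. w ^ p = 1} - {1}"
      proof
        fix w assume "w \<in> (\<lambda>j. z ^ (2 * j)) ` {1..<p}"
        then obtain j where j: "j \<in> {1..<p}" "w = z ^ (2 * j)" by auto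
        have "w ^ p = 1" unfolding j(2) by (metis power_mult mult.commute power_one zp)
        moreover have "w \<noteq> 1"
        proof
          assume "w = 1"
          hence "p dvd 2 * j" using zeta_power_eq_1_iff[OF p0] j by (simp add: z_def)
          hence "p dvd j" using p(2) by (subst (asm) coprime_dvd_mult_right_iff) (auto simp: coprime_right_2_iff_odd)
          thus False using j by (auto dest: dvd_imp_le)
        qed
        ultimately show "w \<in> {w. w ^ p = 1} - {1}" by simp
      qed
      have "card ({w :: complex. w ^ p = 1} - {1}) = p - 1"
        using card_roots_unity_eq[OF p0] by (subst card_Diff_singleton) auto
      moreover have "card ((\<lambda>j. z ^ (2 * j)) ` {1..<p}) = p - 1" using card_image[OF inj] by simp
      ultimately have "(\<lambda>j. z ^ (2 * j)) ` {1..<p} = {w. w ^ p = 1} - {1}"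
        using sub p0 by (intro card_subset_eq) (auto simp: finite_roots_unity)
      thus "bij_betw (\<lambda>j. z ^ (2 * j)) {1..<p} ({w. w ^ p = 1} - {1})"
        using inj by (simp add: bij_betw_def)
    qed
    also have "\<dots> = of_nat p" by (rule prod_one_minus_roots_of_unity[OF p0])
    finally show ?thesis .
  qed
  ultimately show ?thesis by (auto simp: h_def)
qed

text \<open>For odd \<open>d\<close> the sign is the one that makes the value congruent to 1 modulo
  4, that is, the sign for which the square root needs only \<open>d\<close>-th roots of
  unity.\<close>

definition signed_nat :: "nat \<Rightarrow> complex" where
  "signed_nat d = (if d mod 4 = 1 then of_nat d else - of_nat d)"

lemma signed_nat_mult:
  assumes "odd a" "odd b"
  shows "signed_nat (a * b) = signed_nat a * signed_nat b"
proof -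
  have "a mod 4 = 1 \<or> a mod 4 = 3" "b mod 4 = 1 \<or> b mod 4 = 3" using assms by presburger+
  moreover have "(a * b) mod 4 = ((a mod 4) * (b mod 4)) mod 4" by (simp add: mod_mult_eq)
  ultimately show ?thesis by (auto simp: signed_nat_def)
qed

lemma sqrt_signed_in_cyclotomic:
  "squarefree d \<Longrightarrow> odd d \<Longrightarrow> \<exists>y\<in>cyclotomic d. y ^ 2 = signed_nat d"
proof (induction d rule: less_induct)
  case (less d)
  show ?case
  proof (cases "d = 1")
    case True
    thus ?thesis by (intro bexI[of _ 1]) (auto simp: signed_nat_def intro: subfield_1 complex_subfield_Q_adjoin)
  next
    case False
    then obtain p where p: "Factorial_Ring.prime p" "p dvd d" using prime_factor_nat by blast
    then obtain e where e: "d = p * e" by (elim dvdE)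
    have d0: "d > 0" using less.prems(2) by (auto elim: oddE)
    hence "e < d" using e prime_gt_1_nat[OF p(1)] by (cases "e = 0") auto
    moreover have "odd p" "odd e" "squarefree e" using less.prems e by (auto dest: squarefree_multD)
    ultimately obtain y where y: "y \<in> cyclotomic e" "y ^ 2 = signed_nat e" using less.IH by blast
    obtain w where w: "w \<in> cyclotomic p" "w ^ 2 = (- 1) ^ ((p - 1) div 2) * of_nat p"
      using sqrt_prime_in_cyclotomic[OF p(1) \<open>odd p\<close>] by blast
    have "p mod 4 = 1 \<longleftrightarrow> even ((p - 1) div 2)" using \<open>odd p\<close> by presburger
    hence "w ^ 2 = signed_nat p" using w(2) by (auto simp: signed_nat_def)
    hence "(w * y) ^ 2 = signed_nat d"
      using y(2) signed_nat_mult[OF \<open>odd p\<close> \<open>odd e\<close>] by (simp add: power_mult_distrib e)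
    moreover have "w * y \<in> cyclotomic d"
      using w(1) y(1) cyclotomic_mono[of p d] cyclotomic_mono[of e d] d0 e
      by (intro subfield_mult complex_subfield_Q_adjoin) auto
    ultimately show ?thesis by blast
  qed
qed

lemma zeta_4: "zeta 4 = \<i>"
  by (simp add: zeta_def complex_eq_iff)

lemma ii_in_cyclotomic: "4 dvd n \<Longrightarrow> n > 0 \<Longrightarrow> \<i> \<in> cyclotomic n"
  using cyclotomic_mono[of 4 n] zeta_in_cyclotomic[of 4 1] by (auto simp: zeta_4)

abbreviation csqrt_nat :: "nat \<Rightarrow> complex" where
  "csqrt_nat d \<equiv> complex_of_real (sqrt (real d))"

lemma csqrt_nat_square: "csqrt_nat d ^ 2 = of_nat d"
  by (simp flip: of_real_power)

lemma csqrt_nat_mult: "csqrt_nat (a * b) = csqrt_nat a * csqrt_nat b"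
  by (simp add: real_sqrt_mult)

lemma csqrt_2: "csqrt_nat 2 = zeta 8 * (1 - \<i>)"
  by (simp add: zeta_def complex_eq_iff cos_45 sin_45 real_div_sqrt flip: mult_2)

lemma csqrt_2_in_cyclotomic: "8 dvd n \<Longrightarrow> n > 0 \<Longrightarrow> csqrt_nat 2 \<in> cyclotomic n"
  unfolding csqrt_2 using cyclotomic_mono[of 8 n] zeta_in_cyclotomic[of 8 1]
  by (intro subfield_mult subfield_diff subfield_1 complex_subfield_Q_adjoin ii_in_cyclotomic)
     (auto elim!: dvdE)

text \<open>Separates the factor \<open>\<i>\<close>, which belongs to the prime 2, from a part of
  odd level. The sign of \<open>y\<close> is adjusted so that the positive real root itself is
  obtained.\<close>

lemma csqrt_odd_cases:
  assumes "squarefree d" "odd d"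
  obtains y where "y \<in> cyclotomic d" "d mod 4 = 1 \<longrightarrow> csqrt_nat d = y"
    "d mod 4 = 3 \<longrightarrow> csqrt_nat d = \<i> * y"
proof -
  obtain y where y: "y \<in> cyclotomic d" "y ^ 2 = signed_nat d" using sqrt_signed_in_cyclotomic[OF assms] by blast
  have ym: "- y \<in> cyclotomic d" by (intro subfield_uminus complex_subfield_Q_adjoin y)
  show ?thesis
  proof (cases "d mod 4 = 1")
    case True
    hence "csqrt_nat d ^ 2 = y ^ 2" unfolding csqrt_nat_square y(2) by (simp add: signed_nat_def)
    hence "csqrt_nat d = y \<or> csqrt_nat d = - y" by (simp only: power2_eq_iff)
    thus ?thesis using that[of y] that[of "- y"] y ym True by auto
  next
    case False
    hence "csqrt_nat d ^ 2 = (\<i> * y) ^ 2"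
      unfolding csqrt_nat_square power_mult_distrib y(2) by (simp add: signed_nat_def)
    hence "csqrt_nat d = \<i> * y \<or> csqrt_nat d = - (\<i> * y)" by (simp only: power2_eq_iff)
    thus ?thesis using that[of y] that[of "- y"] y ym False by auto
  qed
qed

lemma csqrt_odd_in_cyclotomic:
  assumes "squarefree d" "odd d" "d dvd n" "n > 0" "d mod 4 = 1 \<or> 4 dvd n"
  shows "csqrt_nat d \<in> cyclotomic n"
proof -
  have y: "y \<in> cyclotomic n" if "y \<in> cyclotomic d" for y using that cyclotomic_mono assms by blast
  obtain y0 where y0: "y0 \<in> cyclotomic d" "d mod 4 = 1 \<longrightarrow> csqrt_nat d = y0"
    "d mod 4 = 3 \<longrightarrow> csqrt_nat d = \<i> * y0" using csqrt_odd_cases[OF assms(1,2)] .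
  have "d mod 4 = 1 \<or> d mod 4 = 3" using assms(2) by presburger
  thus ?thesis using y0 y[OF y0(1)] assms(4,5) ii_in_cyclotomic[of n]
    by (auto intro!: subfield_mult complex_subfield_Q_adjoin)
qed

text \<open>For squarefree \<open>d\<close> this is the discriminant of the field generated by the
  square root of \<open>d\<close>, with value 1 for \<open>d = 1\<close>.\<close>

definition quad_disc :: "nat \<Rightarrow> nat" where
  "quad_disc d = (if d mod 4 = 1 then d else 4 * d)"

text \<open>For even \<open>d\<close> the root of 2 is split off; it needs an eighth root of unity,
  which also supplies the \<open>\<i>\<close> that the odd cofactor may require.\<close>

lemma csqrt_in_cyclotomic_quad_disc:
  assumes d: "squarefree d" and n: "quad_disc d dvd n" "n > 0"
  shows "csqrt_nat d \<in> cyclotomic n"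
proof (cases "even d")
  case False
  thus ?thesis using d n by (intro csqrt_odd_in_cyclotomic) (auto simp: quad_disc_def split: if_splits intro: dvd_mult_right dvd_mult_left)
next
  case True
  then obtain e where e: "d = 2 * e" by blast
  have "odd e"
  proof
    assume "even e"
    hence "2 ^ 2 dvd d" using e by auto
    hence "(2 :: nat) dvd 1" using d squarefreeD by blast
    thus False by simp
  qed
  have "d mod 4 \<noteq> 1" using True by presburger
  hence n8: "8 * e dvd n" using n e by (simp add: quad_disc_def)
  have "csqrt_nat 2 \<in> cyclotomic n" using n8 n(2) by (intro csqrt_2_in_cyclotomic) (auto intro: dvd_mult_left)
  moreover have "csqrt_nat e \<in> cyclotomic n"
  proof (rule csqrt_odd_in_cyclotomic)
    show "squarefree e" using d e by (auto dest: squarefree_multD)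
    have "4 * (2 * e) dvd n" using n8 by simp
    thus "e mod 4 = 1 \<or> 4 dvd n" using dvd_mult_left by blast
    show "e dvd n" using n8 dvd_mult_right by blast
  qed (use \<open>odd e\<close> n in auto)
  ultimately show ?thesis unfolding e csqrt_nat_mult by (intro subfield_mult complex_subfield_Q_adjoin)
qed

subsection \<open>Homomorphisms of cyclotomic fields\<close>

lemma hom_on_zeta_dvd:
  assumes N: "N > 0" "n dvd N" and g: "hom_on (cyclotomic N) g" "g (zeta N) = zeta N ^ a"
  shows "g (zeta n) = zeta n ^ a"
proof -
  obtain k where k: "N = n * k" "k > 0" using N by (auto elim!: dvdE)
  have z: "zeta n = zeta N ^ k" using zeta_mult_power[OF k(2)] k(1) by simp
  have "g (zeta n) = (zeta N ^ a) ^ k"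
    unfolding z using hom_on_power[OF complex_subfield_Q_adjoin g(1)] zeta_in_cyclotomic[of N 1] g(2) by simp
  thus ?thesis unfolding z by (metis power_mult mult.commute)
qed

lemma hom_on_cyclotomic_fixed:
  assumes K: "complex_subfield K" "cyclotomic n \<subseteq> K" and g: "hom_on K g" "g (zeta n) = zeta n"
    and x: "x \<in> cyclotomic n" and n: "n > 0"
  shows "g x = x"
proof -
  obtain p where p: "poly_over \<rat> p" "x = poly p (zeta n)"
    using x cyclotomic_eq_adjoin1[OF n] by (auto simp: adjoin1_def)
  have "zeta n \<in> K" using K(2) zeta_in_cyclotomic[of n 1] by auto
  thus ?thesis using hom_on_poly_Rats[OF K(1) g(1) p(1)] p(2) g(2) by simp
qed

lemma zeta_cong_1: "n > 0 \<Longrightarrow> [a = 1] (mod n) \<Longrightarrow> zeta n ^ a = zeta n"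
  using zeta_power_eq_iff[of n a 1] by (simp add: cong_def)

text \<open>An exponent congruent to 1 modulo \<open>n\<close> fixes \<open>zeta n\<close> and so
  the field it generates. Every contradiction below compares this with a sign change.\<close>

lemma hom_on_cyclotomic_fixed_cong:
  assumes N: "N > 0" "n dvd N" and g: "hom_on (cyclotomic N) g" "g (zeta N) = zeta N ^ a"
    and a: "[a = 1] (mod n)" and x: "x \<in> cyclotomic n"
  shows "g x = x"
proof -
  have n: "n > 0" using N by (auto intro: dvd_pos_nat)
  show ?thesis
    by (rule hom_on_cyclotomic_fixed[OF complex_subfield_Q_adjoin cyclotomic_mono[OF N(2,1)] g(1) _ x n])
       (simp add: hom_on_zeta_dvd[OF N g] zeta_cong_1[OF n a])
qed

lemma coprime_dvd_mult_cong:
  fixes p m :: nat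
  assumes "Rings.coprime b p" "Rings.coprime p m" "p > 0" "m > 0"
  obtains a where "[a = b] (mod p)" "[a = 1] (mod m)" "Rings.coprime a (p * m)" "a > 0"
proof -
  obtain x where x: "[x = b] (mod p)" "[x = 1] (mod m)"
    using binary_chinese_remainder_nat[OF assms(2)] by blast
  define a where "a = x + p * m"
  have a: "[a = b] (mod p)" "[a = 1] (mod m)" using x by (auto simp: a_def cong_def)
  have "Rings.coprime a p" using a(1) assms(1) by (metis cong_gcd_eq coprime_iff_gcd_eq_1)
  moreover have "Rings.coprime a m" using a(2) by (metis cong_gcd_eq coprime_iff_gcd_eq_1 gcd_1_nat gcd.commute)
  ultimately have "Rings.coprime a (p * m)" by simp
  thus ?thesis using a that[of a] assms by (simp add: a_def)
qed

lemma squarefree_mult_prime_not_dvd: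
  fixes p e :: nat
  assumes "squarefree (p * e)" "Factorial_Ring.prime p" shows "\<not> p dvd e"
proof
  assume "p dvd e"
  hence "p ^ 2 dvd p * e" by (auto simp: power2_eq_square)
  hence "p dvd 1" using assms(1) squarefreeD by blast
  thus False using assms(2) by auto
qed

text \<open>The homomorphism constructed here acts on \<open>\<zeta>\<^sub>p\<close> as one that moves \<open>\<surd>(\<plusminus>p)\<close>, and trivially on
  all roots of unity of order dividing \<open>N\<close>.\<close>

lemma csqrt_not_in_cyclotomic_ramified:
  assumes p: "Factorial_Ring.prime p" "odd p" and d: "squarefree (p * e)"
    and N: "8 * e dvd N" "N > 0" "\<not> p dvd N" and u: "u \<in> cyclotomic N" "u \<noteq> 0"
  shows "u * csqrt_nat (p * e) \<notin> cyclotomic N"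
proof
  assume x: "u * csqrt_nat (p * e) \<in> cyclotomic N"
  have p0: "p > 0" using prime_gt_0_nat[OF p(1)] .
  have sqe: "squarefree e" "squarefree p" using d by (auto dest: squarefree_multD)
  obtain y where y: "y \<in> cyclotomic p" "p mod 4 = 1 \<longrightarrow> csqrt_nat p = y"
    "p mod 4 = 3 \<longrightarrow> csqrt_nat p = \<i> * y" using csqrt_odd_cases[OF sqe(2) p(2)] .
  have p4: "p mod 4 = 1 \<or> p mod 4 = 3" using p(2) by presburger
  have y2: "y ^ 2 = signed_nat p"
  proof -
    have "csqrt_nat p ^ 2 = signed_nat p * (if p mod 4 = 1 then 1 else - 1)"
      unfolding csqrt_nat_square by (simp add: signed_nat_def)
    thus ?thesis using p4 y by (auto simp: power_mult_distrib)
  qed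
  have "y \<notin> \<rat>"
  proof
    assume "y \<in> \<rat>"
    moreover have "algebraic_int y"
    proof (rule algebraic_int_root[where y = "signed_nat p" and p = "Polynomial.monom 1 2"])
      have "signed_nat p = of_int (if p mod 4 = 1 then int p else - int p)" by (simp add: signed_nat_def)
      thus "algebraic_int (signed_nat p)" by (metis algebraic_int_of_int_complex)
    qed (use y2 in \<open>auto simp: poly_monom degree_monom_eq\<close>)
    ultimately obtain k where "y = of_int k" using rational_algebraic_int_is_int by (auto elim: Ints_cases)
    hence "(of_int (k ^ 2) :: complex) = of_int (if p mod 4 = 1 then int p else - int p)"
      using y2 by (simp add: signed_nat_def)
    hence "k ^ 2 = (if p mod 4 = 1 then int p else - int p)" by (simp only: of_int_eq_iff)
    hence "k ^ 2 = int p" by (metis zero_le_power2 neg_0_le_iff_le of_nat_le_0_iff of_nat_0_le_iff p0 less_irrefl)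
    hence "nat \<bar>k\<bar> ^ 2 = p" by (metis nat_int nat_power_eq abs_ge_zero power2_abs)
    thus False using p(1) by (metis prime_power_iff numeral_eq_one_iff semiring_norm(85) )
  qed
  moreover have "alg_over \<rat> y"
    by (rule alg_over_root[of _ _ 2]) (auto simp: y2 signed_nat_def complex_subfield_Rats)
  moreover have az: "alg_over \<rat> (zeta p)" using alg_over_zeta complex_subfield_Rats p0 by blast
  ultimately obtain h where h: "hom_on (adjoin_list \<rat> [y, zeta p]) h" "h y \<noteq> y"
    using hom_moving_exists[OF complex_subfield_Rats, of y "[zeta p]"] by auto
  have L: "complex_subfield (adjoin_list \<rat> [y, zeta p])" "set [y, zeta p] \<subseteq> adjoin_list \<rat> [y, zeta p]"
    using complex_subfield_adjoin_list[OF complex_subfield_Rats, of "[y, zeta p]"]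
      adjoin_list_superset(2)[OF complex_subfield_Rats, of "[y, zeta p]"] \<open>alg_over \<rat> y\<close> az by auto
  have sub: "cyclotomic p \<subseteq> adjoin_list \<rat> [y, zeta p]"
    using L by (intro Q_adjoin_least) auto
  obtain b where b: "Rings.coprime b p" "b > 0" "h (zeta p) = zeta p ^ b"
    using hom_on_zeta[OF L(1) sub h(1) p0] .
  have "Rings.coprime p N" using p(1) N(3) by (simp add: prime_imp_coprime)
  then obtain a where a: "[a = b] (mod p)" "[a = 1] (mod N)" "Rings.coprime a (p * N)" "a > 0"
    using coprime_dvd_mult_cong[OF b(1) _ p0 N(2)] by blast
  have pN: "p * N > 0" using p0 N(2) by simp
  obtain g where g: "hom_on (cyclotomic (p * N)) g" "g (zeta (p * N)) = zeta (p * N) ^ a"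
    using hom_on_cyclotomic_exists[OF pN a(3,4)] .
  have fix1: "g w = w" if "w \<in> cyclotomic N" for w
    by (rule hom_on_cyclotomic_fixed_cong[OF pN _ g a(2) that]) simp
  obtain q where q: "poly_over \<rat> q" "y = poly q (zeta p)"
    using y(1) cyclotomic_eq_adjoin1[OF p0] by (auto simp: adjoin1_def)
  have zpN: "zeta p \<in> cyclotomic (p * N)"
    using cyclotomic_mono[of p "p * N"] pN zeta_in_cyclotomic[of p 1] by auto
  have "g (zeta p) = zeta p ^ a" by (rule hom_on_zeta_dvd[OF pN _ g]) simp
  also have "\<dots> = h (zeta p)" using b(3) a(1) zeta_power_eq_iff[OF p0] by (simp add: cong_def)
  finally have "g y = h y" unfolding q(2)
    using hom_on_poly_Rats[OF complex_subfield_Q_adjoin g(1) q(1) zpN]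
      hom_on_poly_Rats[OF L(1) h(1) q(1)] L(2) by simp
  hence gy: "g y \<noteq> y" using h(2) by simp
  note G = complex_subfield_Q_adjoin[of "{zeta (p * N)}"]
  have subN: "cyclotomic N \<subseteq> cyclotomic (p * N)" using pN by (intro cyclotomic_mono) auto
  have "8 dvd N" using N(1) dvd_mult_left by blast
  hence i: "\<i> \<in> cyclotomic N" using N(2) by (intro ii_in_cyclotomic) (auto elim!: dvdE)
  have yN: "y \<in> cyclotomic (p * N)" using y(1) cyclotomic_mono[of p "p * N"] pN by auto
  have e: "csqrt_nat e \<in> cyclotomic N"
    using N(1) by (intro csqrt_in_cyclotomic_quad_disc sqe N(2)) (auto simp: quad_disc_def elim!: dvdE)
  \<comment> \<open>Since \<open>8 * e\<close> divides \<open>N\<close>, both \<open>\<i>\<close>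
    and the root of \<open>e\<close> lie in the \<open>N\<close>-th field; everything but
    \<open>y\<close> goes into \<open>w\<close>, which \<open>g\<close> fixes.\<close>
  obtain w where w: "w \<in> cyclotomic N" "w \<noteq> 0" "u * csqrt_nat (p * e) = w * y"
  proof -
    have e0: "e \<noteq> 0" using sqe(1) not_squarefree_0 by metis
    have C: "complex_subfield (cyclotomic N)" by (rule complex_subfield_Q_adjoin)
    show ?thesis
    proof (cases "p mod 4 = 1")
      case True
      thus ?thesis using y(2) u e e0 by (intro that[of "u * csqrt_nat e"])
        (auto simp: real_sqrt_mult intro: subfield_mult[OF C])
    next
      case False
      thus ?thesis using y(3) p4 u e e0 i by (intro that[of "u * csqrt_nat e * \<i>"])
        (auto simp: real_sqrt_mult intro: subfield_mult[OF C])
    qed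
  qed
  have "w * y = g (w * y)" using fix1[OF x] w(3) by simp
  also have "\<dots> = g w * g y" using w(1) subN yN by (intro hom_on_mult[OF G g(1)]) auto
  also have "g w = w" by (rule fix1[OF w(1)])
  finally show False using w(2) gy by simp
qed

lemma squarefree_nat_pos: "squarefree (d :: nat) \<Longrightarrow> d > 0"
  by (rule ccontr) simp

lemma complex_eq_neg_self: "(x :: complex) = - x \<Longrightarrow> x = 0"
  by (simp add: complex_eq_iff)

lemma multiplicity_2_quad_disc:
  assumes "squarefree d"
  shows "multiplicity 2 (quad_disc d) = (if d mod 4 = 1 then 0 else if odd d then 2 else 3)"
proof -
  have d: "d \<noteq> 0" using squarefree_nat_pos[OF assms] by simp
  have 4: "multiplicity 2 (4 * k) = 2 + multiplicity 2 k" if "k > 0" for k :: nat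
  proof -
    have "multiplicity 2 (4 * k) = multiplicity 2 ((2 :: nat) ^ 2) + multiplicity 2 k"
      using that by (subst prime_elem_multiplicity_mult_distrib[symmetric]) auto
    thus ?thesis by (subst (asm) multiplicity_prime_power) auto
  qed
  show ?thesis
  proof (cases "odd d")
    case True
    hence "multiplicity 2 d = 0" by (simp add: not_dvd_imp_multiplicity_0)
    thus ?thesis using True d 4[of d] by (auto simp: quad_disc_def)
  next
    case False
    then obtain e where e: "d = 2 * e" by blast
    have "odd e" using squarefree_mult_prime_not_dvd[of 2 e] assms e by auto
    hence "multiplicity 2 e = 0" "e > 0" by (auto simp: not_dvd_imp_multiplicity_0 elim: oddE)
    hence "multiplicity 2 d = 1" unfolding e by (simp add: multiplicity_times_same)
    moreover have "d mod 4 \<noteq> 1" using False by presburger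
    ultimately show ?thesis using False d 4[of d] by (simp add: quad_disc_def)
  qed
qed

lemma squarefree_dvdI:
  fixes d n :: nat
  assumes "squarefree d" "\<And>p. Factorial_Ring.prime p \<Longrightarrow> p dvd d \<Longrightarrow> p dvd n"
  shows "d dvd n"
  using assms
proof (induction d rule: less_induct)
  case (less d)
  show ?case
  proof (cases "d = 1")
    case False
    then obtain p where p: "Factorial_Ring.prime p" "p dvd d" using prime_factor_nat by blast
    then obtain e where e: "d = p * e" by (elim dvdE)
    have "e \<noteq> 0" using squarefree_nat_pos[OF less.prems(1)] e by auto
    hence "e < d" using e prime_gt_1_nat[OF p(1)] by auto
    moreover have "squarefree e" using less.prems(1) e squarefree_multD(2) by blast
    moreover have "q dvd n" if "Factorial_Ring.prime q" "q dvd e" for q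
      using less.prems(2)[OF that(1)] that(2) e by simp
    ultimately have "e dvd n" by (rule less.IH)
    moreover have "Rings.coprime p e"
      using squarefree_mult_prime_not_dvd less.prems(1) p(1) e by (simp add: prime_imp_coprime)
    ultimately show ?thesis using less.prems(2)[OF p] by (simp add: e divides_mult)
  qed auto
qed

lemma odd_squarefree_dvdI:
  fixes d e n :: nat
  assumes "squarefree e" "odd e" "e dvd d"
    and n: "\<forall>p. Factorial_Ring.prime p \<and> odd p \<and> p dvd d \<longrightarrow> p dvd n"
  shows "e dvd n"
proof (rule squarefree_dvdI[OF assms(1)])
  fix p assume p: "Factorial_Ring.prime p" "p dvd e"
  have "odd p" using assms(2) p(2) dvd_trans by blast
  moreover have "p dvd d" using p(2) assms(3) by (rule dvd_trans)
  ultimately show "p dvd n" using n p(1) by blast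
qed

lemma squarefree_even_half:
  fixes d :: nat
  assumes "squarefree d" "even d"
  obtains e where "d = 2 * e" "odd e" "squarefree e"
proof -
  obtain e where e: "d = 2 * e" using assms(2) by (elim evenE)
  thus ?thesis using that[of e] assms(1) squarefree_mult_prime_not_dvd[of 2 e] squarefree_multD(2)[of 2 e]
    by auto
qed

text \<open>Enlarging the level to \<open>8 * n * e\<close> reduces this to the ramified case. The
  factor \<open>u\<close> covers both \<open>1\<close> and \<open>zeta (2 * n)\<close>, for positive
  and negative cosets.\<close>

lemma csqrt_in_cyclotomic_imp_dvd:
  assumes d: "squarefree d" and n: "n > 0" and u: "u \<in> cyclotomic (2 * n)" "u \<noteq> 0"
    and x: "u * csqrt_nat d \<in> cyclotomic n"
    and p: "Factorial_Ring.prime p" "odd p" "p dvd d"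
  shows "p dvd n"
proof (rule ccontr)
  assume pn: "\<not> p dvd n"
  obtain e where e: "d = p * e" using p(3) by (elim dvdE)
  have e0: "e \<noteq> 0" using squarefree_nat_pos[OF d] e by auto
  have pe: "\<not> p dvd e" using squarefree_mult_prime_not_dvd d p(1) e by simp
  have "\<not> p dvd 2" using p primes_dvd_imp_eq[of p 2] two_is_prime_nat by auto
  hence "\<not> p dvd 8" using prime_dvd_power[OF p(1), of 2 3] by auto
  hence "\<not> p dvd 8 * n * e" using pn pe p(1) by (simp add: prime_dvd_mult_iff)
  moreover have "u \<in> cyclotomic (8 * n * e)"
    using u(1) cyclotomic_mono[of "2 * n" "8 * n * e"] n e0 by (auto simp: dvd_def)
  moreover have "u * csqrt_nat (p * e) \<in> cyclotomic (8 * n * e)"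
    using x cyclotomic_mono[of n "8 * n * e"] n e0 e by auto
  ultimately show False
    using csqrt_not_in_cyclotomic_ramified[OF p(1,2), of e "8 * n * e" u] d e n e0 u by auto
qed

text \<open>By the Chinese remainder theorem the exponent at 2 can be any odd \<open>c\<close> while
  the odd part is fixed. Level \<open>8 * n\<close>, with 2-part \<open>2 ^ (\<alpha> + 3)\<close>,
  contains \<open>zeta (2 * n)\<close> and \<open>zeta 8\<close>, the roots of unity whose images
  matter.\<close>

lemma cyclotomic_hom_2adic:
  fixes n n' \<alpha> c :: nat
  assumes n: "n = 2 ^ \<alpha> * n'" "odd n'" and c: "odd c"
  obtains g a where "hom_on (cyclotomic (8 * n)) g" "g (zeta (8 * n)) = zeta (8 * n) ^ a"
    "[a = c] (mod 2 ^ (\<alpha> + 3))" "[a = 1] (mod n')"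
proof -
  have n0: "n' > 0" using n(2) by (auto elim: oddE)
  have co: "Rings.coprime (2 ^ (\<alpha> + 3)) n'" "Rings.coprime c (2 ^ (\<alpha> + 3))" using n(2) c by auto
  obtain a where a: "[a = c] (mod 2 ^ (\<alpha> + 3))" "[a = 1] (mod n')"
    "Rings.coprime a (2 ^ (\<alpha> + 3) * n')" "a > 0"
    using coprime_dvd_mult_cong[OF co(2,1)] n0 by auto
  have eq: "2 ^ (\<alpha> + 3) * n' = 8 * n" by (simp add: n(1) power_add)
  obtain g where "hom_on (cyclotomic (8 * n)) g" "g (zeta (8 * n)) = zeta (8 * n) ^ a"
    using hom_on_cyclotomic_exists[of "8 * n" a] a(3,4) n0 unfolding eq by (auto simp: n(1))
  thus ?thesis using that a by blast
qed

lemma cong_2adic: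
  fixes n n' \<alpha> \<beta> a c :: nat
  assumes "odd n'" "[a = c] (mod 2 ^ (\<alpha> + 3))" "[a = 1] (mod n')" "\<beta> \<le> \<alpha> + 3" "[c = k] (mod 2 ^ \<beta>)"
    "[k = 1] (mod n')"
  shows "[a = k] (mod 2 ^ \<beta> * n')"
proof (rule coprime_cong_mult_nat)
  have "[a = c] (mod 2 ^ \<beta>)" by (rule cong_dvd_modulus_nat[OF assms(2)]) (use assms(4) in \<open>simp add: le_imp_power_dvd\<close>)
  thus "[a = k] (mod 2 ^ \<beta>)" using assms(5) by (rule cong_trans)
  show "[a = k] (mod n')" using assms(3,6) by (metis cong_trans cong_sym)
qed (use assms(1) in auto)

text \<open>Exponent 3 sends \<open>\<i>\<close> to its negative, so among odd \<open>d\<close> it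
  moves the roots with \<open>d mod 4 = 3\<close>. Exponent 5 fixes \<open>\<i>\<close> and negates
  \<open>zeta 8\<close>, so it moves the root of 2 and fixes the roots of odd
  \<open>d\<close>.\<close>

lemma cyclotomic_hom_csqrt:
  fixes n n' \<alpha> c a :: nat
  assumes n: "n = 2 ^ \<alpha> * n'" "odd n'" and g: "hom_on (cyclotomic (8 * n)) g" "g (zeta (8 * n)) = zeta (8 * n) ^ a"
    and a: "[a = c] (mod 2 ^ (\<alpha> + 3))" "[a = 1] (mod n')"
    and d: "squarefree d" "\<And>p. Factorial_Ring.prime p \<Longrightarrow> odd p \<Longrightarrow> p dvd d \<Longrightarrow> p dvd n"
  shows "c = 3 \<Longrightarrow> odd d \<Longrightarrow> g (csqrt_nat d) = (if d mod 4 = 1 then csqrt_nat d else - csqrt_nat d)"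
    and "c = 5 \<Longrightarrow> g (csqrt_nat d) = (if even d then - csqrt_nat d else csqrt_nat d)"
proof -
  note K = complex_subfield_Q_adjoin[of "{zeta (8 * n)}"]
  have n0: "n' > 0" "8 * n > 0" using n by (auto elim: oddE)
  have gz: "g (zeta k) = zeta k ^ a" if "k dvd 8 * n" for k by (rule hom_on_zeta_dvd[OF n0(2) that g])
  have z: "zeta k \<in> cyclotomic (8 * n)" if "k dvd 8 * n" for k
    using cyclotomic_mono[OF that n0(2)] zeta_in_cyclotomic[of k 1] by auto
  have a8: "[a = c] (mod 8)"
    using a(1) by (rule cong_dvd_modulus_nat) (simp add: power_add)
  have gi: "g \<i> = \<i> ^ c"
  proof -
    have "[a = c] (mod 4)" using a8 by (rule cong_dvd_modulus_nat) simp
    hence "zeta 4 ^ a = zeta 4 ^ c" by (simp add: zeta_power_eq_iff cong_def)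
    thus ?thesis using gz[of 4] by (simp add: zeta_4)
  qed
  have i: "\<i> \<in> cyclotomic (8 * n)" using z[of 4] by (simp add: zeta_4)
  have g8: "g (zeta 8) = zeta 8 ^ c"
    using gz[of 8] a8 by (simp add: zeta_power_eq_iff cong_def)
  have odd_case: "g (csqrt_nat e) = (if e mod 4 = 1 then csqrt_nat e else csqrt_nat e * \<i> ^ (c - 1)) \<and>
      csqrt_nat e \<in> cyclotomic (8 * n)"
    if e: "squarefree e" "odd e" "e dvd d" and c: "c > 0" for e
  proof -
    have "p dvd n'" if "Factorial_Ring.prime p" "p dvd e" for p
    proof -
      have "odd p" using that e(2) by (meson dvd_trans)
      hence "p dvd n" using d(2) that e(3) dvd_trans by blast
      hence "p dvd 2 ^ \<alpha> \<or> p dvd n'" using that(1) n(1) by (simp add: prime_dvd_mult_iff)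
      moreover have "\<not> p dvd 2 ^ \<alpha>" using \<open>odd p\<close> that(1)
        by (metis prime_dvd_power primes_dvd_imp_eq two_is_prime_nat dvd_refl)
      ultimately show ?thesis by blast
    qed
    hence en': "e dvd n'" using e(1) by (rule squarefree_dvdI[rotated])
    hence en: "e dvd 8 * n" using n(1) by auto
    obtain y where y: "y \<in> cyclotomic e" "e mod 4 = 1 \<longrightarrow> csqrt_nat e = y"
      "e mod 4 = 3 \<longrightarrow> csqrt_nat e = \<i> * y" using csqrt_odd_cases[OF e(1,2)] .
    have gy: "g y = y"
      by (rule hom_on_cyclotomic_fixed_cong[OF n0(2) en g _ y(1)]) (rule cong_dvd_modulus_nat[OF a(2) en'])
    have yK: "y \<in> cyclotomic (8 * n)" using y(1) cyclotomic_mono[OF en n0(2)] by auto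
    have "e mod 4 = 1 \<or> e mod 4 = 3" using e(2) by presburger
    thus ?thesis
    proof
      assume "e mod 4 = 3"
      moreover from this have "g (csqrt_nat e) = \<i> ^ c * y"
        using y(3) hom_on_mult[OF K g(1) i yK] gi gy by simp
      moreover have "\<i> ^ c = \<i> * \<i> ^ (c - 1)" using c by (cases c) auto
      ultimately show ?thesis using y(3) subfield_mult[OF K i yK] by simp
    qed (use y(2) gy yK in auto)
  qed
  show "g (csqrt_nat d) = (if d mod 4 = 1 then csqrt_nat d else - csqrt_nat d)" if "c = 3" "odd d"
    using odd_case[of d] d that by simp
  show "g (csqrt_nat d) = (if even d then - csqrt_nat d else csqrt_nat d)" if c5: "c = 5"
  proof (cases "even d")
    case False
    thus ?thesis using odd_case[of d] d c5 by simp
  next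
    case True
    then obtain e where e: "d = 2 * e" "odd e" "squarefree e" using squarefree_even_half d(1) by blast
    have ge: "g (csqrt_nat e) = csqrt_nat e" "csqrt_nat e \<in> cyclotomic (8 * n)"
      using odd_case[of e] e c5 by auto
    have z85: "zeta 8 ^ 5 = - zeta 8"
    proof -
      have "zeta 8 ^ 4 = - 1" by (simp add: zeta_power)
      thus ?thesis by (simp add: eval_nat_numeral)
    qed
    have g2: "g (csqrt_nat 2) = - csqrt_nat 2"
    proof -
      have "g (csqrt_nat 2) = g (zeta 8) * (g 1 - g \<i>)" unfolding csqrt_2
        using z[of 8] i subfield_1[OF K]
        by (simp add: hom_on_mult[OF K g(1)] hom_on_diff[OF K g(1)] subfield_diff[OF K])
      thus ?thesis unfolding gi g8 c5 z85 csqrt_2 by (simp add: hom_on_1[OF K g(1)] eval_nat_numeral)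
    qed
    have "csqrt_nat 2 \<in> cyclotomic (8 * n)" using n0 by (intro csqrt_2_in_cyclotomic) auto
    hence "g (csqrt_nat d) = - csqrt_nat 2 * csqrt_nat e"
      unfolding e(1) csqrt_nat_mult using hom_on_mult[OF K g(1)] ge g2 by simp
    thus ?thesis using True unfolding e(1) csqrt_nat_mult by simp
  qed
qed

text \<open>The odd primes are settled by ramification. If the condition at 2 fails, some
  homomorphism of level \<open>8 * n\<close> is trivial on the \<open>n\<close>-th field and still
  negates the root of \<open>d\<close>.\<close>

lemma csqrt_in_cyclotomic_iff:
  assumes d: "squarefree d" and n: "n > 0"
  shows "csqrt_nat d \<in> cyclotomic n \<longleftrightarrow>
    (\<forall>p. Factorial_Ring.prime p \<and> odd p \<and> p dvd d \<longrightarrow> p dvd n) \<and>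
    multiplicity 2 (quad_disc d) \<le> multiplicity 2 n" (is "?L \<longleftrightarrow> ?P \<and> ?V")
proof -
  have dvd: "4 dvd n \<longleftrightarrow> 2 \<le> multiplicity 2 n" "8 dvd n \<longleftrightarrow> 3 \<le> multiplicity 2 n"
    using power_dvd_iff_le_multiplicity[of n 2 2] power_dvd_iff_le_multiplicity[of n 2 3] n by simp_all
  have V: "?V \<longleftrightarrow> (if d mod 4 = 1 then True else if odd d then 4 dvd n else 8 dvd n)"
    unfolding multiplicity_2_quad_disc[OF d] dvd by simp
  show ?thesis
  proof (intro iffI conjI)
    assume L: ?L
    show P: ?P
      using csqrt_in_cyclotomic_imp_dvd[OF d n, of 1] L by (auto intro: subfield_1 complex_subfield_Q_adjoin)
    show ?V
    proof (rule ccontr)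
      assume nV: "\<not> ?V"
      define \<alpha> where "\<alpha> = multiplicity 2 n"
      obtain n' where n': "n = 2 ^ \<alpha> * n'" "odd n'"
        using multiplicity_decompose'[of n 2] n unfolding \<alpha>_def by auto
      \<comment> \<open>When the condition at 2 fails, \<open>\<alpha>\<close> is at most 1 for odd
        \<open>d\<close> and at most 2 for even \<open>d\<close>, so this \<open>c\<close> is 1
        modulo \<open>2 ^ \<alpha>\<close> and yet moves the root of \<open>d\<close>.\<close>
      define c :: nat where "c = (if odd d then 3 else 5)"
      have cc: "[c = 1] (mod 2 ^ \<alpha>)"
      proof (cases "odd d")
        case True
        hence "\<not> 4 dvd n" using nV V by (auto split: if_splits)
        hence "\<alpha> < 2" unfolding dvd \<alpha>_def by simp
        hence "\<alpha> = 0 \<or> \<alpha> = 1" by linarith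
        thus ?thesis using True by (auto simp: c_def cong_def)
      next
        case False
        hence "d mod 4 \<noteq> 1" by presburger
        hence "\<not> 8 dvd n" using nV V False by auto
        hence "\<alpha> < 3" unfolding dvd \<alpha>_def by simp
        hence "\<alpha> = 0 \<or> \<alpha> = 1 \<or> \<alpha> = 2" by linarith
        thus ?thesis using False by (auto simp: c_def cong_def)
      qed
      have "odd c" by (simp add: c_def)
      then obtain g a where g: "hom_on (cyclotomic (8 * n)) g" "g (zeta (8 * n)) = zeta (8 * n) ^ a"
        "[a = c] (mod 2 ^ (\<alpha> + 3))" "[a = 1] (mod n')" using cyclotomic_hom_2adic[OF n'] by blast
      have "[a = 1] (mod 2 ^ \<alpha> * n')" by (rule cong_2adic[OF n'(2) g(3,4) _ cc]) auto
      hence "g (csqrt_nat d) = csqrt_nat d"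
        using n L by (intro hom_on_cyclotomic_fixed_cong[OF _ _ g(1,2)]) (auto simp: n'(1))
      moreover have "g (csqrt_nat d) = - csqrt_nat d"
        using cyclotomic_hom_csqrt[OF n' g d, of] P nV V by (auto simp: c_def split: if_splits)
      ultimately have "csqrt_nat d = 0" by (metis complex_eq_neg_self)
      thus False using squarefree_nat_pos[OF d] by simp
    qed
  next
    assume PV: "?P \<and> ?V"
    show ?L
    proof (cases "odd d")
      case True
      have "d dvd n" using odd_squarefree_dvdI[OF d True dvd_refl] PV by blast
      thus ?thesis using PV V True d n by (intro csqrt_odd_in_cyclotomic) (auto split: if_splits)
    next
      case False
      then obtain e where e: "d = 2 * e" "odd e" "squarefree e" using squarefree_even_half d by blast
      have "d mod 4 \<noteq> 1" using False by presburger
      hence n8: "8 dvd n" using PV V False by auto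
      hence n4: "4 dvd n" using dvd_trans[of 4 8 n] by simp
      have "e dvd n" using odd_squarefree_dvdI[OF e(3,2), of d n] PV e(1) by simp
      hence "csqrt_nat e \<in> cyclotomic n" using e n n4 by (intro csqrt_odd_in_cyclotomic) auto
      thus ?thesis unfolding e(1) csqrt_nat_mult using n n8
        by (intro subfield_mult complex_subfield_Q_adjoin csqrt_2_in_cyclotomic)
    qed
  qed
qed

lemma zeta_double_power: "n > 0 \<Longrightarrow> zeta (2 * n) ^ n = - 1"
  by (simp add: zeta_power)

text \<open>Outside the \<open>n\<close>-th field, \<open>zeta (2 * n)\<close> can be compensated
  only by a root of \<open>d\<close> that contributes a 2-power root of unity just beyond that
  field: \<open>\<i>\<close> if \<open>n\<close> is twice odd, \<open>zeta 8\<close> if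
  \<open>n\<close> is four times odd. Otherwise some homomorphism trivial on the \<open>n\<close>-th
  field negates the product.\<close>

lemma zeta_double_csqrt_in_cyclotomic_iff:
  assumes d: "squarefree d" and n: "n > 0" "even n"
  shows "zeta (2 * n) * csqrt_nat d \<in> cyclotomic n \<longleftrightarrow>
    (\<forall>p. Factorial_Ring.prime p \<and> odd p \<and> p dvd d \<longrightarrow> p dvd n) \<and>
    multiplicity 2 (quad_disc d) = multiplicity 2 n + 1" (is "?L \<longleftrightarrow> ?P \<and> ?V")
proof -
  note K = complex_subfield_Q_adjoin[of "{zeta n}"]
  note K8 = complex_subfield_Q_adjoin[of "{zeta (8 * n)}"]
  define \<alpha> where "\<alpha> = multiplicity 2 n"
  obtain n' where n': "n = 2 ^ \<alpha> * n'" "odd n'"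
    using multiplicity_decompose'[of n 2] n unfolding \<alpha>_def by auto
  have \<alpha>0: "\<alpha> > 0" using n'(1,2) n(2) by (cases \<alpha>) auto
  have d0: "csqrt_nat d \<noteq> 0" using squarefree_nat_pos[OF d] by simp
  have V: "?V \<longleftrightarrow> (d mod 4 = 3 \<and> \<alpha> = 1) \<or> (even d \<and> \<alpha> = 2)"
  proof -
    have "d mod 4 = 1 \<or> d mod 4 = 3 \<or> even d" by presburger
    moreover have "d mod 4 = 3 \<Longrightarrow> odd d" "d mod 4 = 1 \<Longrightarrow> odd d" by presburger+
    ultimately show ?thesis using \<alpha>0 unfolding multiplicity_2_quad_disc[OF d] \<alpha>_def by auto
  qed
  have z2: "zeta (2 * n) \<in> cyclotomic (8 * n)" "zeta (2 * n) \<in> cyclotomic (2 * n)"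
    using cyclotomic_mono[of "2 * n" "8 * n"] zeta_in_cyclotomic[of "2 * n" 1] n by (auto simp: dvd_def)
  show ?thesis
  proof (intro iffI conjI)
    assume L: ?L
    show P: ?P
      using csqrt_in_cyclotomic_imp_dvd[OF d n(1) z2(2) _ L] by auto
    show ?V
    proof (rule ccontr)
      assume nV: "\<not> ?V"
      show False
      proof (cases "\<alpha> \<ge> 3")
        \<comment> \<open>For \<open>\<alpha> \<ge> 3\<close> the root of \<open>d\<close> already
          lies in the field, so \<open>zeta (2 * n)\<close> would lie there too; the exponent
          \<open>1 + n\<close> refutes this.\<close>
        case True
        have "multiplicity 2 (quad_disc d) \<le> multiplicity 2 n"
          unfolding multiplicity_2_quad_disc[OF d] using True by (simp add: \<alpha>_def)
        hence "csqrt_nat d \<in> cyclotomic n" using csqrt_in_cyclotomic_iff[OF d n(1)] P by blast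
        hence "zeta (2 * n) * csqrt_nat d / csqrt_nat d \<in> cyclotomic n" using L by (intro subfield_divide[OF K])
        hence zn: "zeta (2 * n) \<in> cyclotomic n" using d0 by simp
        have "Rings.coprime (1 + n) (2 * n)" using n(2) by simp
        then obtain g where g: "hom_on (cyclotomic (2 * n)) g" "g (zeta (2 * n)) = zeta (2 * n) ^ (1 + n)"
          using hom_on_cyclotomic_exists[of "2 * n" "1 + n"] n by auto
        have "g (zeta (2 * n)) = zeta (2 * n)"
          using n mod_add_self2[of 1 n] by (intro hom_on_cyclotomic_fixed_cong[OF _ dvd_triv_right g _ zn]) (auto simp only: cong_def)
        thus False using g(2) zeta_double_power[OF n(1)] by (simp add: power_add)
      next
        case False
        \<comment> \<open>The choice moves exactly one of the two factors: for
          \<open>\<alpha> = 1\<close> and even \<open>d\<close> the root of \<open>d\<close>, and in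
          all other remaining cases \<open>zeta (2 * n)\<close>.\<close>
        define c :: nat where "c = (if \<alpha> = 1 \<and> odd d then 3 else 5)"
        have "odd c" by (simp add: c_def)
        then obtain g a where g: "hom_on (cyclotomic (8 * n)) g" "g (zeta (8 * n)) = zeta (8 * n) ^ a"
          "[a = c] (mod 2 ^ (\<alpha> + 3))" "[a = 1] (mod n')" using cyclotomic_hom_2adic[OF n'] by blast
        have \<alpha>12: "\<alpha> = 1 \<or> \<alpha> = 2" using \<alpha>0 False by linarith
        have "[c = 1] (mod 2 ^ \<alpha>)" using \<alpha>12 by (auto simp: c_def cong_def)
        hence "[a = 1] (mod 2 ^ \<alpha> * n')" by (intro cong_2adic[OF n'(2) g(3,4)]) auto
        hence fixed: "g (zeta (2 * n) * csqrt_nat d) = zeta (2 * n) * csqrt_nat d"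
          using n L by (intro hom_on_cyclotomic_fixed_cong[OF _ _ g(1,2)]) (auto simp: n'(1))
        \<comment> \<open>The exponent by which \<open>g\<close> acts on
          \<open>zeta (2 * n)\<close>; the value \<open>1 + n\<close> is a change of sign, since
          \<open>zeta (2 * n) ^ n = - 1\<close>.\<close>
        define k where "k = (if \<alpha> = 1 \<and> even d then 1 else 1 + n)"
        have "[c = k] (mod 2 ^ (\<alpha> + 1))"
        proof (cases "\<alpha> = 1")
          case True
          have "(1 + n) mod 4 = 3" using n'(2) unfolding n'(1) True by simp presburger
          thus ?thesis using True by (auto simp: c_def k_def cong_def)
        next
          case False
          hence a2: "\<alpha> = 2" using \<alpha>12 by simp
          have "(1 + n) mod 8 = 5" using n'(2) unfolding n'(1) a2 by simp presburger
          thus ?thesis using a2 by (auto simp: c_def k_def cong_def)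
        qed
        moreover have "[k = 1] (mod n')"
          using mod_mult_self3[of "2 ^ \<alpha>" n' 1] by (auto simp: k_def cong_def n'(1) add.commute[of _ 1])
        ultimately have "[a = k] (mod 2 ^ (\<alpha> + 1) * n')" by (intro cong_2adic[OF n'(2) g(3,4)]) auto
        hence "[a = k] (mod 2 * n)" by (simp add: n'(1) mult.assoc)
        hence "zeta (2 * n) ^ a = zeta (2 * n) ^ k" using n by (simp add: zeta_power_eq_iff cong_def)
        moreover have "zeta (2 * n) ^ (1 + n) = - zeta (2 * n)" using zeta_double_power[OF n(1)] by (simp add: power_add)
        ultimately have gz: "g (zeta (2 * n)) = (if \<alpha> = 1 \<and> even d then zeta (2 * n) else - zeta (2 * n))"
          using hom_on_zeta_dvd[OF _ _ g(1,2), of "2 * n"] n by (auto simp: k_def)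
        have gd: "g (csqrt_nat d) = (if \<alpha> = 1 \<and> even d then - csqrt_nat d else csqrt_nat d)"
        proof -
          have "d mod 4 = 1 \<or> d mod 4 = 3 \<or> even d" by presburger
          thus ?thesis
            using cyclotomic_hom_csqrt[OF n' g d] P nV V \<alpha>12 by (auto simp: c_def split: if_splits)
        qed
        have dK: "csqrt_nat d \<in> cyclotomic (8 * n)"
        proof -
          have "zeta (2 * n) * csqrt_nat d / zeta (2 * n) \<in> cyclotomic (8 * n)"
            using L cyclotomic_mono[of n "8 * n"] n by (intro subfield_divide[OF K8] z2) auto
          thus ?thesis by simp
        qed
        have "g (zeta (2 * n) * csqrt_nat d) = - (zeta (2 * n) * csqrt_nat d)"
          using hom_on_mult[OF K8 g(1) z2(1) dK] gz gd by (auto split: if_splits)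
        hence "zeta (2 * n) * csqrt_nat d = 0" using fixed by (metis complex_eq_neg_self)
        thus False using d0 by simp
      qed
    qed
  next
    assume PV: "?P \<and> ?V"
    consider "d mod 4 = 3" "\<alpha> = 1" | "even d" "\<alpha> = 2" using PV V by blast
    thus ?L
    proof cases
      case 1
      hence od: "odd d" by presburger
      obtain y where y: "y \<in> cyclotomic d" "d mod 4 = 3 \<longrightarrow> csqrt_nat d = \<i> * y"
        using csqrt_odd_cases[OF d od] by blast
      have "d dvd n" using odd_squarefree_dvdI[OF d od dvd_refl] PV by blast
      hence yn: "y \<in> cyclotomic n" using y(1) cyclotomic_mono n by blast
      have k: "n = 2 * n'" "odd n'" using n' 1(2) by simp_all
      \<comment> \<open>Both factors have \<open>n\<close>-th power -1, because \<open>n\<close> is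
        twice an odd number.\<close>
      have "(zeta (2 * n) * \<i>) ^ n = 1"
        unfolding power_mult_distrib zeta_double_power[OF n(1)] unfolding k(1) power_mult using k(2) by simp
      hence "zeta (2 * n) * \<i> \<in> cyclotomic n" using n by (intro root_of_unity_in_cyclotomic)
      hence "zeta (2 * n) * \<i> * y \<in> cyclotomic n" by (rule subfield_mult[OF K _ yn])
      thus ?thesis using y(2) 1 by (simp add: mult.assoc)
    next
      case 2
      then obtain e where e: "d = 2 * e" "odd e" "squarefree e" using squarefree_even_half d by blast
      have k: "n = 4 * n'" "odd n'" using n' 2(2) by simp_all
      have n4: "4 dvd n" using k by simp
      have "e dvd n" using odd_squarefree_dvdI[OF e(3,2), of d n] PV e(1) by simp
      hence en: "csqrt_nat e \<in> cyclotomic n" using e n n4 by (intro csqrt_odd_in_cyclotomic) auto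
      have "zeta 8 ^ 4 = - 1" by (simp add: zeta_power)
      hence "(zeta (2 * n) * zeta 8) ^ n = 1"
        unfolding power_mult_distrib zeta_double_power[OF n(1)] unfolding k(1) power_mult using k(2) by simp
      hence z: "zeta (2 * n) * zeta 8 \<in> cyclotomic n" using n by (intro root_of_unity_in_cyclotomic)
      have "1 - \<i> \<in> cyclotomic n"
        by (intro subfield_diff[OF K] subfield_1[OF K] ii_in_cyclotomic n4 n)
      hence "(zeta (2 * n) * zeta 8) * (1 - \<i>) * csqrt_nat e \<in> cyclotomic n"
        by (intro subfield_mult[OF K subfield_mult[OF K z] en])
      thus ?thesis unfolding e(1) csqrt_nat_mult csqrt_2 by (simp add: mult.assoc)
    qed
  qed
qed

subsection \<open>Rational powers in cyclotomic fields\<close>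

text \<open>A fraction \<open>a / b\<close> equals \<open>a * b / b ^ 2\<close>, so the squarefree
  part of the integer \<open>a * b\<close> serves as \<open>d\<close>.\<close>

lemma rat_squarefree_decomposition:
  assumes "(q :: rat) > 0"
  obtains d :: nat and s where "squarefree d" "s > 0" "q = of_nat d * s ^ 2"
proof -
  obtain a b :: int where ab: "q = of_int a / of_int b" "b > 0"
    by (metis Fract_of_int_quotient Rat_cases)
  hence a0: "a > 0" using assms by (simp add: zero_less_divide_iff)
  define k where "k = nat (a * b)"
  have k0: "k > 0" using a0 ab(2) by (simp add: k_def)
  have kd: "k = squarefree_part k * square_part k ^ 2" by (rule squarefree_decompose)
  have "(of_nat k :: rat) = of_int a * of_int b"
    using a0 ab(2) unfolding k_def by (simp flip: of_int_mult)
  hence "q = of_nat k / of_int b ^ 2" using ab by (simp add: power2_eq_square field_simps)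
  also have "(of_nat k :: rat) = of_nat (squarefree_part k) * of_nat (square_part k) ^ 2"
    by (subst kd) simp
  finally have q: "q = of_nat (squarefree_part k) * (of_nat (square_part k) / of_int b) ^ 2"
    by (simp add: power_divide)
  have "square_part k > 0" using k0 by (intro gr0I) simp
  hence "(of_nat (square_part k) / of_int b :: rat) > 0" using ab(2) by simp
  thus ?thesis using q by (rule that[OF squarefree_squarefree_part])
qed

text \<open>For a root \<open>x\<close> of a rational in a cyclotomic field, \<open>|x|\<^sup>2\<close> is fixed by every homomorphism, because
  complex conjugation commutes with all of them.\<close>

lemma cyclotomic_power_norm_rational:
  assumes n: "n > 0" and x: "x \<in> cyclotomic n" "x ^ n = of_rat g" and g0: "g \<noteq> 0"
  obtains q :: rat where "q > 0" "g ^ 2 = q ^ n" "x * cnj x = of_rat q"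
proof -
  define B where "B = x * cnj x"
  have x0: "x \<noteq> 0" using x(2) g0 n by (auto simp: power_0_left)
  have cnj_rat: "cnj (of_rat g) = of_rat g"
    using hom_on_of_rat[of UNIV cnj g] by (auto simp: complex_subfield_def hom_on_def)
  have Bn: "B ^ n = of_rat (g ^ 2)"
    using x(2) cnj_rat by (simp add: B_def power_mult_distrib power2_eq_square of_rat_mult flip: complex_cnj_power)
  have Br: "B = of_real ((norm x) ^ 2)" unfolding B_def using complex_norm_square[of x] by simp
  have "B \<in> \<rat>"
  proof (rule ccontr)
    assume nB: "B \<notin> \<rat>"
    note Q = complex_subfield_Rats
    have aB: "alg_over \<rat> B" by (rule alg_over_root[OF Q _ n]) (simp add: Bn)
    have az: "alg_over \<rat> (zeta n)" by (rule alg_over_zeta[OF Q n])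
    define K where "K = adjoin_list \<rat> [B, zeta n]"
    obtain h where h: "hom_on K h" "h B \<noteq> B"
      using hom_moving_exists[OF Q aB nB, of "[zeta n]"] az by (auto simp: K_def)
    have K: "complex_subfield K" "zeta n \<in> K"
      using complex_subfield_adjoin_list[OF Q, of "[B, zeta n]"] adjoin_list_superset(2)[OF Q, of "[B, zeta n]"]
        aB az by (auto simp: K_def)
    hence sub: "cyclotomic n \<subseteq> K" by (intro Q_adjoin_least) auto
    have cx: "cnj x \<in> cyclotomic n" "h (cnj x) = cnj (h x)" using hom_on_cnj[OF K(1) sub h(1) n x(1)] by auto
    have BK: "B \<in> K" unfolding B_def using x(1) cx(1) sub by (intro subfield_mult[OF K(1)]) auto
    have "h B = h x * cnj (h x)" unfolding B_def using hom_on_mult[OF K(1) h(1), of x "cnj x"] x(1) cx sub by auto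
    hence hB: "h B = of_real ((norm (h x)) ^ 2)" using complex_norm_square[of "h x"] by simp
    have hBn: "h B ^ n = B ^ n" using hom_on_power[OF K(1) h(1) BK, of n] Bn hom_on_of_rat[OF K(1) h(1)] by simp
    \<comment> \<open>\<open>h B\<close> and \<open>B\<close> are nonnegative reals with the same
      \<open>n\<close>-th power, so they coincide, although \<open>h\<close> was chosen to move
      \<open>B\<close>.\<close>
    have "complex_of_real (((norm (h x)) ^ 2) ^ n) = h B ^ n" unfolding hB by (rule of_real_power)
    also have "\<dots> = complex_of_real (((norm x) ^ 2) ^ n)"
      unfolding hBn by (simp only: Br of_real_power)
    finally have "((norm (h x)) ^ 2) ^ n = ((norm x) ^ 2) ^ n" by (simp only: of_real_eq_iff)
    hence "(norm (h x)) ^ 2 = (norm x) ^ 2" using n by (simp only: power_eq_iff_eq_base zero_le_power2)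
    thus False using h(2) hB Br by simp
  qed
  then obtain q where q: "B = of_rat q" by (auto elim: Rats_cases)
  have "(of_rat q :: complex) = of_real (of_rat q)"
    by (cases q rule: Rat_cases) (simp add: of_rat_rat)
  hence "of_rat q = (norm x) ^ 2" using q Br by (metis of_real_eq_iff)
  hence "(of_rat q :: real) > 0" using x0 by simp
  hence "q > 0" by simp
  moreover have "(of_rat (g ^ 2) :: complex) = of_rat (q ^ n)" using Bn q by (simp add: of_rat_power)
  hence "g ^ 2 = q ^ n" by (simp only: of_rat_eq_iff)
  ultimately show ?thesis using that q by (simp add: B_def)
qed

lemma cyclotomic_powersI: "x \<in> cyclotomic n \<Longrightarrow> x ^ n = of_rat g \<Longrightarrow> g \<noteq> 0 \<Longrightarrow> g \<in> cyclotomic_powers n"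
  by (auto simp: cyclotomic_powers_def)

lemma Qstar_pow_subset_cyclotomic_powers: "n > 0 \<Longrightarrow> Qstar_pow n \<subseteq> cyclotomic_powers n"
  by (auto simp: Qstar_pow_def of_rat_power intro!: cyclotomic_powersI[of "of_rat _"]
      subfield_of_rat complex_subfield_Q_adjoin)

text \<open>From \<open>g ^ 2 = q ^ n\<close> with \<open>n = 2 * j + 1\<close> the number
  \<open>g / q ^ j\<close> is a rational square root of \<open>q\<close>, and its
  \<open>n\<close>-th power is \<open>g\<close>.\<close>

lemma cyclotomic_powers_odd:
  assumes n: "odd n"
  shows "cyclotomic_powers n = Qstar_pow n"
proof
  have n0: "n > 0" using n by (auto elim: oddE)
  show "Qstar_pow n \<subseteq> cyclotomic_powers n" by (rule Qstar_pow_subset_cyclotomic_powers[OF n0])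
  show "cyclotomic_powers n \<subseteq> Qstar_pow n"
  proof
    fix g assume "g \<in> cyclotomic_powers n"
    then obtain x where x: "g \<noteq> 0" "x \<in> cyclotomic n" "x ^ n = of_rat g"
      by (auto simp: cyclotomic_powers_def)
    obtain q where q: "q > 0" "g ^ 2 = q ^ n"
      using cyclotomic_power_norm_rational[OF n0 x(2,3,1)] by blast
    obtain j where j: "n = 2 * j + 1" using n by (elim oddE)
    have "(g / q ^ j) ^ 2 = q"
      using q by (simp add: power_divide j power_mult[symmetric] mult.commute field_simps)
    hence "(g / q ^ j) ^ n = (g / q ^ j) * q ^ j" by (simp add: j power_mult)
    also have "\<dots> = g" using q(1) by simp
    finally show "g \<in> Qstar_pow n" using x(1) q(1) Qstar_powI[of "g / q ^ j" n] by simp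
  qed
qed

text \<open>A root \<open>x\<close> of \<open>g\<close> gives \<open>g ^ 2 = q ^ n\<close>, so
  \<open>g\<close> is plus or minus \<open>q\<close> to the power \<open>n / 2\<close>; with
  \<open>q = d * t ^ 2\<close>, \<open>x\<close> is a root of unity times the root of
  \<open>d\<close> and \<open>t\<close>. The condition is split into the odd part \<open>n'\<close>
  and the 2-part because \<open>Gamma_tilde\<close> sees only the latter.\<close>

lemma cyclotomic_powers_even:
  assumes n: "n = 2 ^ \<alpha> * n'" "odd n'" and \<alpha>: "\<alpha> > 0"
  shows "g \<in> cyclotomic_powers n \<longleftrightarrow> g \<in> Qstar_pow n' \<and>
    (\<exists>(d :: nat) s q. squarefree d \<and> (s = 1 \<or> s = -1) \<and> q \<noteq> 0 \<and>
      g = s * of_nat d ^ (2 ^ (\<alpha> - 1)) * q ^ (2 ^ \<alpha>) \<and>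
      (\<forall>p. Factorial_Ring.prime p \<and> odd p \<and> p dvd d \<longrightarrow> p dvd n) \<and>
      (if s = 1 then multiplicity 2 (quad_disc d) \<le> \<alpha> else multiplicity 2 (quad_disc d) = \<alpha> + 1))"
    (is "?L \<longleftrightarrow> _ \<and> (\<exists>d s q. ?R d s q)")
proof -
  note K = complex_subfield_Q_adjoin[of "{zeta n}"]
  have n'0: "n' > 0" and n0: "n > 0" using n by (auto elim: oddE)
  have ev: "even n" using n \<alpha> by simp
  have v: "multiplicity 2 n = \<alpha>" unfolding n(1)
    using n(2) by (simp add: multiplicity_eqI dvd_def) 
  define k where "k = 2 ^ (\<alpha> - 1) * n'"
  have a2: "2 * 2 ^ (\<alpha> - 1) = (2 :: nat) ^ \<alpha>" using \<alpha> by (cases \<alpha>) auto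
  have nk: "n = 2 * k" unfolding n(1) k_def a2[symmetric] by simp
  \<comment> \<open>An \<open>n\<close>-th root of the sign \<open>s\<close>.\<close>
  define e where "e = (\<lambda>s :: rat. if s = 1 then 1 else zeta (2 * n))"
  have e: "e s ^ n = of_rat s" "e s \<noteq> 0" if "s = 1 \<or> s = -1" for s
    using that zeta_double_power[OF n0] by (auto simp: e_def of_rat_minus)
  have mem: "e s * csqrt_nat d \<in> cyclotomic n \<longleftrightarrow>
     (\<forall>p. Factorial_Ring.prime p \<and> odd p \<and> p dvd d \<longrightarrow> p dvd n) \<and>
     (if s = 1 then multiplicity 2 (quad_disc d) \<le> \<alpha> else multiplicity 2 (quad_disc d) = \<alpha> + 1)"
    if "squarefree d" for s d
    using csqrt_in_cyclotomic_iff[OF that n0] zeta_double_csqrt_in_cyclotomic_iff[OF that n0 ev]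
    by (simp add: e_def v)
  have pw: "(e s * csqrt_nat d * of_rat t) ^ n = of_rat (s * of_nat d ^ k * t ^ n)"
    if "s = 1 \<or> s = -1" for s t and d :: nat
  proof -
    have "csqrt_nat d ^ n = of_nat d ^ k" unfolding nk power_mult csqrt_nat_square ..
    thus ?thesis using e(1)[OF that] by (simp add: power_mult_distrib of_rat_mult of_rat_power)
  qed
  show ?thesis
  proof
    assume ?L
    then obtain x where x: "g \<noteq> 0" "x \<in> cyclotomic n" "x ^ n = of_rat g"
      by (auto simp: cyclotomic_powers_def)
    obtain q where q: "q > 0" "g ^ 2 = q ^ n"
      using cyclotomic_power_norm_rational[OF n0 x(2,3,1)] by blast
    obtain d t where dt: "squarefree (d :: nat)" "t > 0" "q = of_nat d * t ^ 2"
      using rat_squarefree_decomposition[OF q(1)] .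
    have "g ^ 2 = (q ^ k) ^ 2" using q(2) by (simp add: nk power_mult mult.commute flip: power_mult)
    hence "g = q ^ k \<or> g = - (q ^ k)" by (simp only: power2_eq_iff)
    then obtain s :: rat where s: "s = 1 \<or> s = -1" "g = s * q ^ k" by (metis mult_1 mult_minus1)
    have g: "g = s * of_nat d ^ k * t ^ n" unfolding s(2) dt(3)
      by (simp add: power_mult_distrib nk power_mult)
    obtain j where j: "n' = 2 * j + 1" using n(2) by (elim oddE)
    have sn: "s ^ n' = s" using s(1) n(2) by auto
    have "g = (s * q ^ (2 ^ (\<alpha> - 1))) ^ n'"
      unfolding s(2) power_mult_distrib sn k_def by (simp add: power_mult)
    moreover have "s * q ^ (2 ^ (\<alpha> - 1)) \<noteq> 0" using s(1) q(1) by auto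
    ultimately have gQ: "g \<in> Qstar_pow n'" using Qstar_powI by metis
    have dpos: "(of_nat d :: rat) \<noteq> 0" using squarefree_nat_pos[OF dt(1)] by simp
    have "g = s * of_nat d ^ (2 ^ (\<alpha> - 1)) * (of_nat d ^ j * t ^ n') ^ (2 ^ \<alpha>)"
    proof -
      \<comment> \<open>Since \<open>n'\<close> is odd, its even part \<open>2 * j\<close> only
        contributes a \<open>2 ^ \<alpha>\<close>-th power to \<open>of_nat d ^ k\<close>.\<close>
      have "k = 2 ^ (\<alpha> - 1) + j * 2 ^ \<alpha>" unfolding k_def j a2[symmetric] by (simp add: algebra_simps)
      hence "(of_nat d :: rat) ^ k = of_nat d ^ (2 ^ (\<alpha> - 1)) * (of_nat d ^ j) ^ (2 ^ \<alpha>)"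
        by (simp add: power_add power_mult)
      moreover have "t ^ n = (t ^ n') ^ (2 ^ \<alpha>)" unfolding n(1) by (simp add: power_mult mult.commute flip: power_mult)
      ultimately show ?thesis unfolding g by (simp add: power_mult_distrib)
    qed
    moreover have "of_nat d ^ j * t ^ n' \<noteq> 0" using dpos dt(2) by simp
    moreover have "e s * csqrt_nat d \<in> cyclotomic n"
    proof -
      define w where "w = e s * csqrt_nat d * of_rat t"
      \<comment> \<open>Two \<open>n\<close>-th roots of \<open>g\<close> differ by a root of unity
        in the field, so membership passes from \<open>x\<close> to \<open>w\<close>.\<close>
      have wn: "w ^ n = x ^ n" unfolding w_def pw[OF s(1)] x(3) g ..
      have w0: "w \<noteq> 0" unfolding w_def using e(2)[OF s(1)] squarefree_nat_pos[OF dt(1)] dt(2) by simp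
      have x0: "x \<noteq> 0" using x(1,3) n0 by (auto simp: power_0_left)
      have "(w / x) ^ n = 1" using wn x0 by (simp add: power_divide)
      hence "w / x \<in> cyclotomic n" by (rule root_of_unity_in_cyclotomic) (rule n0)
      hence "w / x * x / of_rat t \<in> cyclotomic n"
        by (rule subfield_divide[OF K subfield_mult[OF K _ x(2)] subfield_of_rat[OF K]])
      thus ?thesis using x0 dt(2) by (simp add: w_def)
    qed
    ultimately have "?R d s (of_nat d ^ j * t ^ n')" using dt(1) s(1) mem[OF dt(1), of s] by blast
    thus "g \<in> Qstar_pow n' \<and> (\<exists>d s q. ?R d s q)" using gQ by blast
  next
    assume R: "g \<in> Qstar_pow n' \<and> (\<exists>d s q. ?R d s q)"
    then obtain d s q where dsq: "squarefree (d :: nat)" "s = 1 \<or> s = -1" "q \<noteq> 0"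
      "g = s * of_nat d ^ (2 ^ (\<alpha> - 1)) * q ^ (2 ^ \<alpha>)" "e s * csqrt_nat d \<in> cyclotomic n"
      using mem by blast
    obtain u where u: "g = u ^ n'" "u \<noteq> 0" using R by (auto simp: Qstar_pow_def)
    have g0: "g \<noteq> 0" using u by simp
    \<comment> \<open>This is a root of \<open>g ^ n'\<close>, while \<open>u\<close> is a root of
      \<open>g ^ (2 ^ \<alpha>)\<close>; as the exponents are coprime, a Bezout combination of the
      two is a root of \<open>g\<close>.\<close>
    define x where "x = e s * csqrt_nat d * of_rat q"
    have x: "x \<in> cyclotomic n" unfolding x_def by (intro subfield_mult[OF K dsq(5)] subfield_of_rat[OF K])
    have sn: "s ^ n' = s" using dsq(2) n(2) by auto
    have "g ^ n' = s * of_nat d ^ k * q ^ n"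
      unfolding dsq(4) power_mult_distrib sn k_def n(1) by (simp add: power_mult)
    hence xn: "x ^ n = of_rat (g ^ n')" unfolding x_def pw[OF dsq(2)] by simp
    have un: "(of_rat u :: complex) ^ n = of_rat (g ^ (2 ^ \<alpha>))"
      unfolding u(1) n(1) by (simp add: of_rat_power power_mult mult.commute flip: power_mult)
    have gc: "gcd (int n') (2 ^ \<alpha>) = 1" using n(2) by (simp flip: coprime_iff_gcd_eq_1)
    obtain i j where ij: "i * int n' + j * 2 ^ \<alpha> = 1"
      using bezout_int[of "int n'" "2 ^ \<alpha>"] unfolding gc by blast
    have G0: "(of_rat g :: complex) \<noteq> 0" using g0 by simp
    have "(x powi i * of_rat u powi j) ^ n = (x ^ n) powi i * (of_rat u ^ n) powi j"
      by (simp add: power_mult_distrib power_int_power power_int_power' mult.commute)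
    also have "\<dots> = of_rat g powi (int n' * i) * of_rat g powi (int (2 ^ \<alpha>) * j)"
      unfolding xn un of_rat_power power_int_power by simp
    also have "\<dots> = of_rat g powi (int n' * i + int (2 ^ \<alpha>) * j)"
      by (rule power_int_add[symmetric]) (use G0 in simp)
    also have "int n' * i + int (2 ^ \<alpha>) * j = 1" using ij by (simp add: mult.commute)
    finally have "(x powi i * of_rat u powi j) ^ n = of_rat g" by simp
    moreover have "x powi i * of_rat u powi j \<in> cyclotomic n"
      by (intro subfield_mult[OF K] subfield_power_int[OF K] x subfield_of_rat[OF K])
    ultimately show ?L using g0 by (intro cyclotomic_powersI)
  qed
qed

subsection \<open>Discriminants of real quadratic fields\<close>

lemma det_mat_2: "Determinant.det (Matrix.mat 2 2 f) = f (0, 0) * f (1, 1) - f (0, 1) * f (1, 0)"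
proof -
  define M where "M = Matrix.mat 2 2 f"
  have M: "M \<in> carrier_mat 2 2" by (simp add: M_def)
  have d: "Determinant.det (mat_delete M 0 j) = mat_delete M 0 j $$ (0, 0)" for j
    by (rule det_single) (simp add: mat_delete_def M_def)
  have "Determinant.det M = (\<Sum>j<2. M $$ (0, j) * cofactor M 0 j)"
    by (rule laplace_expansion_row[OF M]) simp
  also have "\<dots> = M $$ (0, 0) * cofactor M 0 0 + M $$ (0, 1) * cofactor M 0 1"
    by (simp add: numeral_2_eq_2)
  also have "\<dots> = f (0, 0) * f (1, 1) - f (0, 1) * f (1, 0)"
    unfolding cofactor_def d by (simp add: mat_delete_def M_def)
  finally show ?thesis by (simp add: M_def)
qed

lemma embeddings_iff: "f \<in> embeddings K \<longleftrightarrow> hom_on K f \<and> f \<in> extensional K"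
  by (auto simp: embeddings_def Ring.ring_hom_def hom_on_def)

lemma Q_adjoin_1: "Q_adjoin {1} = \<rat>"
  by (intro antisym Q_adjoin_least complex_subfield_Rats Rats_subset_subfield complex_subfield_Q_adjoin) auto

lemma embeddings_Rats: "embeddings \<rat> = {restrict (\<lambda>x. x) \<rat>}"
proof (intro equalityI subsetI)
  fix f assume "f \<in> embeddings \<rat>"
  hence "hom_on \<rat> f" "f \<in> extensional \<rat>" by (auto simp: embeddings_iff)
  thus "f \<in> {restrict (\<lambda>x. x) \<rat>}"
    using hom_on_Rats[OF complex_subfield_Rats] by (auto simp: fun_eq_iff extensional_def)
next
  fix f assume "f \<in> {restrict (\<lambda>x. x) (\<rat> :: complex set)}"
  thus "f \<in> embeddings \<rat>" by (auto simp: embeddings_iff hom_on_def)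
qed

text \<open>Covers \<open>d = 1\<close>, which occurs for the coset of -1. The only integral bases
  are 1 and -1, so the squared determinant is unique.\<close>

lemma field_disc_Rats: "field_disc \<rat> = 1"
  unfolding field_disc_def
proof (rule the_equality)
  define \<sigma> where "\<sigma> = (\<lambda>_ :: nat. restrict (\<lambda>x. x) (\<rat> :: complex set))"
  have "{x \<in> \<rat>. algebraic_int x} = range (\<lambda>c :: nat \<Rightarrow> int. \<Sum>i<1. of_int (c i) * (1 :: complex))"
  proof (intro equalityI subsetI)
    fix x :: complex assume "x \<in> {x \<in> \<rat>. algebraic_int x}"
    hence "x \<in> \<int>" using rational_algebraic_int_is_int by auto
    then obtain k where "x = of_int k" by (elim Ints_cases)
    thus "x \<in> range (\<lambda>c :: nat \<Rightarrow> int. \<Sum>i<1. of_int (c i) * (1 :: complex))"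
      by (intro image_eqI[of _ _ "\<lambda>_. k"]) auto
  qed (auto intro: algebraic_int_of_int_complex)
  hence ib: "integral_basis \<rat> 1 (\<lambda>_. 1)" by (simp add: integral_basis_def)
  have "bij_betw \<sigma> {..<1} (embeddings \<rat>)" by (auto simp: embeddings_Rats bij_betw_def \<sigma>_def lessThan_Suc)
  moreover have "complex_of_int 1 = (Determinant.det (Matrix.mat 1 1 (\<lambda>(i, j). \<sigma> i ((\<lambda>_. 1) j)))) ^ 2"
    by (subst det_single) (auto simp: \<sigma>_def)
  ultimately show "\<exists>n \<omega> \<sigma>. integral_basis \<rat> n \<omega> \<and> bij_betw \<sigma> {..<n} (embeddings \<rat>) \<and>
      complex_of_int 1 = (Determinant.det (Matrix.mat n n (\<lambda>(i, j). \<sigma> i (\<omega> j)))) ^ 2"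
    using ib by blast
next
  fix D assume "\<exists>n \<omega> \<sigma>. integral_basis \<rat> n \<omega> \<and> bij_betw \<sigma> {..<n} (embeddings \<rat>) \<and>
      complex_of_int D = (Determinant.det (Matrix.mat n n (\<lambda>(i, j). \<sigma> i (\<omega> j)))) ^ 2"
  then obtain n \<omega> \<sigma> where *: "integral_basis \<rat> n \<omega>" "bij_betw \<sigma> {..<n} (embeddings \<rat>)"
    "complex_of_int D = (Determinant.det (Matrix.mat n n (\<lambda>(i, j). \<sigma> i (\<omega> j)))) ^ 2" by blast
  have n: "n = 1" using bij_betw_same_card[OF *(2)] by (simp add: embeddings_Rats)
  have eq: "{x \<in> \<rat>. algebraic_int x} = range (\<lambda>c :: nat \<Rightarrow> int. \<Sum>i<n. of_int (c i) * \<omega> i)"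
    using *(1) by (simp add: integral_basis_def)
  have "\<omega> 0 \<in> range (\<lambda>c :: nat \<Rightarrow> int. \<Sum>i<n. of_int (c i) * \<omega> i)"
    by (rule image_eqI[of _ _ "\<lambda>_. 1"]) (simp_all add: n)
  hence w: "\<omega> 0 \<in> \<rat>" "algebraic_int (\<omega> 0)" unfolding eq[symmetric] by auto
  then obtain k where k: "\<omega> 0 = of_int k" using rational_algebraic_int_is_int by (auto elim: Ints_cases)
  have "1 \<in> {x :: complex \<in> \<rat>. algebraic_int x}" by (auto intro: int_imp_algebraic_int)
  then obtain c :: "nat \<Rightarrow> int" where "1 = (\<Sum>i<n. of_int (c i) * \<omega> i)" unfolding eq by blast
  hence "complex_of_int 1 = of_int (c 0 * k)" using n k by simp
  hence "c 0 * k = 1" by (simp only: of_int_eq_iff)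
  hence "k ^ 2 = 1" by (auto simp: zmult_eq_1_iff)
  moreover have "\<sigma> 0 = restrict (\<lambda>x. x) \<rat>" using *(2) n by (auto simp: bij_betw_def embeddings_Rats)
  hence "complex_of_int D = of_int (k ^ 2)" using *(3) w k unfolding n by (subst (asm) det_single) auto
  ultimately show "D = 1" by simp
qed

context
  fixes d :: nat
  assumes d: "squarefree d" "d > 1"
begin

lemma csqrt_nat_irrational: "csqrt_nat d \<notin> \<rat>"
proof
  assume "csqrt_nat d \<in> \<rat>"
  moreover have "algebraic_int (csqrt_nat d)"
    using algebraic_int_sqrt[of "real d"] int_imp_algebraic_int[of "real d"] by (simp add: algebraic_int_of_real_iff)
  ultimately obtain k where k: "csqrt_nat d = of_int k" using rational_algebraic_int_is_int by (auto elim: Ints_cases)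
  have "(of_int (k ^ 2) :: complex) = of_int (int d)" using csqrt_nat_square[of d] unfolding k by simp
  hence "k ^ 2 = int d" by (simp only: of_int_eq_iff)
  hence "nat \<bar>k\<bar> ^ 2 = d" by (metis nat_int nat_power_eq abs_ge_zero power2_abs)
  hence "nat \<bar>k\<bar> dvd 1" using squarefreeD[OF d(1), of "nat \<bar>k\<bar>"] by simp
  thus False using \<open>nat \<bar>k\<bar> ^ 2 = d\<close> d(2) by simp
qed

lemma quadratic_field_conj:
  obtains g where "hom_on (Q_adjoin {csqrt_nat d}) g" "g (csqrt_nat d) = - csqrt_nat d"
    "Q_adjoin {csqrt_nat d} = {of_rat a + of_rat b * csqrt_nat d | a b. True}"
proof -
  note Q = complex_subfield_Rats
  define r where "r = csqrt_nat d"
  have r2: "r ^ 2 = of_nat d" by (simp add: r_def csqrt_nat_square)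
  have alg: "alg_over \<rat> r" by (rule alg_over_root[OF Q, of _ 2]) (auto simp: r2)
  obtain g where g: "hom_on (adjoin_list \<rat> [r]) g" "g r \<noteq> r"
    using hom_moving_exists[OF Q alg, of "[]"] csqrt_nat_irrational by (auto simp: r_def)
  have K: "complex_subfield (adjoin1 \<rat> r)" by (rule complex_subfield_adjoin1[OF Q alg])
  have eq: "Q_adjoin {r} = adjoin1 \<rat> r"
    by (intro antisym Q_adjoin_least adjoin1_least K complex_subfield_Q_adjoin
        Rats_subset_subfield) (auto intro: Q_adjoin_incl adjoin1_mem[OF Q])
  have rK: "r \<in> adjoin1 \<rat> r" by (rule adjoin1_mem[OF Q])
  have g': "hom_on (adjoin1 \<rat> r) g" using g(1) by simp
  have "g r ^ 2 = r ^ 2" using hom_on_power[OF K g' rK, of 2] r2 hom_on_of_nat[OF K g'] by simp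
  hence gr: "g r = - r" using g(2) by (auto simp: power2_eq_iff)
  have "adjoin1 \<rat> r = {of_rat a + of_rat b * r | a b. True}"
  proof (intro equalityI subsetI)
    fix y assume "y \<in> adjoin1 \<rat> r"
    then obtain p where p: "poly_over \<rat> p" "y = poly p r" by (auto simp: adjoin1_def)
    have "poly p r \<in> {of_rat a + of_rat b * r | a b. True}" using p(1)
    proof (induction p)
      case 0
      show ?case by (auto intro: exI[of _ 0])
    next
      case (pCons c p)
      have "c \<in> \<rat>" "poly_over \<rat> p" using pCons.prems(1) unfolding poly_over_def
        by (metis coeff_pCons_0, metis coeff_pCons_Suc)
      then obtain c' a b where "c = of_rat c'" "poly p r = of_rat a + of_rat b * r"
        using pCons.IH by (auto elim: Rats_cases)
      hence "poly (pCons c p) r = of_rat (c' + b * of_nat d) + of_rat a * r"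
        using r2 by (simp add: algebra_simps power2_eq_square of_rat_add of_rat_mult)
      thus ?case by blast
    qed
    thus "y \<in> {of_rat a + of_rat b * r | a b. True}" using p by simp
  next
    fix y assume "y \<in> {of_rat a + of_rat b * r | a b. True}"
    thus "y \<in> adjoin1 \<rat> r"
      by (auto intro!: subfield_add[OF K] subfield_mult[OF K] subfield_of_rat[OF K] rK)
  qed
  thus ?thesis using that[of g] g' gr eq by (simp add: r_def)
qed

text \<open>The conjugate is also integral, so trace \<open>2 * a\<close> and norm are integers;
  four times the norm is the number divided by 4.\<close>

lemma quadratic_algebraic_int:
  assumes x: "algebraic_int (of_rat a + of_rat b * csqrt_nat d)"
  obtains A B :: int where "of_rat a = (of_int A / 2 :: complex)" "of_rat b = (of_int B / 2 :: complex)"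
    "4 dvd A ^ 2 - int d * B ^ 2"
proof -
  define r where "r = csqrt_nat d"
  have r2: "r * r = of_nat d" using csqrt_nat_square[of d] by (simp add: r_def power2_eq_square)
  obtain g where g: "hom_on (Q_adjoin {r}) g" "g r = - r"
    "Q_adjoin {r} = {of_rat a + of_rat b * r | a b. True}" using quadratic_field_conj unfolding r_def by blast
  define y where "y = of_rat a + of_rat b * r"
  define y' where "y' = of_rat a - of_rat b * r"
  note K = complex_subfield_Q_adjoin[of "{r}"]
  have rK: "r \<in> Q_adjoin {r}" by (rule Q_adjoin_incl) simp
  have yK: "y \<in> Q_adjoin {r}" unfolding y_def g(3) by blast
  have gy: "g y = y'" unfolding y_def y'_def
    by (simp add: hom_on_add[OF K g(1)] hom_on_mult[OF K g(1)] subfield_of_rat[OF K] subfield_mult[OF K] rK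
        hom_on_of_rat[OF K g(1)] g(2))
  have ay: "algebraic_int y" using x by (simp add: y_def r_def)
  obtain p :: "int poly" where p: "poly (map_poly of_int p) y = 0" "lead_coeff p = 1"
    using ay by (auto simp: algebraic_int_altdef_ipoly)
  have "poly (map_poly of_int p) y' = g (poly (map_poly of_int p) y)"
    using hom_on_poly_Rats[OF K g(1) poly_over_map_of_int[OF complex_subfield_Rats] yK] gy by simp
  hence ay': "algebraic_int y'" using p hom_on_0[OF K g(1)] by (auto simp: algebraic_int_altdef_ipoly)
  have "y + y' \<in> \<int>"
    by (rule rational_algebraic_int_is_int[OF algebraic_int_add_complex[OF ay ay']])
       (simp add: y_def y'_def)
  then obtain A where A: "y + y' = of_int A" by (elim Ints_cases)
  have yy: "y * y' = of_rat (a ^ 2 - of_nat d * b ^ 2)"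
    unfolding y_def y'_def using r2 by (simp add: algebra_simps power2_eq_square of_rat_diff of_rat_mult)
  have "y * y' \<in> \<int>"
    by (rule rational_algebraic_int_is_int[OF algebraic_int_mult_complex[OF ay ay']]) (simp add: yy)
  then obtain N where N: "y * y' = of_int N" by (elim Ints_cases)
  have a: "of_rat a = (of_int A / 2 :: complex)" 
  proof -
    have "2 * of_rat a = (of_int A :: complex)" using A by (simp add: y_def y'_def)
    thus ?thesis by (metis nonzero_mult_div_cancel_left zero_neq_numeral)
  qed
  hence "(of_rat a :: complex) = of_rat (of_int A / 2)" by (simp add: of_rat_divide)
  hence aq: "a = of_int A / 2" by (simp only: of_rat_eq_iff)
  have "(of_rat (a ^ 2 - of_nat d * b ^ 2) :: complex) = of_rat (of_int N)" using N yy by simp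
  hence Nq: "a ^ 2 - of_nat d * b ^ 2 = of_int N" by (simp only: of_rat_eq_iff)
  \<comment> \<open>In lowest terms, clearing denominators in the norm equation gives
    \<open>q ^ 2 dvd int d\<close>, and squarefreeness forces \<open>q = 1\<close>.\<close>
  obtain p q where pq: "quotient_of (2 * b) = (p, q)" by (cases "quotient_of (2 * b)")
  have q: "q > 0" "Rings.coprime p q" "2 * b = of_int p / of_int q"
    using quotient_of_denom_pos[OF pq] quotient_of_coprime[OF pq] quotient_of_div[OF pq] by auto
  have "of_nat d * (2 * b) ^ 2 = of_int (A ^ 2 - 4 * N)"
    using Nq unfolding aq by (simp add: power_divide power_mult_distrib field_simps)
  hence "of_nat d * of_int p ^ 2 = of_int (A ^ 2 - 4 * N) * (of_int q ^ 2 :: rat)"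
    unfolding q(3) using q(1) by (simp add: power_divide field_simps)
  hence "(of_int (int d * p ^ 2) :: rat) = of_int ((A ^ 2 - 4 * N) * q ^ 2)" by simp
  hence eq: "int d * p ^ 2 = (A ^ 2 - 4 * N) * q ^ 2" by (simp only: of_int_eq_iff)
  hence "q ^ 2 dvd int d * p ^ 2" by simp
  moreover have "Rings.coprime (q ^ 2) (p ^ 2)" using q(2) by (simp add: coprime_commute)
  ultimately have "q ^ 2 dvd int d" by (simp add: coprime_dvd_mult_left_iff)
  hence "nat q ^ 2 dvd d" using q(1) by (metis int_dvd_int_iff int_nat_eq less_imp_le of_nat_power)
  hence "nat q dvd 1" using d(1) squarefreeD by blast
  hence q1: "q = 1" using q(1) by simp
  hence b: "2 * b = of_int p" using q(3) by simp
  have "(of_rat (2 * b) :: complex) = of_int p" unfolding b by simp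
  hence "2 * of_rat b = (of_int p :: complex)" by (simp add: of_rat_mult)
  hence "of_rat b = (of_int p / 2 :: complex)" by (metis nonzero_mult_div_cancel_left zero_neq_numeral)
  moreover have "4 dvd A ^ 2 - int d * p ^ 2" using eq q1 by simp
  ultimately show ?thesis using that a by blast
qed

text \<open>Besides computing the value on one basis, uniqueness is required for \<open>THE\<close>:
  swapping the embeddings only changes the sign of the determinant, and two integral bases differ by
  an integer factor that is a unit.\<close>

lemma field_disc_quadratic: "field_disc (Q_adjoin {csqrt_nat d}) = int (quad_disc d)"
proof -
  define r where "r = csqrt_nat d"
  define K where "K = Q_adjoin {r}"
  have r2: "r * r = of_nat d" using csqrt_nat_square[of d] by (simp add: r_def power2_eq_square)
  have r0: "r \<noteq> 0" using r2 d(2) by auto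
  obtain g where g: "hom_on K g" "g r = - r" "K = {of_rat a + of_rat b * r | a b. True}"
    using quadratic_field_conj unfolding r_def K_def by blast
  have K: "complex_subfield K" unfolding K_def by (rule complex_subfield_Q_adjoin)
  have rK: "r \<in> K" unfolding K_def by (rule Q_adjoin_incl) simp
  have hom_eval: "f (of_rat a + of_rat b * r) = of_rat a + of_rat b * f r" if "hom_on K f" for f a b
    by (simp add: hom_on_add[OF K that] hom_on_mult[OF K that] subfield_of_rat[OF K] subfield_mult[OF K] rK
        hom_on_of_rat[OF K that])
  define e1 e2 where "e1 = restrict (\<lambda>x. x) K" and "e2 = restrict g K"
  have homr: "hom_on K (restrict f K)" if "hom_on K f" for f
    using that K by (auto simp: hom_on_def complex_subfield_def)
  have emb: "embeddings K = {e1, e2}"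
  proof (intro equalityI subsetI)
    fix f assume "f \<in> embeddings K"
    hence f: "hom_on K f" "f \<in> extensional K" by (auto simp: embeddings_iff)
    have "f r * f r = r * r" using hom_on_mult[OF K f(1) rK rK] r2 hom_on_of_nat[OF K f(1)] by simp
    hence "f r = r \<or> f r = - r" by (simp add: square_eq_iff)
    thus "f \<in> {e1, e2}"
    proof
      assume "f r = r"
      hence "f x = e1 x" for x
        using hom_eval[OF f(1)] f(2) g(3) by (cases "x \<in> K") (auto simp: e1_def extensional_def)
      thus ?thesis by blast
    next
      assume "f r = - r"
      hence "f x = e2 x" for x
        using hom_eval[OF f(1)] hom_eval[OF g(1)] f(2) g(2,3) by (cases "x \<in> K") (auto simp: e2_def extensional_def)
      thus ?thesis by blast
    qed
  next
    fix f assume "f \<in> {e1, e2}"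
    thus "f \<in> embeddings K" using homr[OF g(1)] homr[OF hom_on_id] by (auto simp: embeddings_iff e1_def e2_def)
  qed
  have e12: "e1 \<noteq> e2"
  proof
    assume "e1 = e2"
    hence "e1 r = e2 r" by simp
    hence "r = - r" using rK g(2) by (simp add: e1_def e2_def)
    thus False using complex_eq_neg_self r0 by blast
  qed
  \<comment> \<open>The determinant with the identity and the conjugation \<open>g\<close> as its
    two rows.\<close>
  define \<Delta> where "\<Delta> = (\<lambda>x y. x * g y - y * g x)"
  have det2: "(Determinant.det (Matrix.mat 2 2 (\<lambda>(i, j). \<sigma> i (\<omega> j)))) ^ 2 = \<Delta> (\<omega> 0) (\<omega> 1) ^ 2"
    if s: "bij_betw \<sigma> {..<2 :: nat} {e1, e2}" and w: "\<omega> 0 \<in> K" "\<omega> (1 :: nat) \<in> K" for \<sigma> \<omega>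
  proof -
    have "\<sigma> 0 \<in> {e1, e2}" "\<sigma> 1 \<in> {e1, e2}" using s by (auto simp: bij_betw_def)
    moreover have "\<sigma> 0 \<noteq> \<sigma> 1"
      using inj_on_eq_iff[of \<sigma> "{..<2}" 0 1] s by (simp add: bij_betw_def)
    ultimately have "(\<sigma> 0 = e1 \<and> \<sigma> 1 = e2) \<or> (\<sigma> 0 = e2 \<and> \<sigma> 1 = e1)" by auto
    thus ?thesis
      using w by (auto simp: det_mat_2 \<Delta>_def e1_def e2_def power2_eq_square algebra_simps)
  qed
  define \<omega> where "\<omega> = (\<lambda>i :: nat. if i = 0 then 1 else if d mod 4 = 1 then (1 + r) / 2 else r)"
  have w: "\<omega> 0 = 1" "\<omega> (Suc 0) = (if d mod 4 = 1 then (1 + r) / 2 else r)" by (auto simp: \<omega>_def)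
  have wK: "\<omega> 0 \<in> K" "\<omega> 1 \<in> K"
    using subfield_divide[OF K subfield_add[OF K subfield_1[OF K] rK] subfield_of_nat[OF K, of 2]] rK subfield_1[OF K]
    by (auto simp: w)
  have wint: "algebraic_int (\<omega> 1)"
  proof (cases "d mod 4 = 1")
    case True
    then obtain k where k: "d = 4 * k + 1" by (metis mult_div_mod_eq)
    have "poly [:- of_nat k, -1, 1:] ((1 + r) / 2) = 0" using r2 by (simp add: k field_simps)
    hence "algebraic_int ((1 + r) / 2)"
      by (intro algebraic_int.intros[of "[:- of_nat k, -1, 1:]"]) (auto simp: coeff_pCons split: nat.splits)
    thus ?thesis using True by (simp add: w)
  next
    case False
    have "algebraic_int r" unfolding r_def
      using algebraic_int_sqrt[of "real d"] int_imp_algebraic_int[of "real d"] by (simp add: algebraic_int_of_real_iff)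
    thus ?thesis using False by (simp add: w)
  qed
  have span: "range (\<lambda>c :: nat \<Rightarrow> int. \<Sum>i<2. of_int (c i) * \<omega> i) = {of_int u + of_int v * \<omega> 1 | u v. True}"
  proof (intro equalityI subsetI)
    fix x assume "x \<in> {of_int u + of_int v * \<omega> 1 | u v. True}"
    then obtain u v where "x = of_int u + of_int v * \<omega> 1" by blast
    thus "x \<in> range (\<lambda>c :: nat \<Rightarrow> int. \<Sum>i<2. of_int (c i) * \<omega> i)"
      by (intro image_eqI[of _ _ "\<lambda>i. if i = 0 then u else v"]) (auto simp: numeral_2_eq_2 w(1))
  qed (auto simp: numeral_2_eq_2 w(1))
  have indep: "u = 0 \<and> v = 0" if "of_int u + of_int v * \<omega> 1 = 0" for u v :: int
  proof -
    have "v = 0"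
    proof (rule ccontr)
      assume v: "v \<noteq> 0"
      have "of_int v * \<omega> 1 = - of_int u" using that by (metis add.commute eq_neg_iff_add_eq_0)
      hence "\<omega> 1 = - of_int u / of_int v" using v by (metis nonzero_mult_div_cancel_left of_int_eq_0_iff)
      hence wr: "\<omega> 1 \<in> \<rat>" by simp
      have "r \<in> \<rat>"
      proof (cases "d mod 4 = 1")
        case True
        hence "r = 2 * \<omega> 1 - 1" by (simp add: w)
        thus ?thesis using wr by simp
      qed (use wr in \<open>simp add: w\<close>)
      thus False using csqrt_nat_irrational by (simp add: r_def)
    qed
    thus ?thesis using that by simp
  qed
  have ib: "integral_basis K 2 \<omega>" unfolding integral_basis_def
  proof (intro conjI allI impI)
    show "{x \<in> K. algebraic_int x} = range (\<lambda>c :: nat \<Rightarrow> int. \<Sum>i<2. of_int (c i) * \<omega> i)"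
      unfolding span
    proof (intro equalityI subsetI)
      fix x assume "x \<in> {of_int u + of_int v * \<omega> 1 | u v. True}"
      then obtain u v where "x = of_int u + of_int v * \<omega> 1" by blast
      thus "x \<in> {x \<in> K. algebraic_int x}"
        by (auto intro!: subfield_add[OF K] subfield_mult[OF K] subfield_of_int[OF K] wK algebraic_int_add_complex
            algebraic_int_mult_complex algebraic_int_of_int_complex wint simp del: One_nat_def)
    next
      fix x assume x: "x \<in> {x \<in> K. algebraic_int x}"
      then obtain a b where ab: "x = of_rat a + of_rat b * r" using g(3) by auto
      obtain A B :: int where AB: "of_rat a = (of_int A / 2 :: complex)" "of_rat b = (of_int B / 2 :: complex)"
        "4 dvd A ^ 2 - int d * B ^ 2" using quadratic_algebraic_int[of a b] x ab by (auto simp: r_def)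
      have xx: "x = (of_int A + of_int B * r) / 2" unfolding ab AB by (simp add: field_simps)
      \<comment> \<open>Squares modulo 4 show parity, so this relation forces \<open>A\<close> and
        \<open>B\<close> to have equal parity if \<open>d mod 4 = 1\<close> and to be even
        otherwise, which matches the chosen basis.\<close>
      have m4: "(A ^ 2) mod 4 = ((int d mod 4) * (B ^ 2 mod 4)) mod 4"
        using AB(3) by (simp add: mod_eq_dvd_iff mod_mult_eq)
      have sq: "(C ^ 2) mod 4 = (if even C then 0 else 1)" for C :: int
      proof (cases "even C")
        case True
        then obtain k where "C = 2 * k" by blast
        thus ?thesis by (simp add: power2_eq_square)
      next
        case False
        then obtain k where "C = 2 * k + 1" by (elim oddE)
        hence "C ^ 2 = 4 * (k * k + k) + 1" by (simp add: power2_eq_square algebra_simps)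
        thus ?thesis using False by presburger
      qed
      have "\<not> 4 dvd d"
      proof
        assume "4 dvd d"
        hence "2 ^ 2 dvd d" by simp
        hence "(2 :: nat) dvd 1" using d(1) squarefreeD by blast
        thus False by simp
      qed
      hence d4: "d mod 4 = 1 \<or> d mod 4 = 2 \<or> d mod 4 = 3" by presburger
      hence d4': "int d mod 4 = 1 \<and> d mod 4 = 1 \<or> int d mod 4 = 2 \<and> d mod 4 = 2 \<or> int d mod 4 = 3 \<and> d mod 4 = 3"
        by presburger
      show "x \<in> {of_int u + of_int v * \<omega> 1 | u v. True}"
      proof (cases "d mod 4 = 1")
        case True
        hence "even A \<longleftrightarrow> even B" using m4 d4' unfolding sq by (auto split: if_splits)
        hence "even (A - B)" by simp
        then obtain k' where "A - B = 2 * k'" by (elim evenE)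
        then obtain k where k: "A = B + 2 * k" by (intro that[of k']) simp
        have "x = of_int k + of_int B * \<omega> 1" unfolding xx k using True by (simp add: w field_simps)
        thus ?thesis by blast
      next
        case False
        hence "even A \<and> even B" using m4 d4' unfolding sq by (auto split: if_splits)
        then obtain k l where k: "A = 2 * k" "B = 2 * l" by blast
        have "x = of_int k + of_int l * \<omega> 1" unfolding xx k using False by (simp add: w field_simps)
        thus ?thesis by blast
      qed
    qed
    fix c :: "nat \<Rightarrow> int" and i :: nat assume "(\<Sum>i<2. of_int (c i) * \<omega> i) = 0" "i < 2"
    moreover from this have "of_int (c 0) + of_int (c 1) * \<omega> 1 = 0" by (simp add: numeral_2_eq_2 w(1))
    ultimately show "c i = 0" using indep[of "c 0" "c 1"] by (auto simp: less_2_cases_iff)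
  qed
  have \<Delta>w: "\<Delta> (\<omega> 0) (\<omega> 1) ^ 2 = of_int (int (quad_disc d))"
  proof (cases "d mod 4 = 1")
    case True
    have "g ((1 + r) / 2) = (1 - r) / 2"
      using hom_eval[OF g(1), of "1 / 2" "1 / 2"] g(2) by (simp add: of_rat_divide add_divide_distrib diff_divide_distrib)
    moreover have "\<Delta> (\<omega> 0) (\<omega> 1) = g ((1 + r) / 2) - (1 + r) / 2"
      using True hom_on_1[OF K g(1)] by (simp add: \<Delta>_def w)
    ultimately have "\<Delta> (\<omega> 0) (\<omega> 1) = (1 - r) / 2 - (1 + r) / 2" by simp
    hence "\<Delta> (\<omega> 0) (\<omega> 1) = - r" by (simp add: field_simps)
    thus ?thesis using r2 True by (simp add: power2_eq_square quad_disc_def)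
  next
    case False
    hence "\<Delta> (\<omega> 0) (\<omega> 1) = - 2 * r" using g(2) hom_on_1[OF K g(1)] by (simp add: \<Delta>_def w)
    thus ?thesis using r2 False by (simp add: power2_eq_square quad_disc_def)
  qed
  have \<Delta>0: "\<Delta> (\<omega> 0) (\<omega> 1) \<noteq> 0"
  proof
    assume "\<Delta> (\<omega> 0) (\<omega> 1) = 0"
    hence "quad_disc d = 0" using \<Delta>w by simp
    thus False using d(2) by (simp add: quad_disc_def split: if_splits)
  qed
  have mem: "\<phi> i \<in> {x \<in> K. algebraic_int x}" if "integral_basis K 2 \<phi>" "i < 2" for \<phi> i
  proof -
    have i: "i = 0 \<or> i = 1" using that(2) by auto
    have "\<phi> i \<in> range (\<lambda>c :: nat \<Rightarrow> int. \<Sum>j<2. of_int (c j) * \<phi> j)"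
      by (rule image_eqI[of _ _ "\<lambda>j. if j = i then 1 else 0"])
         (use i in \<open>auto simp: numeral_2_eq_2\<close>)
    thus ?thesis using that(1) unfolding integral_basis_def by blast
  qed
  have change: "\<exists>k :: int. \<Delta> (\<eta> 0) (\<eta> 1) = of_int k * \<Delta> (\<theta> 0) (\<theta> 1)"
    if "integral_basis K 2 \<theta>" "integral_basis K 2 \<eta>" for \<theta> \<eta>
  proof -
    have ex: "\<exists>u v :: int. \<eta> i = of_int u * \<theta> 0 + of_int v * \<theta> 1" if "i < 2" for i
    proof -
      have "\<eta> i \<in> range (\<lambda>c :: nat \<Rightarrow> int. \<Sum>j<2. of_int (c j) * \<theta> j)"
        using mem[OF \<open>integral_basis K 2 \<eta>\<close> that] \<open>integral_basis K 2 \<theta>\<close> unfolding integral_basis_def by blast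
      thus ?thesis by (auto simp: numeral_2_eq_2)
    qed
    obtain u v where uv: "\<eta> 0 = of_int u * \<theta> 0 + of_int v * \<theta> 1" using ex[of 0] by auto
    obtain u' v' where uv': "\<eta> 1 = of_int u' * \<theta> 0 + of_int v' * \<theta> 1" using ex[of 1] by auto
    have tK: "\<theta> 0 \<in> K" "\<theta> 1 \<in> K" using mem[OF \<open>integral_basis K 2 \<theta>\<close>] by auto
    have gl: "g (of_int u * \<theta> 0 + of_int v * \<theta> 1) = of_int u * g (\<theta> 0) + of_int v * g (\<theta> 1)" for u v
      using tK by (simp add: hom_on_add[OF K g(1)] hom_on_mult[OF K g(1)] subfield_mult[OF K] subfield_of_int[OF K]
          hom_on_of_int[OF K g(1)])
    have "\<Delta> (\<eta> 0) (\<eta> 1) = of_int (u * v' - v * u') * \<Delta> (\<theta> 0) (\<theta> 1)"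
      unfolding \<Delta>_def uv uv' gl by (simp add: algebra_simps)
    thus ?thesis by blast
  qed
  have "field_disc K = int (quad_disc d)" unfolding field_disc_def
  proof (rule the_equality)
    define \<sigma> where "\<sigma> = (\<lambda>i :: nat. if i = 0 then e1 else e2)"
    have "{..<2 :: nat} = {0, 1}" by auto
    hence s: "bij_betw \<sigma> {..<2} {e1, e2}" using e12 by (auto simp: bij_betw_def \<sigma>_def)
    show "\<exists>n \<omega> \<sigma>. integral_basis K n \<omega> \<and> bij_betw \<sigma> {..<n} (embeddings K) \<and>
      complex_of_int (int (quad_disc d)) = (Determinant.det (Matrix.mat n n (\<lambda>(i, j). \<sigma> i (\<omega> j)))) ^ 2"
      using ib s det2[of \<sigma> \<omega>, OF s wK] \<Delta>w emb
      by (intro exI[of _ 2] exI[of _ \<omega>] exI[of _ \<sigma>]) simp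
  next
    fix D assume "\<exists>n \<omega> \<sigma>. integral_basis K n \<omega> \<and> bij_betw \<sigma> {..<n} (embeddings K) \<and>
      complex_of_int D = (Determinant.det (Matrix.mat n n (\<lambda>(i, j). \<sigma> i (\<omega> j)))) ^ 2"
    then obtain n \<theta> \<sigma> where *: "integral_basis K n \<theta>" "bij_betw \<sigma> {..<n} (embeddings K)"
      "complex_of_int D = (Determinant.det (Matrix.mat n n (\<lambda>(i, j). \<sigma> i (\<theta> j)))) ^ 2" by blast
    have n: "n = 2" using bij_betw_same_card[OF *(2)] e12 by (simp add: emb)
    have ib': "integral_basis K 2 \<theta>" using *(1) n by simp
    have tK: "\<theta> 0 \<in> K" "\<theta> 1 \<in> K" using mem[OF ib'] by auto
    obtain k k' :: int where k: "\<Delta> (\<theta> 0) (\<theta> 1) = of_int k * \<Delta> (\<omega> 0) (\<omega> 1)"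
      "\<Delta> (\<omega> 0) (\<omega> 1) = of_int k' * \<Delta> (\<theta> 0) (\<theta> 1)" using change[OF ib ib'] change[OF ib' ib] by blast
    have "1 * \<Delta> (\<omega> 0) (\<omega> 1) = of_int (k' * k) * \<Delta> (\<omega> 0) (\<omega> 1)" using k by (metis mult.assoc mult_1 of_int_mult)
    hence "complex_of_int 1 = of_int (k' * k)" using \<Delta>0 by (metis mult_right_cancel of_int_1)
    hence "k' * k = 1" by (simp only: of_int_eq_iff)
    hence k2: "k ^ 2 = 1" by (auto simp: zmult_eq_1_iff)
    have "complex_of_int D = \<Delta> (\<theta> 0) (\<theta> 1) ^ 2"
      using *(2,3) unfolding n emb using det2[of \<sigma> \<theta>] tK by simp
    also have "\<dots> = of_int (k ^ 2) * \<Delta> (\<omega> 0) (\<omega> 1) ^ 2" unfolding k(1) by (simp add: power_mult_distrib)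
    also have "\<dots> = of_int (int (quad_disc d))" unfolding k2 \<Delta>w by simp
    finally show "D = int (quad_disc d)" by (simp only: of_int_eq_iff)
  qed
  thus ?thesis by (simp add: K_def r_def)
qed

end

lemma field_disc_csqrt: "squarefree d \<Longrightarrow> field_disc (Q_adjoin {csqrt_nat d}) = int (quad_disc d)"
proof (cases "d = 1")
  case True
  thus ?thesis using field_disc_Rats Q_adjoin_1 by (simp add: quad_disc_def)
next
  case False
  assume "squarefree d"
  thus ?thesis using False squarefree_nat_pos[of d] by (intro field_disc_quadratic) auto
qed

subsection \<open>Representatives of 2-torsion cosets\<close>

text \<open>Writing \<open>x\<close> in lowest terms, its numerator to the power \<open>D\<close>
  divides \<open>n\<close> and its denominator to the power \<open>D\<close> divides
  \<open>n'\<close>. This gives uniqueness of coset representatives up to sign.\<close>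

lemma power_free_quotient_unit:
  assumes n: "power_free D n" "power_free D n'" and x: "of_int n = of_int n' * (x :: rat) ^ D"
  shows "\<bar>x\<bar> = 1"
proof -
  have n0: "n \<noteq> 0" "n' \<noteq> 0" using n by (auto simp: power_free_def)
  obtain u v where uv: "quotient_of x = (u, v)" by (cases "quotient_of x")
  have v: "v > 0" "Rings.coprime u v" "x = of_int u / of_int v"
    using quotient_of_denom_pos[OF uv] quotient_of_coprime[OF uv] quotient_of_div[OF uv] by auto
  have "(of_int (n * v ^ D) :: rat) = of_int (n' * u ^ D)"
    using x v by (simp add: power_divide field_simps)
  hence eq: "n * v ^ D = n' * u ^ D" by (simp only: of_int_eq_iff)
  have co: "Rings.coprime (u ^ D) (v ^ D)" using v(2) by simp
  have "u ^ D dvd n" using eq co by (metis coprime_dvd_mult_left_iff dvd_triv_right)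
  moreover have "v ^ D dvd n'" using eq co by (metis coprime_commute coprime_dvd_mult_left_iff dvd_triv_right)
  moreover have unit: "\<bar>w\<bar> = 1" if "w ^ D dvd m" "power_free D m" for w m :: int
  proof (rule ccontr)
    assume w: "\<bar>w\<bar> \<noteq> 1"
    obtain p where p: "Factorial_Ring.prime p" "p dvd w"
      using prime_factor_int[OF w] by blast
    have "p ^ D dvd w ^ D" using p(2) by (rule dvd_power_same)
    hence "p ^ D dvd m" using that(1) by (rule dvd_trans)
    thus False using that(2) p(1) by (auto simp: power_free_def)
  qed
  ultimately have "\<bar>u\<bar> = 1" "\<bar>v\<bar> = 1" using n by blast+
  thus ?thesis using v by (simp add: abs_divide flip: of_int_abs)
qed

lemma power_free_squarefree_power:
  assumes d: "squarefree (d :: nat)" and k: "k > 0" and s: "s = 1 \<or> s = (- 1 :: int)"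
  shows "power_free (2 * k) (s * int d ^ k)"
  unfolding power_free_def
proof (intro conjI allI impI notI)
  have "d > 0" by (rule squarefree_nat_pos[OF d])
  thus "s * int d ^ k = 0 \<Longrightarrow> False" using s by auto
  fix p :: int assume p: "Factorial_Ring.prime p" "p ^ (2 * k) dvd s * int d ^ k"
  have p0: "p > 1" using prime_gt_1_int[OF p(1)] .
  have "(p ^ 2) ^ k dvd int d ^ k" using p(2) s by (auto simp: power_mult)
  hence "p ^ 2 dvd int d" using k by (simp add: pow_divides_pow_iff)
  hence "int (nat p ^ 2) dvd int d" using p0 by simp
  hence "nat p ^ 2 dvd d" by (simp only: int_dvd_int_iff)
  hence "nat p dvd 1" by (rule squarefreeD[OF d])
  thus False using p0 by simp
qed

context
  fixes \<alpha> d :: nat and s :: rat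
  assumes d: "squarefree d" and \<alpha>: "\<alpha> > 0" and s: "s = 1 \<or> s = - 1"
begin

lemma half_power_2: "(2 :: nat) ^ \<alpha> = 2 * 2 ^ (\<alpha> - 1)" "(2 :: nat) ^ \<alpha> div 2 = 2 ^ (\<alpha> - 1)"
  using \<alpha> by (cases \<alpha>; simp)+

lemma pos_coset_pcls:
  "pos_coset (2 ^ \<alpha>) (pcls (2 ^ \<alpha>) (s * of_nat d ^ 2 ^ (\<alpha> - 1))) \<longleftrightarrow> s = 1"
proof -
  have d0: "d > 0" by (rule squarefree_nat_pos[OF d])
  have ev: "even ((2 :: nat) ^ \<alpha>)" using \<alpha> by simp
  have "x * (s * of_nat d ^ 2 ^ (\<alpha> - 1)) > 0 \<longleftrightarrow> s = 1" if x: "x \<in> Qstar_pow (2 ^ \<alpha>)" for x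
  proof -
    have "x > 0" using x ev by (auto simp: Qstar_pow_def zero_less_power_eq)
    thus ?thesis using s d0 by (auto simp: zero_less_mult_iff)
  qed
  moreover have "1 \<in> Qstar_pow (2 ^ \<alpha>)" by (rule subgroup_Qstar_1[OF subgroup_Qstar_pow])
  ultimately show ?thesis using ev unfolding pos_coset_def qcoset_def' by blast
qed

text \<open>Two power-free representatives differ by \<open>x ^ D\<close> with \<open>x\<close>
  equal to 1 or -1; as \<open>D\<close> is even, this factor is 1 and the representative is
  unique.\<close>

lemma coset_rep_pcls:
  "coset_rep (2 ^ \<alpha>) (pcls (2 ^ \<alpha>) (s * of_nat d ^ 2 ^ (\<alpha> - 1))) = (if s = 1 then 1 else - 1) * int d ^ 2 ^ (\<alpha> - 1)"
proof -
  define k where "k = (2 :: nat) ^ (\<alpha> - 1)"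
  define D where "D = (2 :: nat) ^ \<alpha>"
  define t :: int where "t = (if s = 1 then 1 else - 1)"
  define n where "n = t * int d ^ k"
  have d0: "d > 0" by (rule squarefree_nat_pos[OF d])
  have D: "D = 2 * k" using half_power_2 by (simp add: D_def k_def)
  have ts: "of_int t = s" using s by (auto simp: t_def)
  have nq: "of_int n = s * of_nat d ^ k" by (simp add: n_def ts)
  have pf: "power_free D n" unfolding D n_def
    by (rule power_free_squarefree_power[OF d]) (auto simp: k_def t_def)
  have pos: "pos_coset D (pcls D (s * of_nat d ^ k)) \<longleftrightarrow> s = 1"
    using pos_coset_pcls by (simp add: D_def k_def)
  have npos: "0 < n \<longleftrightarrow> s = 1" using d0 s by (auto simp: n_def t_def)
  have "coset_rep D (pcls D (s * of_nat d ^ k)) = n" unfolding coset_rep_def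
  proof (rule the_equality)
    show "power_free D n \<and> pcls D (s * of_nat d ^ k) = pcls D (of_int n) \<and>
       (0 < n \<longleftrightarrow> pos_coset D (pcls D (s * of_nat d ^ k)))"
      using pf pos npos nq by simp
  next
    fix m assume m: "power_free D m \<and> pcls D (s * of_nat d ^ k) = pcls D (of_int m) \<and>
       (0 < m \<longleftrightarrow> pos_coset D (pcls D (s * of_nat d ^ k)))"
    have m0: "m \<noteq> 0" "n \<noteq> 0" using m pf by (auto simp: power_free_def)
    have "pcls D (of_int m) = pcls D (of_int n)" using m nq by simp
    hence "of_int m / of_int n \<in> Qstar_pow D" using m0 by (simp add: pcls_eq_iff)
    then obtain x :: rat where x: "of_int m / of_int n = x ^ D" by (auto simp: Qstar_pow_def)
    hence x': "(of_int m :: rat) = of_int n * x ^ D" using m0 by (simp add: field_simps)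
    have "\<bar>x\<bar> = 1" using power_free_quotient_unit[OF _ pf x'] m by blast
    hence "x ^ D = 1" unfolding D power_mult by (metis power2_abs power_one)
    hence "(of_int m :: rat) = of_int n" using x' by simp
    thus "m = n" by simp
  qed
  thus ?thesis by (simp add: D_def k_def n_def t_def)
qed

lemma sqfree_root_pcls: "sqfree_root (2 ^ \<alpha>) (pcls (2 ^ \<alpha>) (s * of_nat d ^ 2 ^ (\<alpha> - 1))) = d"
  unfolding sqfree_root_def coset_rep_pcls half_power_2(2)
proof (rule the_equality)
  show "squarefree d \<and> ((if s = 1 then 1 else - 1) * int d ^ 2 ^ (\<alpha> - 1) = int d ^ 2 ^ (\<alpha> - 1) \<or>
     (if s = 1 then 1 else - 1) * int d ^ 2 ^ (\<alpha> - 1) = - (int d ^ 2 ^ (\<alpha> - 1)))"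
    using d by auto
  fix e assume e: "squarefree e \<and> ((if s = 1 then 1 else - 1) * int d ^ 2 ^ (\<alpha> - 1) = int e ^ 2 ^ (\<alpha> - 1) \<or>
     (if s = 1 then 1 else - 1) * int d ^ 2 ^ (\<alpha> - 1) = - (int e ^ 2 ^ (\<alpha> - 1)))"
  have "\<bar>(if s = 1 then 1 else - 1) * int d ^ 2 ^ (\<alpha> - 1)\<bar> = int d ^ 2 ^ (\<alpha> - 1)" by simp
  hence "int d ^ 2 ^ (\<alpha> - 1) = \<bar>int e ^ 2 ^ (\<alpha> - 1)\<bar>" using e by (metis abs_minus_cancel)
  hence "int d ^ 2 ^ (\<alpha> - 1) = int e ^ 2 ^ (\<alpha> - 1)" by simp
  hence "int d = int e" by (subst (asm) power_eq_iff_eq_base) auto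
  thus "e = d" by simp
qed

lemma delta_pcls: "delta (2 ^ \<alpha>) (pcls (2 ^ \<alpha>) (s * of_nat d ^ 2 ^ (\<alpha> - 1))) = int (quad_disc d)"
proof (cases "pcls (2 ^ \<alpha>) (s * of_nat d ^ 2 ^ (\<alpha> - 1)) = Qstar_pow (2 ^ \<alpha>)")
  \<comment> \<open>On the trivial coset \<open>delta\<close> is 1 by convention. It agrees with the
    general formula, because uniqueness of power-free representatives forces
    \<open>d = 1\<close>.\<close>
  case True
  define k where "k = (2 :: nat) ^ (\<alpha> - 1)"
  have d0: "d > 0" by (rule squarefree_nat_pos[OF d])
  have "pcls (2 ^ \<alpha>) (s * of_nat d ^ k) = pcls (2 ^ \<alpha>) 1" using True by (simp add: pcls_1 k_def)
  hence "s * of_nat d ^ k \<in> Qstar_pow (2 ^ \<alpha>)" using s d0 by (subst (asm) pcls_eq_iff) auto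
  then obtain x where x: "s * of_nat d ^ k = x ^ (2 * k)" using half_power_2(1) by (auto simp: Qstar_pow_def k_def)
  define t :: int where "t = (if s = 1 then 1 else - 1)"
  have ts: "of_int t = s" using s by (auto simp: t_def)
  have k0: "k > 0" by (simp add: k_def)
  have "power_free (2 * k) (t * int d ^ k)" by (rule power_free_squarefree_power[OF d k0]) (auto simp: t_def)
  moreover have "power_free (2 * k) (1 * int 1 ^ k)" by (rule power_free_squarefree_power[OF _ k0]) auto
  ultimately have "\<bar>x\<bar> = 1" by (rule power_free_quotient_unit) (simp add: ts x)
  hence "s * of_nat d ^ k = 1" unfolding x power_mult by (metis power2_abs power_one)
  hence "\<bar>s * of_nat d ^ k\<bar> = 1" by simp
  hence "of_nat d ^ k = (1 :: rat)" using s by (auto simp: abs_mult)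
  hence "(of_nat (d ^ k) :: rat) = of_nat 1" by simp
  hence "d ^ k = 1" by (simp only: of_nat_eq_iff)
  hence "d = 1" using k0 by simp
  thus ?thesis using True by (simp add: delta_def quad_disc_def)
next
  case False
  thus ?thesis unfolding delta_def sqfree_root_pcls field_disc_csqrt[OF d] by simp
qed

end

text \<open>If \<open>g ^ 2 = u ^ (2 * k)\<close>, then \<open>g\<close> is plus or minus the
  \<open>k\<close>-th power of the absolute value of \<open>u\<close>, and splitting off the
  squarefree part of the latter gives the normal form of a 2-torsion coset.\<close>

lemma square_in_Qstar_pow_cases:
  assumes "(g :: rat) \<noteq> 0" "g ^ 2 \<in> Qstar_pow (2 ^ \<alpha>)" "\<alpha> > 0"
  obtains d s q where "squarefree (d :: nat)" "s = 1 \<or> s = - 1" "q \<noteq> 0"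
    "g = s * of_nat d ^ 2 ^ (\<alpha> - 1) * q ^ 2 ^ \<alpha>"
proof -
  define k where "k = (2 :: nat) ^ (\<alpha> - 1)"
  have D: "(2 :: nat) ^ \<alpha> = 2 * k" using assms(3) by (cases \<alpha>) (auto simp: k_def)
  obtain u where u: "g ^ 2 = u ^ (2 * k)" "u \<noteq> 0" using assms(2) by (auto simp: Qstar_pow_def D)
  have "g ^ 2 = (\<bar>u\<bar> ^ k) ^ 2" unfolding u(1) by (metis power_abs power2_abs power_mult mult.commute)
  hence "g = \<bar>u\<bar> ^ k \<or> g = - (\<bar>u\<bar> ^ k)" by (simp only: power2_eq_iff)
  then obtain s :: rat where s: "s = 1 \<or> s = -1" "g = s * \<bar>u\<bar> ^ k" by (metis mult_1 mult_minus1)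
  obtain d t where dt: "squarefree (d :: nat)" "t > 0" "\<bar>u\<bar> = of_nat d * t ^ 2"
    using rat_squarefree_decomposition[of "\<bar>u\<bar>"] u(2) by auto
  have "g = s * of_nat d ^ k * t ^ (2 * k)" unfolding s(2) dt(3) by (simp add: power_mult_distrib power_mult)
  thus ?thesis using that[OF dt(1) s(1), of t] dt(2) by (simp add: D k_def)
qed

subsection \<open>The degree formula\<close>

lemma subgroup_cyclotomic_powers:
  assumes "n > 0"
  shows "subgroup (cyclotomic_powers n) Qstar"
proof (rule subgroup_QstarI)
  note K = complex_subfield_Q_adjoin[of "{zeta n}"]
  show "1 \<in> cyclotomic_powers n" by (rule cyclotomic_powersI[OF subfield_1[OF K]]) auto
  show "x \<noteq> 0" if "x \<in> cyclotomic_powers n" for x using that by (simp add: cyclotomic_powers_def)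
  show "x * y \<in> cyclotomic_powers n" if xy: "x \<in> cyclotomic_powers n" "y \<in> cyclotomic_powers n" for x y
  proof -
    from xy obtain u v where uv: "x \<noteq> 0" "y \<noteq> 0" "u \<in> cyclotomic n" "v \<in> cyclotomic n"
      "u ^ n = of_rat x" "v ^ n = of_rat y" by (auto simp: cyclotomic_powers_def)
    show ?thesis by (rule cyclotomic_powersI[OF subfield_mult[OF K uv(3,4)]])
      (use uv in \<open>auto simp: power_mult_distrib of_rat_mult\<close>)
  qed
  show "inverse x \<in> cyclotomic_powers n" if "x \<in> cyclotomic_powers n" for x
  proof -
    from that obtain u where u: "x \<noteq> 0" "u \<in> cyclotomic n" "u ^ n = of_rat x"
      by (auto simp: cyclotomic_powers_def)
    show ?thesis by (rule cyclotomic_powersI[OF subfield_inverse[OF K u(2)]])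
      (use u in \<open>auto simp: power_inverse of_rat_inverse\<close>)
  qed
qed

lemma multiplicity_2_int:
  assumes "n > 0"
  shows "multiplicity 2 (int n) = multiplicity 2 n"
proof (rule multiplicity_eqI)
  have "n \<noteq> 0" using assms by simp
  thus "2 ^ multiplicity 2 n dvd int n" by (metis int_dvd_int_iff multiplicity_dvd of_nat_numeral of_nat_power)
  have "\<not> 2 ^ Suc (multiplicity 2 n) dvd n"
    using assms by (subst power_dvd_iff_le_multiplicity) auto
  thus "\<not> 2 ^ Suc (multiplicity 2 n) dvd int n" by (metis int_dvd_int_iff of_nat_numeral of_nat_power)
qed

lemma quad_disc_pos: "squarefree d \<Longrightarrow> quad_disc d > 0"
  using squarefree_nat_pos[of d] by (simp add: quad_disc_def)

text \<open>\<open>Gamma_tilde\<close> holds the condition at 2; the condition at odd primes is the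
  one that varies when \<open>n\<close> is multiplied by an odd number. The cardinality will be the
  defect of the degree.\<close>

definition entangled_cosets :: "rat set \<Rightarrow> nat \<Rightarrow> rat set set" where
  "entangled_cosets \<Gamma> n = {\<gamma> \<in> Gamma_tilde \<Gamma> n. \<forall>l. Factorial_Ring.prime l \<and> odd l \<and>
     int l dvd delta (prime_part 2 n) \<gamma> \<longrightarrow> l dvd n}"

lemma odd_prime_dvd_quad_disc:
  assumes "Factorial_Ring.prime p" "odd p"
  shows "p dvd quad_disc d \<longleftrightarrow> p dvd d"
proof -
  have "\<not> p dvd 2" using assms primes_dvd_imp_eq[of p 2] two_is_prime_nat by auto
  hence "\<not> p dvd 4" using prime_dvd_power[OF assms(1), of 2 2] by auto
  thus ?thesis using assms(1) by (auto simp: quad_disc_def prime_dvd_mult_iff)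
qed

text \<open>Rationals with a cyclotomic root are powers with the odd exponent \<open>n'\<close>, so
  their cosets modulo n-th powers are determined at the 2-part, where the normal form of 2-torsion
  elements applies.\<close>

lemma pcls_cyclotomic_powers:
  assumes \<Gamma>: "subgroup \<Gamma> Qstar" and n: "n > 0"
  shows "pcls (prime_part 2 n) ` (\<Gamma> \<inter> cyclotomic_powers n) = entangled_cosets \<Gamma> n"
    and "card (pcls n ` (\<Gamma> \<inter> cyclotomic_powers n)) = card (pcls (prime_part 2 n) ` (\<Gamma> \<inter> cyclotomic_powers n))"
proof -
  note nz = subgroup_Qstar_nonzero[OF \<Gamma>]
  define \<alpha> where "\<alpha> = multiplicity 2 n"
  obtain n' where n': "n = 2 ^ \<alpha> * n'" "odd n'"
    using multiplicity_decompose'[of n 2] n unfolding \<alpha>_def by auto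
  have n'0: "n' > 0" using n'(2) by (auto elim: oddE)
  have pp: "prime_part 2 n = 2 ^ \<alpha>" by (simp add: prime_part_def \<alpha>_def)
  have sub: "subgroup (\<Gamma> \<inter> cyclotomic_powers n) Qstar"
    by (rule group.subgroups_Inter_pair[OF group_Qstar \<Gamma> subgroup_cyclotomic_powers[OF n]])
  have one: "1 \<in> \<Gamma> \<inter> cyclotomic_powers n" by (rule subgroup_Qstar_1[OF sub])
  have oddpart: "g \<in> Qstar_pow n'" if "g \<in> cyclotomic_powers n" for g
  proof (cases "\<alpha> = 0")
    case True
    thus ?thesis using that cyclotomic_powers_odd[OF n'(2)] n'(1) by simp
  next
    case False
    thus ?thesis using that cyclotomic_powers_even[OF n'] by simp
  qed
  show "card (pcls n ` (\<Gamma> \<inter> cyclotomic_powers n)) = card (pcls (prime_part 2 n) ` (\<Gamma> \<inter> cyclotomic_powers n))"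
  proof (rule card_image_same_kernel)
    fix x y assume xy: "x \<in> \<Gamma> \<inter> cyclotomic_powers n" "y \<in> \<Gamma> \<inter> cyclotomic_powers n"
    have "x / y \<in> Qstar_pow n'" using subgroup_Qstar_divide[OF sub xy] oddpart by blast
    moreover have "Rings.coprime (2 ^ \<alpha>) n'" using n'(2) by simp
    ultimately have "x / y \<in> Qstar_pow n \<longleftrightarrow> x / y \<in> Qstar_pow (2 ^ \<alpha>)"
      using Qstar_pow_coprime_iff[of "2 ^ \<alpha>" n' "x / y"] n'(1) by simp
    moreover have "x \<noteq> 0" "y \<noteq> 0" using xy nz by auto
    ultimately show "pcls n x = pcls n y \<longleftrightarrow> pcls (prime_part 2 n) x = pcls (prime_part 2 n) y"
      unfolding pp by (simp add: pcls_eq_iff)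
  qed
  show "pcls (prime_part 2 n) ` (\<Gamma> \<inter> cyclotomic_powers n) = entangled_cosets \<Gamma> n"
  proof (cases "\<alpha> = 0")
    case True
    have all: "pcls 1 g = Qstar_pow 1" if "g \<noteq> 0" for g
      using pcls_eq_iff[of g 1 1] that Qstar_powI[of g 1] by (simp add: pcls_1)
    have tors: "two_torsion (Gamma_mod \<Gamma> 1) = {Qstar_pow 1}"
    proof -
      have "1 \<in> {g \<in> \<Gamma>. g ^ 2 \<in> Qstar_pow 1}"
        using subgroup_Qstar_1[OF \<Gamma>] subgroup_Qstar_1[OF subgroup_Qstar_pow] by simp
      thus ?thesis unfolding two_torsion_Gamma_mod[OF \<Gamma>] using all nz by auto
    qed
    have "entangled_cosets \<Gamma> n = {Qstar_pow 1}"
      using True by (auto simp: entangled_cosets_def Gamma_tilde_def pp tors[unfolded One_nat_def] pos_coset_def delta_def)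
    moreover have "pcls (prime_part 2 n) ` (\<Gamma> \<inter> cyclotomic_powers n) = {Qstar_pow 1}"
      using True one all nz by (auto simp: pp)
    ultimately show ?thesis by simp
  next
    case False
    hence \<alpha>: "\<alpha> > 0" by simp
    define D where "D = (2 :: nat) ^ \<alpha>"
    define k where "k = (2 :: nat) ^ (\<alpha> - 1)"
    have Dk: "D = 2 * k" using \<alpha> by (cases \<alpha>) (auto simp: D_def k_def)
    have gen: "pcls D g \<in> entangled_cosets \<Gamma> n \<longleftrightarrow>
        (\<forall>p. Factorial_Ring.prime p \<and> odd p \<and> p dvd d \<longrightarrow> p dvd n) \<and>
        (if s = 1 then multiplicity 2 (quad_disc d) \<le> \<alpha> else multiplicity 2 (quad_disc d) = \<alpha> + 1)"
      if g: "g \<in> \<Gamma>" "squarefree d" "s = 1 \<or> s = - 1" "q \<noteq> 0" "g = s * of_nat d ^ k * q ^ D" for g d s q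
    proof -
      have d0: "d > 0" by (rule squarefree_nat_pos[OF g(2)])
      have eq: "pcls D g = pcls D (s * of_nat d ^ k)"
        using g d0 nz[OF g(1)] by (subst pcls_eq_iff) (auto intro: Qstar_powI)
      have "s ^ 2 = 1" using g(3) by auto
      hence "g ^ 2 = (of_nat d * q ^ 2) ^ D"
        unfolding g(5) Dk by (simp add: power_mult_distrib power_mult[symmetric] mult.commute)
      hence "g ^ 2 \<in> Qstar_pow D" using d0 g(4) by (auto intro: Qstar_powI)
      hence "pcls D g \<in> two_torsion (Gamma_mod \<Gamma> D)" using g(1) by (auto simp: two_torsion_Gamma_mod[OF \<Gamma>])
      moreover have "delta D (pcls D g) = int (quad_disc d)"
        unfolding eq unfolding D_def k_def by (rule delta_pcls[OF g(2) \<alpha> g(3)])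
      moreover have "pos_coset D (pcls D g) \<longleftrightarrow> s = 1"
        unfolding eq unfolding D_def k_def by (rule pos_coset_pcls[OF g(2) \<alpha> g(3)])
      moreover have "multiplicity 2 (int (quad_disc d)) = multiplicity 2 (quad_disc d)"
        by (rule multiplicity_2_int[OF quad_disc_pos[OF g(2)]])
      ultimately show ?thesis
        unfolding entangled_cosets_def Gamma_tilde_def pp D_def[symmetric] \<alpha>_def[symmetric]
        by (auto simp: odd_prime_dvd_quad_disc)
    qed
    have mem: "g \<in> cyclotomic_powers n \<longleftrightarrow> g \<in> Qstar_pow n' \<and> pcls D g \<in> entangled_cosets \<Gamma> n"
      if g: "g \<in> \<Gamma>" "g ^ 2 \<in> Qstar_pow D" for g
    proof
      assume "g \<in> cyclotomic_powers n"
      thus "g \<in> Qstar_pow n' \<and> pcls D g \<in> entangled_cosets \<Gamma> n"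
        unfolding cyclotomic_powers_even[OF n' \<alpha>] using gen[OF g(1)] unfolding D_def k_def by blast
    next
      assume R: "g \<in> Qstar_pow n' \<and> pcls D g \<in> entangled_cosets \<Gamma> n"
      obtain d s q where "squarefree (d :: nat)" "s = 1 \<or> s = - 1" "q \<noteq> 0" "g = s * of_nat d ^ k * q ^ D"
        using square_in_Qstar_pow_cases[OF nz[OF g(1)] _ \<alpha>] g(2) unfolding D_def k_def by blast
      thus "g \<in> cyclotomic_powers n"
        unfolding cyclotomic_powers_even[OF n' \<alpha>] using gen[OF g(1)] R unfolding D_def k_def by blast
    qed
    show ?thesis unfolding pp D_def[symmetric]
    proof (intro equalityI subsetI)
      fix \<gamma> assume "\<gamma> \<in> pcls D ` (\<Gamma> \<inter> cyclotomic_powers n)"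
      then obtain g where g: "g \<in> \<Gamma>" "g \<in> cyclotomic_powers n" "\<gamma> = pcls D g" by auto
      obtain d s q where dsq: "squarefree (d :: nat)" "s = 1 \<or> s = - 1" "q \<noteq> 0" "g = s * of_nat d ^ k * q ^ D"
        "(\<forall>p. Factorial_Ring.prime p \<and> odd p \<and> p dvd d \<longrightarrow> p dvd n)"
        "(if s = 1 then multiplicity 2 (quad_disc d) \<le> \<alpha> else multiplicity 2 (quad_disc d) = \<alpha> + 1)"
        using g(2) unfolding cyclotomic_powers_even[OF n' \<alpha>] D_def k_def by blast
      thus "\<gamma> \<in> entangled_cosets \<Gamma> n" unfolding g(3) using gen[OF g(1)] by blast
    next
      fix \<gamma> assume \<gamma>: "\<gamma> \<in> entangled_cosets \<Gamma> n"
      hence "\<gamma> \<in> two_torsion (Gamma_mod \<Gamma> D)"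
        by (simp add: entangled_cosets_def Gamma_tilde_def pp D_def)
      then obtain g where g: "g \<in> \<Gamma>" "g ^ 2 \<in> Qstar_pow D" "\<gamma> = pcls D g"
        by (auto simp: two_torsion_Gamma_mod[OF \<Gamma>])
      have "Rings.coprime D n'" using n'(2) by (simp add: D_def)
      \<comment> \<open>The representative \<open>g\<close> need not be an \<open>n'\<close>-th
        power. Raising it to an exponent that is 1 modulo \<open>D\<close> and 0 modulo
        \<open>n'\<close> keeps its coset modulo \<open>D\<close> and stays in \<Gamma>.\<close>
      then obtain e0 where e0: "[e0 = 1] (mod D)" "[e0 = 0] (mod n')" using binary_chinese_remainder_nat by blast
      define e where "e = e0 + D * n'"
      have Dn: "D * n' > 0" using n'0 by (simp add: D_def)
      have e: "[e = 1] (mod D)" "n' dvd e" "e > 0"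
        using e0 Dn by (auto simp: e_def cong_def cong_0_iff mod_0_imp_dvd)
      have "D dvd e - 1" using e(1,3) by (metis One_nat_def Suc_leI cong_altdef_nat cong_sym)
      then obtain j where j: "e = 1 + D * j" using e(3) by (metis One_nat_def Suc_leI add_diff_inverse_nat dvdE le_neq_implies_less less_one linorder_not_less)
      define h where "h = g ^ e"
      have h: "h \<in> \<Gamma>" unfolding h_def by (rule subgroup_Qstar_power[OF \<Gamma> g(1)])
      have "h / g = (g ^ j) ^ D" using nz[OF g(1)] by (simp add: h_def j power_mult[symmetric] mult.commute)
      hence "pcls D h = pcls D g" using nz g(1) h by (subst pcls_eq_iff) (auto intro!: Qstar_powI)
      moreover have "h \<in> Qstar_pow n'"
      proof -
        obtain i where "e = n' * i" using e(2) by (elim dvdE)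
        hence "h = (g ^ i) ^ n'" by (simp add: h_def mult.commute flip: power_mult)
        thus ?thesis using nz[OF g(1)] by (auto intro: Qstar_powI)
      qed
      moreover have "h ^ 2 \<in> Qstar_pow D"
      proof -
        have "h ^ 2 = (g ^ 2) ^ e" by (simp add: h_def mult.commute flip: power_mult)
        thus ?thesis using subgroup_Qstar_power[OF subgroup_Qstar_pow g(2)] by simp
      qed
      ultimately have "h \<in> cyclotomic_powers n" using mem[OF h] \<gamma> g(3) by simp
      thus "\<gamma> \<in> pcls D ` (\<Gamma> \<inter> cyclotomic_powers n)" using h \<open>pcls D h = pcls D g\<close> g(3) by blast
    qed
  qed
qed

text \<open>The degree counts cosets modulo \<open>cyclotomic_powers n\<close>, and the tower of
  cosets relates this to all cosets modulo n-th powers; the remaining factor is the number of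
  entangled ones.\<close>

lemma degree_formula:
  assumes \<Gamma>: "subgroup \<Gamma> Qstar" "finitely_generated_subgroup \<Gamma>" and n: "n > 0"
  shows "degree_over_Q (Q_adjoin (insert (zeta n) (roots_of \<Gamma> n))) * card (entangled_cosets \<Gamma> n) =
           totient n * card (pcls n ` \<Gamma>)"
    and "finite (entangled_cosets \<Gamma> n)" "entangled_cosets \<Gamma> n \<noteq> {}"
proof -
  have fin: "finite (pcls n ` \<Gamma>)" by (rule finite_pcls_image[OF \<Gamma>(2) n])
  have H: "subgroup (cyclotomic_powers n) Qstar" "Qstar_pow n \<subseteq> cyclotomic_powers n"
    using subgroup_cyclotomic_powers[OF n] Qstar_pow_subset_cyclotomic_powers[OF n] by auto
  note tower = card_cosets_tower[OF \<Gamma>(1) subgroup_Qstar_pow H fin]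
  have \<Gamma>0: "0 \<notin> \<Gamma>" using subgroup_Qstar_nonzero[OF \<Gamma>(1)] by auto
  obtain R where R: "finite R" "R \<subseteq> \<Gamma>" "card R = card (qcoset (cyclotomic_powers n) ` \<Gamma>)"
    "\<And>g. g \<in> \<Gamma> \<Longrightarrow> \<exists>r\<in>R. g / r \<in> cyclotomic_powers n"
    "\<And>r s. r \<in> R \<Longrightarrow> s \<in> R \<Longrightarrow> r / s \<in> cyclotomic_powers n \<Longrightarrow> r = s"
    using coset_representatives[OF H(1) \<Gamma>0 tower(1)] by metis
  have "degree_over_Q (Q_adjoin (insert (zeta n) (roots_of \<Gamma> n))) = totient n * card R"
    by (rule degree_radical_extension[OF n \<Gamma>0 subgroup_Qstar_1[OF \<Gamma>(1)] subgroup_Qstar_mult[OF \<Gamma>(1)] R(1,2,4,5)])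
  thus "degree_over_Q (Q_adjoin (insert (zeta n) (roots_of \<Gamma> n))) * card (entangled_cosets \<Gamma> n) =
           totient n * card (pcls n ` \<Gamma>)"
    using tower(2) R(3) pcls_cyclotomic_powers[OF \<Gamma>(1) n] by simp
  show "finite (entangled_cosets \<Gamma> n)"
    unfolding pcls_cyclotomic_powers(1)[OF \<Gamma>(1) n, symmetric]
    by (rule finite_subset[OF _ finite_pcls_image[OF \<Gamma>(2), of "prime_part 2 n"]]) (auto simp: prime_part_def)
  show "entangled_cosets \<Gamma> n \<noteq> {}"
    unfolding pcls_cyclotomic_powers(1)[OF \<Gamma>(1) n, symmetric]
    using subgroup_Qstar_1[OF \<Gamma>(1)] subgroup_Qstar_1[OF H(1)] by blast
qed

subsection \<open>Euler products over squarefree integers\<close>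

lemma
  assumes "finite S" "\<And>p. p \<in> S \<Longrightarrow> Factorial_Ring.prime (p :: nat)"
  shows prime_factors_prod_primes: "prime_factors (\<Prod>S) = S"
    and squarefree_prod_primes: "squarefree (\<Prod>S)"
proof -
  have "prime_factors (\<Prod>S) = S \<and> squarefree (\<Prod>S) \<and> \<Prod>S > 0"
    using assms
  proof (induction S rule: finite_induct)
    case (insert p S)
    have IH: "prime_factors (\<Prod>S) = S" "squarefree (\<Prod>S)" "\<Prod>S > 0" using insert by auto
    have p: "Factorial_Ring.prime p" using insert by auto
    have "\<not> p dvd \<Prod>S" using IH(1,3) p insert.hyps(2) by (metis in_prime_factors_iff less_irrefl)
    hence "Rings.coprime p (\<Prod>S)" using p by (simp add: prime_imp_coprime)
    hence "squarefree (p * \<Prod>S)" using IH(2) by (intro squarefree_mult_coprime squarefree_prime[OF p])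
    moreover have "prime_factors (p * \<Prod>S) = insert p S"
      using IH p prime_gt_0_nat[OF p] by (simp add: prime_factors_product prime_prime_factors)
    ultimately show ?case using insert.hyps IH prime_gt_0_nat[OF p] by simp
  qed auto
  thus "prime_factors (\<Prod>S) = S" "squarefree (\<Prod>S)" by auto
qed

lemma squarefree_eq_prod_primes:
  assumes "squarefree (n :: nat)"
  shows "\<Prod>(prime_factors n) = n"
proof -
  have n: "n \<noteq> 0" using assms by (metis not_squarefree_0)
  have "(\<Prod>p\<in>prime_factors n. p ^ multiplicity p n) = n"
    using prod_prime_factors[OF n] by simp
  moreover have "multiplicity p n = 1" if "p \<in> prime_factors n" for p
    using that assms n by (auto simp: squarefree_factorial_semiring' )
  ultimately show ?thesis by simp
qed

text \<open>The coefficients whose Euler factor is \<open>1 + a p\<close> at a prime outside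
  \<open>Z\<close> and only \<open>a p\<close> at a prime in \<open>Z\<close>, which must divide
  \<open>k\<close>.\<close>

definition euler_coeff :: "(nat \<Rightarrow> real) \<Rightarrow> nat set \<Rightarrow> nat \<Rightarrow> real" where
  "euler_coeff a Z k = (if squarefree k \<and> Z \<subseteq> prime_factors k then \<Prod>p\<in>prime_factors k. a p else 0)"

text \<open>Expanding the product chooses a set \<open>S\<close> of primes; the summand 0 at primes
  of \<open>Z\<close> removes every \<open>S\<close> that does not contain \<open>Z\<close>.\<close>

lemma sum_euler_coeff_finite:
  assumes T: "finite T" "\<And>p. p \<in> T \<Longrightarrow> Factorial_Ring.prime (p :: nat)"
  shows "sum f ((\<lambda>S. \<Prod>S) ` Pow T) = (\<Sum>S\<in>Pow T. f (\<Prod>S))"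
    and "Z \<subseteq> T \<Longrightarrow> (\<Sum>S\<in>Pow T. euler_coeff a Z (\<Prod>S)) = (\<Prod>p\<in>T. (if p \<in> Z then 0 else 1) + a p)"
proof -
  have sub: "prime_factors (\<Prod>S) = S" "squarefree (\<Prod>S)" if "S \<in> Pow T" for S
    using prime_factors_prod_primes[of S] squarefree_prod_primes[of S] that T(2) finite_subset[OF _ T(1), of S]
    by (auto simp del: prod_dvd_prod_subset)
  have "inj_on (\<lambda>S. \<Prod>S) (Pow T)" by (rule inj_onI) (metis sub(1))
  thus "sum f ((\<lambda>S. \<Prod>S) ` Pow T) = (\<Sum>S\<in>Pow T. f (\<Prod>S))" by (simp add: sum.reindex)
  assume Z: "Z \<subseteq> T"
  have "(\<Prod>p\<in>T. a p + (if p \<in> Z then 0 else 1)) =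
      (\<Sum>S\<in>Pow T. (\<Prod>p\<in>S. a p) * (\<Prod>p\<in>T - S. if p \<in> Z then 0 else 1))"
    by (rule prod_add[OF T(1)])
  also have "\<dots> = (\<Sum>S\<in>Pow T. euler_coeff a Z (\<Prod>S))"
  proof (rule sum.cong)
    fix S assume S: "S \<in> Pow T"
    have "(\<Prod>p\<in>T - S. if p \<in> Z then 0 else 1 :: real) = (if Z \<subseteq> S then 1 else 0)"
    proof (cases "Z \<subseteq> S")
      case True
      thus ?thesis by (auto intro!: prod.neutral)
    next
      case False
      then obtain p where "p \<in> Z" "p \<notin> S" by auto
      thus ?thesis using T(1) Z False by (auto intro!: prod_zero bexI[of _ p])
    qed
    thus "(\<Prod>p\<in>S. a p) * (\<Prod>p\<in>T - S. if p \<in> Z then 0 else 1) = euler_coeff a Z (\<Prod>S)"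
      using sub[OF S] by (simp add: euler_coeff_def)
  qed simp
  finally show "(\<Sum>S\<in>Pow T. euler_coeff a Z (\<Prod>S)) = (\<Prod>p\<in>T. (if p \<in> Z then 0 else 1) + a p)"
    by (simp add: add.commute)
qed

lemma squarefree_in_prod_primes:
  "squarefree (k :: nat) \<Longrightarrow> prime_factors k \<subseteq> T \<Longrightarrow> k \<in> (\<lambda>S. \<Prod>S) ` Pow T"
  using squarefree_eq_prod_primes[of k] by (auto intro!: image_eqI[of _ _ "prime_factors k"])

text \<open>Uniform bounds on finite sums of \<open>a\<close> give absolute convergence through
  \<open>1 + t \<le> exp t\<close>. The sum may then be taken along the sets of squarefree smooth
  numbers, where it is a finite product.\<close>

lemma euler_product:
  fixes a :: "nat \<Rightarrow> real"
  assumes bound: "\<And>T. finite T \<Longrightarrow> (\<And>p. p \<in> T \<Longrightarrow> Factorial_Ring.prime p) \<Longrightarrow> (\<Sum>p\<in>T. \<bar>a p\<bar>) \<le> C"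
    and Z: "finite Z" "\<And>p. p \<in> Z \<Longrightarrow> Factorial_Ring.prime p"
  shows "summable (euler_coeff a Z)"
    and "(\<lambda>n. \<Prod>p | Factorial_Ring.prime p \<and> p \<le> n. (if p \<in> Z then 0 else 1) + a p) \<longlonglongrightarrow> suminf (euler_coeff a Z)"
proof -
  define c where "c = euler_coeff a Z"
  define smooth where "smooth = (\<lambda>n. (\<lambda>S. \<Prod>S) ` Pow {p :: nat. Factorial_Ring.prime p \<and> p \<le> n})"
  have finT: "finite {p :: nat. Factorial_Ring.prime p \<and> p \<le> n}" for n by (rule finite_subset[of _ "{..n}"]) auto
  have pf_le: "p \<le> n" if "k \<le> n" "p \<in> prime_factors k" for k n p :: nat
    using that by (auto simp: in_prime_factors_iff dest!: dvd_imp_le)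
  have in_smooth: "k \<in> smooth n" if "squarefree k" "k \<le> n" for k n
    unfolding smooth_def by (rule squarefree_in_prod_primes[OF that(1)])
      (use pf_le[OF that(2)] in \<open>auto simp: in_prime_factors_iff\<close>)
  have fin_smooth: "finite (smooth n)" for n using finT by (simp add: smooth_def)
  have c0: "c k = 0" if "\<not> squarefree k" for k using that by (simp add: c_def euler_coeff_def)
  have bnd: "(\<Sum>k\<in>smooth n. \<bar>c k\<bar>) \<le> exp C" for n
  proof -
    have "(\<Sum>k\<in>smooth n. \<bar>c k\<bar>) \<le> (\<Sum>k\<in>smooth n. euler_coeff (\<lambda>p. \<bar>a p\<bar>) {} k)"
      unfolding c_def by (intro sum_mono) (auto simp: euler_coeff_def abs_prod intro!: prod_nonneg)
    also have "\<dots> = (\<Prod>p | Factorial_Ring.prime p \<and> p \<le> n. 1 + \<bar>a p\<bar>)"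
      unfolding smooth_def using sum_euler_coeff_finite(1)[OF finT, of n "euler_coeff (\<lambda>p. \<bar>a p\<bar>) {}"]
        sum_euler_coeff_finite(2)[OF finT, of n "{}"] by simp
    also have "\<dots> \<le> exp (\<Sum>p | Factorial_Ring.prime p \<and> p \<le> n. \<bar>a p\<bar>)"
      by (rule prod_le_exp_sum) auto
    also have "\<dots> \<le> exp C" using bound[OF finT] by simp
    finally show ?thesis .
  qed
  have summ: "summable (\<lambda>k. \<bar>c k\<bar>)"
  proof (rule summableI_nonneg_bounded)
    fix n
    have "(\<Sum>k<n. \<bar>c k\<bar>) = (\<Sum>k | k < n \<and> squarefree k. \<bar>c k\<bar>)"
      using c0 by (intro sum.mono_neutral_right) auto
    also have "\<dots> \<le> (\<Sum>k\<in>smooth n. \<bar>c k\<bar>)" using in_smooth fin_smooth by (intro sum_mono2) (auto simp: less_imp_le)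
    also have "\<dots> \<le> exp C" by (rule bnd)
    finally show "(\<Sum>k<n. \<bar>c k\<bar>) \<le> exp C" .
  qed auto
  thus "summable (euler_coeff a Z)" unfolding c_def by (rule summable_rabs_cancel)
  have "(c has_sum suminf c) UNIV" 
    using norm_summable_imp_has_sum[of c] summ summable_sums[OF summable_rabs_cancel[OF summ]] by simp
  hence lim: "(sum c \<longlongrightarrow> suminf c) (finite_subsets_at_top UNIV)" by (simp add: has_sum_def)
  \<comment> \<open>The sets \<open>smooth n\<close> contain only squarefree numbers and do not
    exhaust the naturals; adding \<open>{..n}\<close> repairs this, and the added terms are
    0.\<close>
  have "filterlim (\<lambda>n. smooth n \<union> {..n}) (finite_subsets_at_top UNIV) sequentially"
    unfolding filterlim_finite_subsets_at_top
  proof (intro allI impI)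
    fix Y :: "nat set" assume "finite Y \<and> Y \<subseteq> UNIV"
    then obtain N where N: "\<forall>y\<in>Y. y \<le> N" by (metis finite_nat_set_iff_bounded_le)
    show "\<forall>\<^sub>F n in sequentially. finite (smooth n \<union> {..n}) \<and> Y \<subseteq> smooth n \<union> {..n} \<and> smooth n \<union> {..n} \<subseteq> UNIV"
      using eventually_ge_at_top[of N] by eventually_elim (use N fin_smooth in \<open>auto intro: order_trans\<close>)
  qed
  hence "(\<lambda>n. sum c (smooth n \<union> {..n})) \<longlonglongrightarrow> suminf c" by (rule filterlim_compose[OF lim])
  moreover have "sum c (smooth n \<union> {..n}) = sum c (smooth n)" for n
    using in_smooth c0 fin_smooth by (intro sum.mono_neutral_right) auto
  ultimately have lim2: "(\<lambda>n. sum c (smooth n)) \<longlonglongrightarrow> suminf c" by simp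
  obtain N where N: "\<forall>z\<in>Z. z \<le> N" using Z(1) by (metis finite_nat_set_iff_bounded_le)
  have "\<forall>\<^sub>F n in sequentially. sum c (smooth n) = (\<Prod>p | Factorial_Ring.prime p \<and> p \<le> n. (if p \<in> Z then 0 else 1) + a p)"
    using eventually_ge_at_top[of N]
  proof eventually_elim
    case (elim n)
    hence "Z \<subseteq> {p. Factorial_Ring.prime p \<and> p \<le> n}" using N Z(2) by fastforce
    thus ?case unfolding smooth_def c_def
      using sum_euler_coeff_finite(1)[OF finT, of n "euler_coeff a Z"]
        sum_euler_coeff_finite(2)[OF finT, of n Z] by simp
  qed
  with lim2 show "(\<lambda>n. \<Prod>p | Factorial_Ring.prime p \<and> p \<le> n. (if p \<in> Z then 0 else 1) + a p) \<longlonglongrightarrow> suminf (euler_coeff a Z)"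
    unfolding c_def by (rule Lim_transform_eventually)
qed

subsection \<open>Multiplicativity of the generic degree\<close>

lemma prime_part_mult_not_dvd:
  assumes "Factorial_Ring.prime l" "M > 0" "\<not> l dvd k" "k > 0"
  shows "prime_part l (M * k) = prime_part l M" "multiplicity l (M * k) = multiplicity l M"
proof -
  show "multiplicity l (M * k) = multiplicity l M"
    using assms by (subst prime_elem_multiplicity_mult_distrib) (auto simp: not_dvd_imp_multiplicity_0)
  thus "prime_part l (M * k) = prime_part l M" by (simp add: prime_part_def)
qed

text \<open>An element of absolute value 1 has square 1, and the exponent 2 would violate
  independence.\<close>

lemma has_rank_imp_nontrivial:
  assumes "has_rank \<Gamma> r" "r \<ge> 1"
  obtains g where "g \<in> \<Gamma>" "\<bar>g\<bar> \<noteq> 1"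
proof -
  obtain S where S: "S \<subseteq> \<Gamma>" "finite S" "mult_independent S" "card S = r"
    using assms(1) by (auto simp: has_rank_def)
  then obtain s where s: "s \<in> S" using assms(2) by (cases "S = {}") auto
  have "\<bar>s\<bar> \<noteq> 1"
  proof
    assume "\<bar>s\<bar> = 1"
    hence "s ^ 2 = 1" by (metis power2_abs power_one)
    hence "(\<Prod>t\<in>S. t powi (if t = s then 2 else 0)) = (\<Prod>t\<in>S. 1)" by (intro prod.cong) auto
    hence "\<forall>t\<in>S. (if t = s then 2 else 0 :: int) = 0"
      using S(3) unfolding mult_independent_def by (auto dest!: spec[of _ "\<lambda>t. if t = s then 2 else 0"])
    thus False using s by auto
  qed
  thus ?thesis using that s S(1) by blast
qed

lemma moebius_simps:
  "\<not> squarefree k \<Longrightarrow> moebius k = 0"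
  "squarefree k \<Longrightarrow> moebius k = (-1) ^ card (prime_factors k)"
  by (simp_all add: moebius_def)

lemma moebius_double: "moebius (2 * j) = (if odd j then - moebius j else 0)"
proof (cases "odd j")
  case True
  have j0: "j \<noteq> 0" using odd_pos[OF True] by simp
  have co: "Rings.coprime 2 j" using True by simp
  have sq: "squarefree (2 * j) \<longleftrightarrow> squarefree j"
    using squarefree_mult_coprime[OF co] squarefree_prime[OF two_is_prime_nat] squarefree_multD(2)[of 2 j] by auto
  have "prime_factors (2 * j) = insert 2 (prime_factors j)"
    using j0 prime_factors_product[of 2 j] by (simp add: prime_prime_factors del: neq0_conv)
  moreover have "2 \<notin> prime_factors j" using True by (auto simp: in_prime_factors_iff)
  ultimately show ?thesis using True sq by (simp add: moebius_def)
next
  case False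
  hence "2 ^ 2 dvd 2 * j" by auto
  hence "\<not> squarefree (2 * j)" using squarefreeD[of "2 * j" 2] by auto
  thus ?thesis using False by (simp add: moebius_def)
qed

text \<open>Positive rank is represented by the growth constant \<open>L\<close>.\<close>

locale rank_pos_subgroup =
  fixes \<Gamma> :: "rat set" and L :: nat
  assumes subgroup: "subgroup \<Gamma> Qstar" and fg: "finitely_generated_subgroup \<Gamma>"
    and L: "L > 0" "\<And>d. d > 0 \<Longrightarrow> d \<le> L * card (pcls d ` \<Gamma>)"
begin

definition N :: "nat \<Rightarrow> nat" where
  "N d = card (pcls d ` \<Gamma>)"

lemma order_eq_N: "Coset.order (Gamma_mod \<Gamma> d) = N d"
  by (simp add: N_def order_Gamma_mod[OF subgroup])

lemma N_pos: "d > 0 \<Longrightarrow> N d > 0"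
  using L(2)[of d] by (cases "N d") (auto simp: N_def)

lemma N_mult: "Rings.coprime a b \<Longrightarrow> N (a * b) = N a * N b"
  unfolding N_def by (rule card_pcls_mult[OF subgroup])

lemma N_1: "N 1 = 1"
  using N_mult[of 1 1] N_pos[of 1] by simp

text \<open>The degree of the radical extension of exponent \<open>n\<close> if there were no entanglement.\<close>

definition gdeg :: "nat \<Rightarrow> real" where
  "gdeg n = real (totient n) * real (N n)"

lemma gdeg_pos: "n > 0 \<Longrightarrow> gdeg n > 0"
  using N_pos by (simp add: gdeg_def)

lemma gdeg_mult: "Rings.coprime a b \<Longrightarrow> gdeg (a * b) = gdeg a * gdeg b"
  by (simp add: gdeg_def N_mult totient_mult_coprime)

text \<open>The factor by which the reciprocal of \<open>gdeg\<close> changes when \<open>M\<close>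
  is multiplied by the prime \<open>l\<close>; it depends only on the \<open>l\<close>-part of
  \<open>M\<close>.\<close>

definition loc :: "nat \<Rightarrow> nat \<Rightarrow> real" where
  "loc M l = gdeg (prime_part l M) / gdeg (l * prime_part l M)"

lemma loc_pos: "Factorial_Ring.prime l \<Longrightarrow> loc M l > 0"
  unfolding loc_def by (intro divide_pos_pos gdeg_pos) (auto simp: prime_part_def prime_gt_0_nat)

lemma gdeg_mult_prime:
  assumes l: "Factorial_Ring.prime l" and n: "n > 0"
  shows "gdeg n = gdeg (n * l) * loc n l"
proof -
  obtain n' where n': "n = prime_part l n * n'" "\<not> l dvd n'"
    unfolding prime_part_def by (rule multiplicity_decompose'[of n l]) (use n l in \<open>auto simp: not_prime_unit\<close>)
  have pp: "prime_part l n > 0" using l prime_gt_0_nat by (simp add: prime_part_def)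
  have co: "Rings.coprime (prime_part l n) n'" "Rings.coprime (l * prime_part l n) n'"
    using prime_imp_coprime[OF l n'(2)] by (auto simp: prime_part_def)
  have "gdeg n = gdeg (prime_part l n) * gdeg n'" by (subst n'(1)) (rule gdeg_mult[OF co(1)])
  moreover have "gdeg (n * l) = gdeg (l * prime_part l n) * gdeg n'"
  proof -
    have "n * l = (l * prime_part l n) * n'" by (subst n'(1)) (simp add: mult_ac)
    thus ?thesis using gdeg_mult[OF co(2)] by (simp only:)
  qed
  moreover have "gdeg (l * prime_part l n) > 0" using pp l by (intro gdeg_pos) (simp add: prime_gt_0_nat)
  ultimately show ?thesis by (simp add: loc_def)
qed

text \<open>Multiplying by other primes leaves the \<open>l\<close>-part alone, so the local factors
  at different primes are independent.\<close>

lemma gdeg_mult_prod_primes: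
  assumes "finite S" "\<And>p. p \<in> S \<Longrightarrow> Factorial_Ring.prime p" and M: "M > 0"
  shows "gdeg M = gdeg (M * \<Prod>S) * (\<Prod>l\<in>S. loc M l)"
  using assms(1,2)
proof (induction S rule: finite_induct)
  case (insert p S)
  have p: "Factorial_Ring.prime p" and S: "\<And>q. q \<in> S \<Longrightarrow> Factorial_Ring.prime q" using insert by auto
  have S0: "\<Prod>S > 0" using S prime_gt_0_nat by (intro prod_pos) auto
  have "\<not> p dvd \<Prod>S"
    using prime_factors_prod_primes[OF insert.hyps(1) S] insert.hyps(2) p S0 by (auto simp: in_prime_factors_iff)
  hence "loc (M * \<Prod>S) p = loc M p" using p M S0 by (simp add: loc_def prime_part_mult_not_dvd)
  moreover have "gdeg (M * \<Prod>S) = gdeg (M * \<Prod>S * p) * loc (M * \<Prod>S) p"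
    by (rule gdeg_mult_prime[OF p]) (use M S0 in simp)
  ultimately have "gdeg (M * \<Prod>S) = gdeg (M * \<Prod>(insert p S)) * loc M p"
    using insert.hyps by (simp add: mult_ac)
  thus ?case using insert.IH[OF S] insert.hyps by (simp add: mult_ac)
qed auto

lemma inverse_gdeg_squarefree:
  assumes "squarefree k" "M > 0"
  shows "1 / gdeg (M * k) = (\<Prod>l\<in>prime_factors k. loc M l) / gdeg M"
proof -
  have k0: "k > 0" by (rule squarefree_nat_pos[OF assms(1)])
  have "gdeg M = gdeg (M * k) * (\<Prod>l\<in>prime_factors k. loc M l)"
    using gdeg_mult_prod_primes[of "prime_factors k" M] assms squarefree_eq_prod_primes[OF assms(1)]
    by (simp add: in_prime_factors_imp_prime)
  moreover have "gdeg (M * k) \<noteq> 0" "gdeg M \<noteq> 0"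
    using gdeg_pos[of "M * k"] gdeg_pos[of M] k0 assms(2) by simp_all
  ultimately have "gdeg (M * k) \<noteq> 0" "gdeg M \<noteq> 0" "gdeg M = gdeg (M * k) * (\<Prod>l\<in>prime_factors k. loc M l)"
    by blast+
  thus ?thesis by (simp add: frac_eq_eq mult.commute del: prod_zero_iff)
qed

lemma loc_not_dvd:
  assumes "Factorial_Ring.prime l" "\<not> l dvd M"
  shows "loc M l = 1 / ((real l - 1) * real (N l))"
proof -
  have "prime_part l M = 1" using assms by (simp add: prime_part_def not_dvd_imp_multiplicity_0)
  thus ?thesis using assms(1) prime_gt_0_nat[OF assms(1)] N_1
    by (simp add: loc_def gdeg_def totient_prime of_nat_diff)
qed

lemma loc_dvd:
  assumes l: "Factorial_Ring.prime l" "l dvd M" "M > 0"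
  shows "loc M l = real (N (prime_part l M)) / (real l * real (N (l * prime_part l M)))"
proof -
  define v where "v = multiplicity l M"
  have v: "v > 0" using l unfolding v_def by (simp add: prime_multiplicity_gt_zero_iff)
  have "totient (l ^ Suc v) = l * totient (l ^ v)"
    using v l(1) totient_prime_power[of l v] totient_prime_power[of l "Suc v"] by (cases v) simp_all
  moreover have "totient (l ^ v) > 0" using prime_gt_0_nat[OF l(1)] by simp
  ultimately show ?thesis by (simp add: loc_def gdeg_def prime_part_def v_def[symmetric])
qed

text \<open>The growth bound \<open>l \<le> L * N l\<close> and \<open>l \<le> 2 * (l - 1)\<close>
  give the quadratic decay. The bound \<open>1 / 2\<close> keeps the denominator in the factors of
  \<open>B_const\<close> nonzero; at \<open>l = 2\<close> with \<open>N 2 = 1\<close> and odd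
  \<open>M\<close> it would vanish.\<close>

lemma loc_bound:
  assumes "Factorial_Ring.prime l" "\<not> l dvd M"
  shows "loc M l \<le> 2 * real L / real l ^ 2" "l > 2 \<Longrightarrow> loc M l \<le> 1 / 2"
proof -
  have l2: "real l \<ge> 2" using prime_ge_2_nat[OF assms(1)] by simp
  have Np: "real (N l) \<ge> 1" using N_pos[of l] l2 by (simp add: Suc_le_eq)
  have "l \<le> L * N l" using L(2)[of l] l2 by (simp add: N_def)
  hence LN: "real l \<le> real L * real (N l)" by (metis of_nat_le_iff of_nat_mult)
  have "real l * real l \<le> (2 * (real l - 1)) * (real L * real (N l))"
    using l2 LN by (intro mult_mono) auto
  thus "loc M l \<le> 2 * real L / real l ^ 2"
    unfolding loc_not_dvd[OF assms] using l2 Np by (simp add: field_simps power2_eq_square)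
  assume "l > 2"
  hence "real l - 1 \<ge> 2" by simp
  hence "2 * 1 \<le> (real l - 1) * real (N l)" using Np by (intro mult_mono) auto
  thus "loc M l \<le> 1 / 2" unfolding loc_not_dvd[OF assms] by (simp add: field_simps)
qed

lemma A_factor_eq: "A_factor \<Gamma> M l = (if Factorial_Ring.prime l \<and> l > 2 \<and> \<not> l dvd M then 1 - loc M l else 1)"
  by (simp add: A_factor_def order_eq_N loc_not_dvd)

lemma convergent_prod_A_factor: "convergent_prod (A_factor \<Gamma> M)"
proof -
  have "summable (\<lambda>l. 2 * real L * inverse (real l ^ 2))"
    by (intro summable_mult inverse_power_summable) auto
  hence "summable (\<lambda>l. norm (A_factor \<Gamma> M l - 1))"
  proof (rule summable_comparison_test[rotated], intro exI allI impI)
    fix l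
    show "norm (norm (A_factor \<Gamma> M l - 1)) \<le> 2 * real L * inverse (real l ^ 2)"
      using loc_bound(1)[of l M] loc_pos[of l M] by (auto simp: A_factor_eq divide_inverse)
  qed
  thus ?thesis by (intro abs_convergent_prod_imp_convergent_prod summable_imp_abs_convergent_prod)
qed

subsection \<open>The sum over odd squarefree \<open>k\<close>\<close>

text \<open>The sign is that of the Moebius function at a prime, and the value 0 at 2 restricts the
  sum to odd \<open>k\<close>.\<close>

definition coeff_at :: "nat \<Rightarrow> nat \<Rightarrow> real" where
  "coeff_at M l = (if l = 2 then 0 else - loc M l)"

text \<open>The finitely many primes dividing \<open>M\<close> are bounded separately; at all others
  the quadratic decay gives a convergent majorant.\<close>

lemma coeff_at_bound:
  assumes M: "M > 0"
  shows "\<exists>C. \<forall>T. finite T \<longrightarrow> (\<forall>p\<in>T. Factorial_Ring.prime p) \<longrightarrow> (\<Sum>p\<in>T. \<bar>coeff_at M p\<bar>) \<le> C"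
proof -
  define s where "s = (\<lambda>l :: nat. 2 * real L * inverse (real l ^ 2))"
  have s: "summable s" unfolding s_def by (intro summable_mult inverse_power_summable) auto
  have "(\<Sum>p\<in>T. \<bar>coeff_at M p\<bar>) \<le> (\<Sum>p\<in>prime_factors M. loc M p) + suminf s"
    if T: "finite T" "\<forall>p\<in>T. Factorial_Ring.prime p" for T
  proof -
    have "\<bar>coeff_at M p\<bar> \<le> (if p \<in> prime_factors M then loc M p else 0) + s p" if "p \<in> T" for p
    proof (cases "p dvd M")
      case True
      hence "p \<in> prime_factors M" using that T M by (auto simp: in_prime_factors_iff)
      moreover have "s p \<ge> 0" by (simp add: s_def)
      ultimately show ?thesis using loc_pos[of p M] T that by (auto simp: coeff_at_def)
    next
      case False
      hence "loc M p \<le> s p" using loc_bound(1)[of p M] T that by (simp add: s_def divide_inverse)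
      thus ?thesis using loc_pos[of p M] T that False by (auto simp: coeff_at_def in_prime_factors_iff)
    qed
    hence "(\<Sum>p\<in>T. \<bar>coeff_at M p\<bar>) \<le> (\<Sum>p\<in>T. (if p \<in> prime_factors M then loc M p else 0) + s p)"
      by (rule sum_mono)
    also have "\<dots> = (\<Sum>p\<in>T. if p \<in> prime_factors M then loc M p else 0) + sum s T" by (simp add: sum.distrib)
    also have "(\<Sum>p\<in>T. if p \<in> prime_factors M then loc M p else 0) = (\<Sum>p\<in>T \<inter> prime_factors M. loc M p)"
      using T(1) by (simp add: sum.inter_restrict)
    also have "\<dots> \<le> (\<Sum>p\<in>prime_factors M. loc M p)"
      by (rule sum_mono2) (auto simp: in_prime_factors_iff intro: less_imp_le loc_pos)
    also have "sum s T \<le> suminf s" by (rule sum_le_suminf[OF s T(1)]) (simp add: s_def)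
    finally show ?thesis by simp
  qed
  thus ?thesis by blast
qed

definition new_primes :: "nat \<Rightarrow> rat set \<Rightarrow> nat set" where
  "new_primes M \<gamma> = {l. Factorial_Ring.prime l \<and> int l dvd delta (prime_part 2 M) \<gamma> \<and> \<not> l dvd M}"

text \<open>For odd \<open>M\<close> only the trivial coset exists and the discriminant is 1; for
  even \<open>M\<close> the discriminant is a positive \<open>quad_disc\<close>, and 2 is not new
  because it divides \<open>M\<close>.\<close>

lemma
  assumes \<gamma>: "\<gamma> \<in> Gamma_tilde \<Gamma> M" and M: "M > 0"
  shows delta_nonzero: "delta (prime_part 2 M) \<gamma> \<noteq> 0"
    and two_notin_new_primes: "2 \<notin> new_primes M \<gamma>"
proof -
  have t: "\<gamma> \<in> two_torsion (Gamma_mod \<Gamma> (prime_part 2 M))" using \<gamma> by (simp add: Gamma_tilde_def)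
  then obtain g where g: "g \<in> \<Gamma>" "g ^ 2 \<in> Qstar_pow (prime_part 2 M)" "\<gamma> = pcls (prime_part 2 M) g"
    by (auto simp: two_torsion_Gamma_mod[OF subgroup])
  have g0: "g \<noteq> 0" using subgroup_Qstar_nonzero[OF subgroup g(1)] .
  have "delta (prime_part 2 M) \<gamma> \<noteq> 0 \<and> 2 \<notin> new_primes M \<gamma>"
  proof (cases "even M")
    case False
    hence "prime_part 2 M = 1" by (simp add: prime_part_def not_dvd_imp_multiplicity_0)
    moreover have "pcls 1 g = pcls 1 1" using g0 Qstar_powI[of g 1] by (subst pcls_eq_iff) auto
    ultimately have "delta (prime_part 2 M) \<gamma> = 1" using g(3) by (simp add: delta_def pcls_1)
    thus ?thesis by (auto simp: new_primes_def)
  next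
    case True
    define \<alpha> where "\<alpha> = multiplicity 2 M"
    have \<alpha>: "\<alpha> > 0" unfolding \<alpha>_def using True M by (simp add: prime_multiplicity_gt_zero_iff)
    have pp: "prime_part 2 M = 2 ^ \<alpha>" by (simp add: prime_part_def \<alpha>_def)
    obtain d s q where dsq: "squarefree (d :: nat)" "s = 1 \<or> s = - 1" "q \<noteq> 0"
      "g = s * of_nat d ^ 2 ^ (\<alpha> - 1) * q ^ 2 ^ \<alpha>"
      using square_in_Qstar_pow_cases[OF g0 _ \<alpha>] g(2) unfolding pp by blast
    have "pcls (2 ^ \<alpha>) g = pcls (2 ^ \<alpha>) (s * of_nat d ^ 2 ^ (\<alpha> - 1))"
      using dsq g0 squarefree_nat_pos[OF dsq(1)] by (subst pcls_eq_iff) (auto intro: Qstar_powI)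
    hence "delta (prime_part 2 M) \<gamma> = int (quad_disc d)"
      unfolding g(3) pp using delta_pcls[OF dsq(1) \<alpha> dsq(2)] by simp
    thus ?thesis using quad_disc_pos[OF dsq(1)] True by (auto simp: new_primes_def)
  qed
  thus "delta (prime_part 2 M) \<gamma> \<noteq> 0" "2 \<notin> new_primes M \<gamma>" by auto
qed

lemma finite_new_primes:
  assumes "\<gamma> \<in> Gamma_tilde \<Gamma> M" "M > 0"
  shows "finite (new_primes M \<gamma>)"
proof (rule finite_subset)
  show "new_primes M \<gamma> \<subseteq> {..nat \<bar>delta (prime_part 2 M) \<gamma>\<bar>}"
  proof
    fix l assume "l \<in> new_primes M \<gamma>"
    hence "int l dvd delta (prime_part 2 M) \<gamma>" by (simp add: new_primes_def)
    hence "\<bar>int l\<bar> \<le> \<bar>delta (prime_part 2 M) \<gamma>\<bar>" by (rule dvd_imp_le_int[OF delta_nonzero[OF assms]])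
    thus "l \<in> {..nat \<bar>delta (prime_part 2 M) \<gamma>\<bar>}" by simp
  qed
qed auto

lemma finite_Gamma_tilde: "finite (Gamma_tilde \<Gamma> M)"
proof (rule finite_subset)
  show "Gamma_tilde \<Gamma> M \<subseteq> pcls (prime_part 2 M) ` \<Gamma>"
    unfolding Gamma_tilde_def two_torsion_Gamma_mod[OF subgroup] by blast
  show "finite (pcls (prime_part 2 M) ` \<Gamma>)"
    by (rule finite_pcls_image[OF fg]) (simp add: prime_part_def)
qed

text \<open>An odd \<open>k\<close> does not change the 2-part, so \<open>Gamma_tilde\<close> stays
  the same and \<open>k\<close> only has to supply the primes of the discriminant missing from
  \<open>M\<close>.\<close>

lemma entangled_cosets_mult_odd:
  assumes M: "M > 0" and k: "odd k"
  shows "entangled_cosets \<Gamma> (M * k) = {\<gamma> \<in> Gamma_tilde \<Gamma> M. new_primes M \<gamma> \<subseteq> prime_factors k}"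
proof -
  have k0: "k > 0" using k by (auto elim: oddE)
  have pp: "prime_part 2 (M * k) = prime_part 2 M" "multiplicity 2 (M * k) = multiplicity 2 M"
    using prime_part_mult_not_dvd[OF two_is_prime_nat M k k0] by auto
  have "Gamma_tilde \<Gamma> (M * k) = Gamma_tilde \<Gamma> M" unfolding Gamma_tilde_def pp ..
  moreover have "(\<forall>l. Factorial_Ring.prime l \<and> odd l \<and> int l dvd delta (prime_part 2 M) \<gamma> \<longrightarrow> l dvd M * k) \<longleftrightarrow>
      new_primes M \<gamma> \<subseteq> prime_factors k" if "\<gamma> \<in> Gamma_tilde \<Gamma> M" for \<gamma>
  proof
    assume *: "\<forall>l. Factorial_Ring.prime l \<and> odd l \<and> int l dvd delta (prime_part 2 M) \<gamma> \<longrightarrow> l dvd M * k"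
    show "new_primes M \<gamma> \<subseteq> prime_factors k"
    proof
      fix l assume l: "l \<in> new_primes M \<gamma>"
      hence "odd l" using two_notin_new_primes[OF that M] primes_dvd_imp_eq[OF two_is_prime_nat, of l]
        by (auto simp: new_primes_def)
      thus "l \<in> prime_factors k" using * l k0 by (auto simp: new_primes_def in_prime_factors_iff prime_dvd_mult_iff)
    qed
  next
    assume "new_primes M \<gamma> \<subseteq> prime_factors k"
    thus "\<forall>l. Factorial_Ring.prime l \<and> odd l \<and> int l dvd delta (prime_part 2 M) \<gamma> \<longrightarrow> l dvd M * k"
      by (auto simp: new_primes_def in_prime_factors_iff)
  qed
  ultimately show ?thesis unfolding entangled_cosets_def pp by blast
qed

definition odd_term :: "nat \<Rightarrow> nat \<Rightarrow> real" where
  "odd_term M k = (if odd k then of_int (moebius k) * real (card (entangled_cosets \<Gamma> (M * k))) / gdeg (M * k) else 0)"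

text \<open>Counting entangled cosets is summing indicators over \<open>Gamma_tilde\<close>; for a
  fixed coset the indicator and the generic degree together form an Euler coefficient.\<close>

lemma odd_term_eq:
  assumes M: "M > 0"
  shows "odd_term M k = (\<Sum>\<gamma>\<in>Gamma_tilde \<Gamma> M. euler_coeff (coeff_at M) (new_primes M \<gamma>) k) / gdeg M"
proof (cases "squarefree k")
  case False
  thus ?thesis by (simp add: odd_term_def euler_coeff_def moebius_simps)
next
  case sq: True
  have k0: "k > 0" by (rule squarefree_nat_pos[OF sq])
  show ?thesis
  proof (cases "odd k")
    case False
    hence "2 \<in> prime_factors k" using k0 by (auto simp: in_prime_factors_iff)
    hence "(\<Prod>p\<in>prime_factors k. coeff_at M p) = 0" by (intro prod_zero bexI[of _ 2]) (auto simp: coeff_at_def)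
    thus ?thesis using False unfolding odd_term_def euler_coeff_def by (simp del: prod_zero_iff cong: if_cong)
  next
    case True
    have "(\<Prod>p\<in>prime_factors k. coeff_at M p) = (\<Prod>p\<in>prime_factors k. - 1 * loc M p)"
      using True by (intro prod.cong) (auto simp: coeff_at_def in_prime_factors_iff)
    also have "\<dots> = of_int (moebius k) * (\<Prod>p\<in>prime_factors k. loc M p)"
      unfolding prod.distrib using sq by (simp add: moebius_simps)
    finally have prod: "(\<Prod>p\<in>prime_factors k. coeff_at M p) = of_int (moebius k) * (\<Prod>p\<in>prime_factors k. loc M p)" .
    have "(\<Sum>\<gamma>\<in>Gamma_tilde \<Gamma> M. euler_coeff (coeff_at M) (new_primes M \<gamma>) k) =
      (\<Sum>\<gamma>\<in>Gamma_tilde \<Gamma> M. if new_primes M \<gamma> \<subseteq> prime_factors k then \<Prod>p\<in>prime_factors k. coeff_at M p else 0)"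
      using sq by (simp add: euler_coeff_def)
    also have "\<dots> = real (card (entangled_cosets \<Gamma> (M * k))) * (\<Prod>p\<in>prime_factors k. coeff_at M p)"
      unfolding entangled_cosets_mult_odd[OF M True]
      using finite_Gamma_tilde[of M] by (simp add: sum.If_cases Int_def)
    finally have "(\<Sum>\<gamma>\<in>Gamma_tilde \<Gamma> M. euler_coeff (coeff_at M) (new_primes M \<gamma>) k) / gdeg M =
       of_int (moebius k) * real (card (entangled_cosets \<Gamma> (M * k))) * ((\<Prod>p\<in>prime_factors k. loc M p) / gdeg M)"
      unfolding prod by simp
    also have "(\<Prod>p\<in>prime_factors k. loc M p) / gdeg M = 1 / gdeg (M * k)"
      by (rule inverse_gdeg_squarefree[OF sq M, symmetric])
    finally show ?thesis using True by (simp add: odd_term_def)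
  qed
qed

lemma suminf_euler_coeff:
  assumes M: "M > 0" and \<gamma>: "\<gamma> \<in> Gamma_tilde \<Gamma> M"
  shows "summable (euler_coeff (coeff_at M) (new_primes M \<gamma>))"
    and "suminf (euler_coeff (coeff_at M) (new_primes M \<gamma>)) =
      (\<Prod>l | Factorial_Ring.prime l \<and> l > 2 \<and> l dvd M. 1 - loc M l) * (\<Prod>l. A_factor \<Gamma> M l) *
      (\<Prod>l\<in>new_primes M \<gamma>. - 1 / ((real l - 1) * real (N l) - 1))"
proof -
  define P where "P = new_primes M \<gamma>"
  define D where "D = {l. Factorial_Ring.prime l \<and> l > 2 \<and> l dvd M}"
  define w where "w = (\<lambda>l. - 1 / ((real l - 1) * real (N l) - 1))"
  have P: "finite P" "\<And>p. p \<in> P \<Longrightarrow> Factorial_Ring.prime p \<and> p > 2 \<and> \<not> p dvd M"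
  proof -
    show "finite P" unfolding P_def by (rule finite_new_primes[OF \<gamma> M])
    show "Factorial_Ring.prime p \<and> p > 2 \<and> \<not> p dvd M" if "p \<in> P" for p
    proof -
      have p: "Factorial_Ring.prime p" "\<not> p dvd M" using that by (auto simp: P_def new_primes_def)
      moreover have "p \<noteq> 2" using that two_notin_new_primes[OF \<gamma> M] by (auto simp: P_def)
      ultimately show ?thesis using prime_ge_2_nat[OF p(1)] by auto
    qed
  qed
  have finD: "finite D" unfolding D_def by (rule finite_subset[of _ "{..M}"]) (use M in \<open>auto dest: dvd_imp_le\<close>)
  obtain C where C: "\<And>T. finite T \<Longrightarrow> (\<And>p. p \<in> T \<Longrightarrow> Factorial_Ring.prime p) \<Longrightarrow> (\<Sum>p\<in>T. \<bar>coeff_at M p\<bar>) \<le> C"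
    using coeff_at_bound[OF M] by meson
  have ep: "summable (euler_coeff (coeff_at M) P)"
    "(\<lambda>n. \<Prod>p | Factorial_Ring.prime p \<and> p \<le> n. (if p \<in> P then 0 else 1) + coeff_at M p) \<longlonglongrightarrow> suminf (euler_coeff (coeff_at M) P)"
    by (rule euler_product[OF C P(1)]; use P(2) in blast)+
  show "summable (euler_coeff (coeff_at M) (new_primes M \<gamma>))" using ep(1) by (simp add: P_def)
  obtain n0 where n0: "\<forall>l\<in>P \<union> D. l \<le> n0" using P(1) finD by (metis finite_UnI finite_nat_set_iff_bounded_le)
  \<comment> \<open>With \<open>loc M l = 1 / x\<close> this is
    \<open>-1 / x = (1 - 1 / x) * (-1 / (x - 1))\<close>. It turns the forced Euler factor into the
    factor of \<open>A_const\<close> times the factor of \<open>B_const\<close>;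
    \<open>x \<ge> 2\<close> makes the division legitimate.\<close>
  have wl: "- loc M l = (1 - loc M l) * w l" if "l \<in> P" for l
  proof -
    have l: "Factorial_Ring.prime l" "l > 2" "\<not> l dvd M" using P(2)[OF that] by auto
    define x where "x = (real l - 1) * real (N l)"
    have "loc M l = 1 / x" using loc_not_dvd[OF l(1,3)] by (simp add: x_def)
    moreover have "1 / x \<le> 1 / 2" using loc_bound(2)[OF l(1,3,2)] calculation by simp
    moreover have "x > 0" using loc_pos[OF l(1), of M] calculation(1) by simp
    ultimately have "x \<ge> 2" "loc M l = 1 / x" by (simp_all add: field_simps)
    thus ?thesis unfolding w_def x_def[symmetric] by (simp add: field_simps)
  qed
  have fin: "finite {p. Factorial_Ring.prime p \<and> p \<le> n}" for n :: nat by (rule finite_subset[of _ "{..n}"]) auto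
  \<comment> \<open>Beyond \<open>n0\<close> the finite sets \<open>P\<close> and \<open>D\<close>
    lie inside the range, so only the product of \<open>A_factor\<close> still depends on
    \<open>n\<close>.\<close>
  have eq: "(\<Prod>p | Factorial_Ring.prime p \<and> p \<le> n. (if p \<in> P then 0 else 1) + coeff_at M p) =
      (\<Prod>l\<in>D. 1 - loc M l) * (\<Prod>l\<le>n. A_factor \<Gamma> M l) * (\<Prod>l\<in>P. w l)" if n: "n \<ge> n0" for n
  proof -
    have bound: "l \<le> n" if "l \<in> P \<or> l \<in> D" for l using n0 n that order.trans by blast
    have "(\<Prod>p | Factorial_Ring.prime p \<and> p \<le> n. (if p \<in> P then 0 else 1) + coeff_at M p) =
        (\<Prod>p\<in>{..n}. if Factorial_Ring.prime p then (if p \<in> P then 0 else 1) + coeff_at M p else 1)"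
      by (subst prod.inter_filter[symmetric]) (auto intro!: prod.cong)
    also have "\<dots> = (\<Prod>p\<in>{..n}. (if p \<in> D then 1 - loc M p else 1) * A_factor \<Gamma> M p * (if p \<in> P then w p else 1))"
    proof (rule prod.cong)
      fix p
      show "(if Factorial_Ring.prime p then (if p \<in> P then 0 else 1) + coeff_at M p else 1) =
        (if p \<in> D then 1 - loc M p else 1) * A_factor \<Gamma> M p * (if p \<in> P then w p else 1)"
      proof (cases "Factorial_Ring.prime p \<and> p \<noteq> 2")
        case False
        thus ?thesis using P(2)[of p] by (auto simp: D_def A_factor_eq coeff_at_def)
      next
        case True
        hence "p > 2" using prime_ge_2_nat[of p] by auto
        thus ?thesis using True P(2)[of p] wl[of p] by (auto simp: D_def A_factor_eq coeff_at_def)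
      qed
    qed simp
    also have "\<dots> = (\<Prod>p\<in>{..n}. if p \<in> D then 1 - loc M p else 1) * (\<Prod>l\<le>n. A_factor \<Gamma> M l) *
        (\<Prod>p\<in>{..n}. if p \<in> P then w p else 1)" by (simp add: prod.distrib)
    also have "(\<Prod>p\<in>{..n}. if p \<in> D then 1 - loc M p else 1) = (\<Prod>l\<in>D. 1 - loc M l)"
      using bound by (intro prod.mono_neutral_cong_right) auto
    also have "(\<Prod>p\<in>{..n}. if p \<in> P then w p else 1) = (\<Prod>l\<in>P. w l)"
      using bound by (intro prod.mono_neutral_cong_right) auto
    finally show ?thesis .
  qed
  have "(\<lambda>n. (\<Prod>l\<in>D. 1 - loc M l) * (\<Prod>l\<le>n. A_factor \<Gamma> M l) * (\<Prod>l\<in>P. w l)) \<longlonglongrightarrow>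
      (\<Prod>l\<in>D. 1 - loc M l) * (\<Prod>l. A_factor \<Gamma> M l) * (\<Prod>l\<in>P. w l)"
    by (intro tendsto_intros convergent_prod_LIMSEQ convergent_prod_A_factor)
  moreover have "\<forall>\<^sub>F n in sequentially. (\<Prod>l\<in>D. 1 - loc M l) * (\<Prod>l\<le>n. A_factor \<Gamma> M l) * (\<Prod>l\<in>P. w l) =
     (\<Prod>p | Factorial_Ring.prime p \<and> p \<le> n. (if p \<in> P then 0 else 1) + coeff_at M p)"
    using eventually_ge_at_top[of n0] by eventually_elim (simp add: eq)
  ultimately have "(\<lambda>n. \<Prod>p | Factorial_Ring.prime p \<and> p \<le> n. (if p \<in> P then 0 else 1) + coeff_at M p) \<longlonglongrightarrow>
      (\<Prod>l\<in>D. 1 - loc M l) * (\<Prod>l. A_factor \<Gamma> M l) * (\<Prod>l\<in>P. w l)"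
    by (rule Lim_transform_eventually)
  hence "suminf (euler_coeff (coeff_at M) P) = (\<Prod>l\<in>D. 1 - loc M l) * (\<Prod>l. A_factor \<Gamma> M l) * (\<Prod>l\<in>P. w l)"
    by (rule LIMSEQ_unique[OF ep(2)])
  thus "suminf (euler_coeff (coeff_at M) (new_primes M \<gamma>)) =
      (\<Prod>l | Factorial_Ring.prime l \<and> l > 2 \<and> l dvd M. 1 - loc M l) * (\<Prod>l. A_factor \<Gamma> M l) *
      (\<Prod>l\<in>new_primes M \<gamma>. - 1 / ((real l - 1) * real (N l) - 1))"
    by (simp add: P_def D_def w_def)
qed

lemma A_const_eq:
  assumes "M > 0"
  shows "A_const \<Gamma> M = 1 / gdeg M * (\<Prod>l | Factorial_Ring.prime l \<and> l > 2 \<and> l dvd M. 1 - loc M l) * (\<Prod>l. A_factor \<Gamma> M l)"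
proof -
  have "(\<Prod>l | Factorial_Ring.prime l \<and> l > 2 \<and> l dvd M.
        1 - real (N (prime_part l M)) / (real l * real (N (l * prime_part l M)))) =
      (\<Prod>l | Factorial_Ring.prime l \<and> l > 2 \<and> l dvd M. 1 - loc M l)"
    by (intro prod.cong refl) (simp add: loc_dvd[OF _ _ assms])
  thus ?thesis unfolding A_const_def order_eq_N gdeg_def by simp
qed

lemma odd_term_sums:
  assumes M: "M > 0"
  shows "odd_term M sums (A_const \<Gamma> M * B_const \<Gamma> M)"
proof -
  define E where "E = (\<Prod>l | Factorial_Ring.prime l \<and> l > 2 \<and> l dvd M. 1 - loc M l) * (\<Prod>l. A_factor \<Gamma> M l)"
  define W where "W = (\<lambda>\<gamma>. \<Prod>l\<in>new_primes M \<gamma>. - 1 / ((real l - 1) * real (N l) - 1))"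
  have "euler_coeff (coeff_at M) (new_primes M \<gamma>) sums (E * W \<gamma>)" if "\<gamma> \<in> Gamma_tilde \<Gamma> M" for \<gamma>
    using suminf_euler_coeff[OF M that] by (auto simp: E_def W_def sums_iff)
  hence "(\<lambda>k. \<Sum>\<gamma>\<in>Gamma_tilde \<Gamma> M. euler_coeff (coeff_at M) (new_primes M \<gamma>) k) sums (\<Sum>\<gamma>\<in>Gamma_tilde \<Gamma> M. E * W \<gamma>)"
    by (rule sums_sum)
  hence "odd_term M sums ((\<Sum>\<gamma>\<in>Gamma_tilde \<Gamma> M. E * W \<gamma>) / gdeg M)"
    unfolding odd_term_eq[OF M, abs_def] by (rule sums_divide)
  also have "(\<Sum>\<gamma>\<in>Gamma_tilde \<Gamma> M. E * W \<gamma>) = E * B_const \<Gamma> M"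
    by (simp add: sum_distrib_left B_const_def W_def new_primes_def order_eq_N)
  finally show ?thesis unfolding A_const_eq[OF M] E_def by simp
qed

section \<open>From odd \<open>k\<close> to all \<open>k\<close>, and the final formula\<close>

lemma rho_term_eq:
  assumes m: "m > 0" and k: "k > 0"
  shows "rho_term \<Gamma> m k = of_int (moebius k) * real (card (entangled_cosets \<Gamma> (m * k))) / gdeg (m * k)"
proof -
  have n: "m * k > 0" using m k by simp
  define dg where "dg = degree_over_Q (Q_adjoin (insert (zeta (m * k)) (roots_of \<Gamma> (m * k))))"
  have "dg * card (entangled_cosets \<Gamma> (m * k)) = totient (m * k) * N (m * k)"
    unfolding dg_def N_def by (rule degree_formula(1)[OF subgroup fg n])
  hence "real dg * real (card (entangled_cosets \<Gamma> (m * k))) = gdeg (m * k)"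
    unfolding gdeg_def by (metis of_nat_mult)
  moreover have "gdeg (m * k) > 0" by (rule gdeg_pos[OF n])
  ultimately show ?thesis unfolding rho_term_def dg_def[symmetric] by (cases "dg = 0") (simp_all add: field_simps del: neq0_conv)
qed

text \<open>For \<open>k = 2 * j\<close> the Moebius value is minus that of \<open>j\<close> if
  \<open>j\<close> is odd and 0 otherwise, so the even terms for \<open>m\<close> are the negatives
  of the odd terms for \<open>2 * m\<close>.\<close>

lemma rho_term_sums:
  assumes m: "m > 0"
  shows "(\<lambda>k. rho_term \<Gamma> m (Suc k)) sums
    (A_const \<Gamma> m * B_const \<Gamma> m - A_const \<Gamma> (2 * m) * B_const \<Gamma> (2 * m))"
proof -
  have z: "odd_term M 0 = 0" for M by (simp add: odd_term_def)
  have shift: "(\<lambda>k. odd_term M (Suc k)) sums (A_const \<Gamma> M * B_const \<Gamma> M)" if "M > 0" for M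
    using odd_term_sums[OF that] z[of M] by (subst sums_Suc_iff) simp
  \<comment> \<open>Position \<open>k\<close> stands for the integer \<open>Suc k\<close>, so odd
    positions carry the even integers \<open>2 * j\<close> with
    \<open>j = Suc ((k - 1) div 2)\<close>.\<close>
  have "(\<lambda>k. if even k then 0 else odd_term (2 * m) (Suc ((k - 1) div 2))) sums (A_const \<Gamma> (2 * m) * B_const \<Gamma> (2 * m))"
    by (rule sums_if'[OF shift]) (use m in simp)
  from sums_diff[OF shift[OF m] this]
  have "(\<lambda>k. odd_term m (Suc k) - (if even k then 0 else odd_term (2 * m) (Suc ((k - 1) div 2)))) sums
     (A_const \<Gamma> m * B_const \<Gamma> m - A_const \<Gamma> (2 * m) * B_const \<Gamma> (2 * m))" .
  moreover have "odd_term m (Suc k) - (if even k then 0 else odd_term (2 * m) (Suc ((k - 1) div 2))) = rho_term \<Gamma> m (Suc k)" for k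
  proof (cases "even k")
    case True
    thus ?thesis using rho_term_eq[OF m, of "Suc k"] by (simp add: odd_term_def)
  next
    case False
    then obtain j where j: "k = 2 * j + 1" by (elim oddE)
    have Sk: "Suc k = 2 * Suc j" using j by simp
    have "rho_term \<Gamma> m (Suc k) = of_int (moebius (2 * Suc j)) * real (card (entangled_cosets \<Gamma> (2 * m * Suc j))) / gdeg (2 * m * Suc j)"
      using rho_term_eq[OF m, of "2 * Suc j"] unfolding Sk by (simp only: mult_ac) simp
    also have "\<dots> = - odd_term (2 * m) (Suc j)" unfolding moebius_double odd_term_def by simp
    finally show ?thesis using False j by (simp add: odd_term_def)
  qed
  ultimately show ?thesis by simp
qed

text \<open>The prime 2 does not enter the two products, so only \<open>1 / gdeg\<close> changes, by
  the local factor \<open>loc m 2\<close>; its totient part is \<open>gcd 2 m\<close>.\<close>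

lemma A_const_double:
  assumes m: "m > 0"
  shows "A_const \<Gamma> (2 * m) = A_const \<Gamma> m *
    (real (N (prime_part 2 m)) / (real (gcd 2 m) * real (N (2 * prime_part 2 m))))"
proof -
  have dvd: "l dvd 2 * m \<longleftrightarrow> l dvd m" and loc: "loc (2 * m) l = loc m l"
    if l: "Factorial_Ring.prime l" "l > 2" for l
  proof -
    have nd: "\<not> l dvd 2" using l by (auto dest: dvd_imp_le)
    thus "l dvd 2 * m \<longleftrightarrow> l dvd m" using l(1) by (simp add: prime_dvd_mult_iff)
    have "prime_part l (m * 2) = prime_part l m" using prime_part_mult_not_dvd[OF l(1) m nd] by simp
    thus "loc (2 * m) l = loc m l" by (simp add: loc_def mult.commute)
  qed
  have "(\<Prod>l | Factorial_Ring.prime l \<and> l > 2 \<and> l dvd 2 * m. 1 - loc (2 * m) l) =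
      (\<Prod>l | Factorial_Ring.prime l \<and> l > 2 \<and> l dvd m. 1 - loc m l)"
    by (rule prod.cong) (auto simp: dvd loc)
  moreover have "A_factor \<Gamma> (2 * m) = A_factor \<Gamma> m" by (rule ext) (auto simp: A_factor_eq dvd loc)
  moreover have "1 / gdeg (2 * m) = 1 / gdeg m * loc m 2"
    using gdeg_mult_prime[OF two_is_prime_nat m] gdeg_pos[OF m] gdeg_pos[of "2 * m"] m loc_pos[OF two_is_prime_nat, of m]
    by (simp add: field_simps mult.commute)
  moreover have "loc m 2 = real (N (prime_part 2 m)) / (real (gcd 2 m) * real (N (2 * prime_part 2 m)))"
  proof (cases "even m")
    case True
    thus ?thesis using loc_dvd[OF two_is_prime_nat _ m] by (simp add: gcd_nat.absorb1)
  next
    case False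
    hence "prime_part 2 m = 1" by (simp add: prime_part_def not_dvd_imp_multiplicity_0)
    moreover have "gcd 2 m = 1" using False by (simp flip: coprime_iff_gcd_eq_1)
    ultimately show ?thesis using loc_not_dvd[OF two_is_prime_nat False] N_1 by simp
  qed
  ultimately show ?thesis using m by (simp add: A_const_eq)
qed

end

text \<open>The two convergence claims give the equation its meaning: \<open>rho\<close> is a
  \<open>suminf\<close> and \<open>A_const\<close> contains an infinite product, both of which are
  total operators with arbitrary values when they diverge.\<close>

theorem theorem2:
  fixes \<Gamma> :: "rat set" and r m :: nat
  assumes "subgroup \<Gamma> Qstar" and "finitely_generated_subgroup \<Gamma>"
    and "has_rank \<Gamma> r" and "r \<ge> 1" and "m \<ge> 1"
  shows "summable (\<lambda>k. rho_term \<Gamma> m (Suc k)) \<and> convergent_prod (A_factor \<Gamma> m) \<and>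
    rho \<Gamma> m = A_const \<Gamma> m *
      (B_const \<Gamma> m
        - real (Coset.order (Gamma_mod \<Gamma> (prime_part 2 m)))
            / (real (gcd 2 m) * real (Coset.order (Gamma_mod \<Gamma> (2 * prime_part 2 m))))
          * B_const \<Gamma> (2 * m))"
proof -
  obtain g where g: "g \<in> \<Gamma>" "\<bar>g\<bar> \<noteq> 1" using has_rank_imp_nontrivial[OF assms(3,4)] .
  obtain L where L: "L > 0" "\<And>d. d > 0 \<Longrightarrow> d \<le> L * card (pcls d ` \<Gamma>)"
    using pcls_card_lower_bound[OF assms(1) finite_pcls_image[OF assms(2)] g] by blast
  interpret rank_pos_subgroup \<Gamma> L by (rule rank_pos_subgroup.intro) (use assms(1,2) L in auto)
  have m: "m > 0" using assms(5) by simp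
  note s = rho_term_sums[OF m]
  have "rho \<Gamma> m = A_const \<Gamma> m * B_const \<Gamma> m - A_const \<Gamma> (2 * m) * B_const \<Gamma> (2 * m)"
    unfolding rho_def by (rule sums_unique[OF s, symmetric])
  thus ?thesis using sums_summable[OF s] convergent_prod_A_factor[of m]
    unfolding A_const_double[OF m] order_eq_N by (simp add: algebra_simps)
qed

end
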